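(* Let $H_\kappa=-\Delta+Q_r+\kappa Q_t$ be as in the context and suppose Assumptions 2 hold. Then there exists $\kappa_1<\infty$ such that for every $\kappa\ge\kappa_1$ the operator $H_\kappa$ almost surely has pure point spectrum (at all energies).
   Context: Let $\mathbb B$ be the rooted binary tree: the root $0$ has two neighbours and every other vertex has three neighbours. $d$ is the graph distance and $S_n=\{x: d(0,x)=n\}$. Every vertex has exactly two children, one labelled $c=0$, the other $c=1$; $c(x)$ is the label of $x\ne0$. $\Delta$ is the adjacency operator. For $\kappa\ge0$, $H_\kappa=-\Delta+Q_r+\kappa Q_t$ with $Q_r(x)=q_n$ for $x\in S_n$ ($q_n$ independent, $q_0\sim\nu_0$, $q_n\sim\nu$ for $n\ge1$), $Q_t(0)=0$, $Q_t(x)=p_{n,c(x)}$ for $x\in S_n$, $n\ge1$, with $(p_{n,0},p_{n,1})$ i.i.d. $\sim\sigma$, independent of $Q_r$. Assumptions 1: $\nu_0,\nu$ have bounded densities supported in $[-K,K]$, $K<\infty$, and $\sigma$ is supported in $[-1,1]^2$. Assumptions 2: Assumptions 1 hold and in addition both one-dimensional marginal measures $\sigma_0,\sigma_1$ of $\sigma$ have bounded densities. *)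

theory Defs
  imports "HOL-Probability.Probability"
begin

text \<open>Vertices of the rooted binary tree B are finite 0/1 words (bool lists):
  the root 0 is the empty list, the children of x are x@[False] (label c=0)
  and x@[True] (label c=1); the parent of x \<noteq> [] is butlast x.
  Hence d(0,x) = length x and S_n = {x. length x = n}.\<close>

type_synonym vertex = "bool list"

definition label :: "vertex \<Rightarrow> bool" where
  "label x = last x"

definition adj :: "(vertex \<Rightarrow> complex) \<Rightarrow> vertex \<Rightarrow> complex" where
  "adj f x = f (x @ [False]) + f (x @ [True]) + (if x = [] then 0 else f (butlast x))"

definition schr :: "(vertex \<Rightarrow> real) \<Rightarrow> (vertex \<Rightarrow> complex) \<Rightarrow> vertex \<Rightarrow> complex" where
  "schr V f x = - adj f x + complex_of_real (V x) * f x"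

definition is_l2 :: "(vertex \<Rightarrow> complex) \<Rightarrow> bool" where
  "is_l2 f \<longleftrightarrow> (\<lambda>x. (cmod (f x))\<^sup>2) summable_on UNIV"

definition l2norm :: "(vertex \<Rightarrow> complex) \<Rightarrow> real" where
  "l2norm f = sqrt (infsum (\<lambda>x. (cmod (f x))\<^sup>2) UNIV)"

definition eigenvector :: "(vertex \<Rightarrow> real) \<Rightarrow> (vertex \<Rightarrow> complex) \<Rightarrow> bool" where
  "eigenvector V f \<longleftrightarrow> is_l2 f \<and> f \<noteq> (\<lambda>_. 0) \<and> (\<exists>E::complex. schr V f = (\<lambda>x. E * f x))"

definition pure_point_spectrum :: "(vertex \<Rightarrow> real) \<Rightarrow> bool" where
  "pure_point_spectrum V \<longleftrightarrow>
     (\<forall>g. is_l2 g \<longrightarrow> (\<forall>\<epsilon>>0. \<exists>F a. finite F \<and> F \<subseteq> {f. eigenvector V f} \<and>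
         l2norm (\<lambda>x. g x - (\<Sum>f\<in>F. a f * f x)) < \<epsilon>))"

text \<open>Sample space: \<omega> = (q, p) with q n = q_n and p n = (p_{n,0}, p_{n,1}).\<close>
definition tree_model :: "real measure \<Rightarrow> real measure \<Rightarrow> (real \<times> real) measure
    \<Rightarrow> ((nat \<Rightarrow> real) \<times> (nat \<Rightarrow> real \<times> real)) measure" where
  "tree_model \<nu>0 \<nu> \<sigma> =
     pair_measure (PiM UNIV (\<lambda>n. if n = 0 then \<nu>0 else \<nu>)) (PiM UNIV (\<lambda>_::nat. \<sigma>))"

definition potential :: "real \<Rightarrow> (nat \<Rightarrow> real) \<times> (nat \<Rightarrow> real \<times> real) \<Rightarrow> vertex \<Rightarrow> real" where
  "potential \<kappa> \<omega> x =
     fst \<omega> (length x) +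
     \<kappa> * (if x = [] then 0
          else (if label x then snd (snd \<omega> (length x)) else fst (snd \<omega> (length x))))"

definition has_bounded_density :: "real measure \<Rightarrow> bool" where
  "has_bounded_density \<mu> \<longleftrightarrow>
     (\<exists>f C. f \<in> borel_measurable lborel \<and> (\<forall>x. 0 \<le> f x \<and> f x \<le> C) \<and>
            \<mu> = density lborel (\<lambda>x. ennreal (f x)))"

end

theory Submission
  imports Defs "HOL-Complex_Analysis.Cauchy_Integral_Theorem"
begin

text \<open>
  Fix a vertex y at level m and cut the tree off at level L. By elimination from the leaves, an
  eigenvector of the finite tree with energy E shrinks from level j - 1 to level j by the factor
  1 / d (j, c), where d (j, c) is a continued-fraction expression in E and the potentials at levels
  at least j: all subtrees with the same root level and label agree. Write S j for
  1/8 plus the sum over c of |d (j, c)| to the power -1/2. Since p (j, c) has a bounded density,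
  averaging over p at level j alone gives E[S j] at most 1/4 once \<kappa> is large, so the weight
  F(E), the sum over n of 2^n S (m+1) ... S (m+n), has expectation at most 2 for every E and L.

  F does not depend on q m, and averaging over q m bounds the mean spectral measure of y by a
  multiple of Lebesgue measure: the resolvent entry at y extends holomorphically in t = q m to the
  lower half plane, with modulus at most 1 / |Im t|. Hence F is integrable, uniformly in L,
  against the mean spectral measure of y. So up to a spectral mass \<epsilon>, the vertex y sees only
  eigenvectors with F at most M; these are uniformly concentrated near the root, so their number is
  bounded independently of L. By compactness they converge along a subsequence of L, and the
  limits are eigenvectors on the infinite tree whose span comes within \<epsilon> of the delta function
  at y.
\<close>

section \<open>Elimination on the finite tree\<close>

text \<open>\<open>q m\<close> moves all 2^m vertices of level m at once, so averaging over it is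
  not rank-one spectral averaging; what survives is that the resolvent entry at y is controlled by
  the imaginary part of the coefficient at y alone. The transversal potential is rigid too: vertices
  with the same level and label share it. This rigidity lets the sum over the vertices of a level
  factor into one term per level, and averaging from the root side outwards peels these off one by
  one. The exponent 1/2 keeps |u|^(-1/2) integrable under a bounded density, and it still controls
  mass because f^2 \<le> sqrt |f| when |f| \<le> 1. The summand 1/8 stops the other levels from
  compensating a level whose denominator tends to 0, so F blows up near such an energy. For \<kappa>
  \<ge> 4096 C each inverse root has mean at most 1/16, whence 1/8 + 1/16 + 1/16 = 1/4; the weight
  2^n forces decay and still leaves a geometric series against 4^(-n). The uniform count of
  eigenvectors keeps spectral mass from dispersing over more and more of them as L grows.\<close>

fun self_energy :: "(nat \<Rightarrow> bool \<Rightarrow> complex) \<Rightarrow> nat \<Rightarrow> nat \<Rightarrow> complex" where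
  "self_energy w n 0 = 0"
| "self_energy w n (Suc k) =
     1 / (w (Suc n) False - self_energy w (Suc n) k) + 1 / (w (Suc n) True - self_energy w (Suc n) k)"

text \<open>Here \<open>w\<close> stands for potential minus spectral parameter. Then
  \<open>1 / denom\<close> is the resolvent entry, at its own root, of the subtree hanging from a
  vertex of level j and label c, detached from the rest and cut off at L: a Schur complement over
  the levels below.\<close>

definition denom :: "(nat \<Rightarrow> bool \<Rightarrow> complex) \<Rightarrow> nat \<Rightarrow> nat \<Rightarrow> bool \<Rightarrow> complex" where
  "denom w L j c = w j c - self_energy w j (L - j)"

text \<open>The word is read upwards from a vertex to the root, hence \<open>rev y\<close> below.
  The value is the diagonal coefficient left at the vertex once everything except its descendants is
  eliminated; the subtree of the sibling enters through the label \<open>\<not> c\<close>. The root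
  carries the label False by convention, as in \<open>site\<close>.\<close>

fun updiag :: "(nat \<Rightarrow> bool \<Rightarrow> complex) \<Rightarrow> nat \<Rightarrow> bool list \<Rightarrow> complex" where
  "updiag w L [] = w 0 False"
| "updiag w L (c # r) = w (Suc (length r)) c -
     1 / (updiag w L r - 1 / denom w L (Suc (length r)) (\<not> c))"

definition green_diag :: "(nat \<Rightarrow> bool \<Rightarrow> complex) \<Rightarrow> nat \<Rightarrow> vertex \<Rightarrow> complex" where
  "green_diag w L y = 1 / (updiag w L (rev y) - self_energy w (length y) (L - length y))"

definition site :: "(nat \<Rightarrow> bool \<Rightarrow> complex) \<Rightarrow> vertex \<Rightarrow> complex" where
  "site w x = w (length x) (x \<noteq> [] \<and> last x)"

lemma self_energy_denom:
  assumes "n < L"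
  shows "self_energy w n (L - n) = 1 / denom w L (Suc n) False + 1 / denom w L (Suc n) True"
proof -
  obtain k where "L - n = Suc k" "L - Suc n = k" using assms by (metis Suc_diff_Suc)
  then show ?thesis by (simp add: denom_def)
qed

text \<open>Each vertex is solved in terms of its parent, starting at the leaves. Division happens
  only strictly below v, so in product form a zero of the denominator at v itself is
  harmless.\<close>

lemma denom_mult_eq_parent:
  assumes van: "\<And>x. length x > L \<Longrightarrow> \<phi> x = 0"
    and eq: "\<And>u. length (v @ u) \<le> L \<Longrightarrow> site w (v @ u) * \<phi> (v @ u) = adj \<phi> (v @ u)"
    and v: "v \<noteq> []" "length v \<le> L"
    and nz: "\<And>j c. length v < j \<Longrightarrow> j \<le> L \<Longrightarrow> denom w L j c \<noteq> 0"
  shows "denom w L (length v) (last v) * \<phi> v = \<phi> (butlast v)"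
  using eq v nz
proof (induction "L - length v" arbitrary: v)
  case 0
  then have l: "length v = L" by simp
  have "site w v * \<phi> v = adj \<phi> v" using 0(2)[of "[]"] l by simp
  then show ?case using 0 l by (simp add: adj_def van denom_def site_def)
next
  case (Suc k)
  have l: "length v < L" using Suc(2) by simp
  have ch: "denom w L (Suc (length v)) c * \<phi> (v @ [c]) = \<phi> v" for c
  proof -
    have "denom w L (length (v @ [c])) (last (v @ [c])) * \<phi> (v @ [c]) = \<phi> (butlast (v @ [c]))"
    proof (rule Suc.hyps(1))
      show "k = L - length (v @ [c])" using Suc(2) by simp
      show "site w ((v @ [c]) @ u) * \<phi> ((v @ [c]) @ u) = adj \<phi> ((v @ [c]) @ u)"
        if "length ((v @ [c]) @ u) \<le> L" for u
        using Suc.prems(1)[of "c # u"] that by simp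
    qed (use l Suc.prems in auto)
    then show ?thesis by simp
  qed
  have ch': "\<phi> (v @ [c]) = \<phi> v / denom w L (Suc (length v)) c" for c
    using ch[of c] Suc.prems(4)[of "Suc (length v)" c] l by (simp add: field_simps)
  have "site w v * \<phi> v = adj \<phi> v" using Suc.prems(1)[of "[]"] l by simp
  then show ?case
    using Suc.prems l self_energy_denom[OF l, of w]
    by (simp add: adj_def ch' denom_def[of w L "length v"] site_def algebra_simps)
qed

section \<open>Elimination preserves half planes\<close>

lemma Im_inverse_pos:
  fixes z :: complex
  assumes "Im z < 0"
  shows "Im (1 / z) > 0"
  using assms by (simp add: Im_divide divide_neg_pos sum_power2_gt_zero_iff)

lemma Im_self_energy_nonneg:
  assumes "\<And>j c. n < j \<Longrightarrow> j \<le> n + k \<Longrightarrow> Im (w j c) < 0"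
  shows "Im (self_energy w n k) \<ge> 0"
  using assms
proof (induction k arbitrary: n)
  case (Suc k)
  have "Im (self_energy w (Suc n) k) \<ge> 0" by (rule Suc.IH) (use Suc.prems in auto)
  then have "Im (w (Suc n) c - self_energy w (Suc n) k) < 0" for c
    using Suc.prems[of "Suc n" c] by simp
  then show ?case using Im_inverse_pos by (simp add: add_nonneg_nonneg less_imp_le)
qed simp

lemma Im_denom_neg:
  assumes "\<And>j c. j \<le> L \<Longrightarrow> Im (w j c) < 0" and "j \<le> L"
  shows "Im (denom w L j c) < 0"
proof -
  have "Im (self_energy w j (L - j)) \<ge> 0" by (rule Im_self_energy_nonneg) (use assms in auto)
  then show ?thesis using assms(1)[of j c] assms(2) by (simp add: denom_def)
qed

lemma Im_updiag_le:
  assumes "\<And>j c. j \<le> L \<Longrightarrow> Im (w j c) < 0" and "length r \<le> L"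
  shows "Im (updiag w L r) \<le> Im (w (length r) (r \<noteq> [] \<and> hd r))"
  using assms(2)
proof (induction r)
  case (Cons c r)
  have "Im (updiag w L r) < 0"
    using Cons assms(1)[of "length r" "r \<noteq> [] \<and> hd r"] by simp
  moreover have "Im (1 / denom w L (Suc (length r)) (\<not> c)) > 0"
    by (rule Im_inverse_pos, rule Im_denom_neg) (use assms Cons in auto)
  ultimately have "Im (1 / (updiag w L r - 1 / denom w L (Suc (length r)) (\<not> c))) > 0"
    by (intro Im_inverse_pos) (simp)
  then show ?case by simp
qed simp

lemma Im_green_denominator_le:
  assumes "\<And>j c. j \<le> L \<Longrightarrow> Im (w j c) < 0" and "length y \<le> L"
  shows "Im (updiag w L (rev y) - self_energy w (length y) (L - length y)) \<le> Im (site w y)"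
proof -
  have "Im (updiag w L (rev y)) \<le> Im (site w y)"
    using Im_updiag_le[of L w "rev y"] assms(1) assms(2) by (simp add: site_def hd_rev)
  moreover have "Im (self_energy w (length y) (L - length y)) \<ge> 0"
    by (rule Im_self_energy_nonneg) (use assms in auto)
  ultimately show ?thesis by simp
qed

text \<open>Eliminating the other vertices can only push the remaining coefficient at y further into
  the lower half plane. Hence the imaginary part at y alone gives the bound, however small the
  imaginary parts elsewhere.\<close>

lemma cmod_green_diag_le:
  assumes "\<And>j c. j \<le> L \<Longrightarrow> Im (w j c) < 0" and "length y \<le> L"
  shows "cmod (green_diag w L y) \<le> 1 / (- Im (site w y))" "Im (green_diag w L y) > 0"
proof -
  let ?b = "updiag w L (rev y) - self_energy w (length y) (L - length y)"
  have b: "Im ?b \<le> Im (site w y)" by (rule Im_green_denominator_le) (use assms in auto)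
  have n: "Im (site w y) < 0" using assms by (simp add: site_def)
  have "- Im (site w y) \<le> cmod ?b" using b abs_Im_le_cmod[of ?b] n by linarith
  then show "cmod (green_diag w L y) \<le> 1 / (- Im (site w y))"
    using n by (simp add: green_diag_def norm_divide divide_simps)
  show "Im (green_diag w L y) > 0" unfolding green_diag_def using b n by (intro Im_inverse_pos) linarith
qed

text \<open>This is the uniqueness half: any solution of the resolvent equation has the continued
  fraction as its value at y, and an eigenfunction expansion will supply such a solution. Side
  subtrees that avoid y are folded from the leaves, the path to y from the root.\<close>

lemma green_diag_eq:
  assumes neg: "\<And>j c. j \<le> L \<Longrightarrow> Im (w j c) < 0" and y: "length y \<le> L"
    and van: "\<And>x. length x > L \<Longrightarrow> \<psi> x = 0"
    and eq: "\<And>x. length x \<le> L \<Longrightarrow> site w x * \<psi> x - adj \<psi> x = (if x = y then 1 else 0)"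
  shows "\<psi> y = green_diag w L y"
proof -
  have nz: "denom w L j c \<noteq> 0" if "j \<le> L" for j c using Im_denom_neg[of L w j c] neg that by force
  have off: "\<psi> v = \<psi> (butlast v) / denom w L (length v) (last v)"
    if v: "v \<noteq> []" "length v \<le> L" and no: "\<And>u. v @ u \<noteq> y" for v
  proof -
    have "denom w L (length v) (last v) * \<psi> v = \<psi> (butlast v)"
    proof (rule denom_mult_eq_parent[OF van])
      show "site w (v @ u) * \<psi> (v @ u) = adj \<psi> (v @ u)" if "length (v @ u) \<le> L" for u
        using eq[OF that] no[of u] by simp
    qed (use v nz in auto)
    then show ?thesis using nz[of "length v" "last v"] v by (simp add: field_simps)
  qed
  \<comment> \<open>Descent along the path: when x is left for its child towards y, the sibling
    subtree is absorbed by \<open>off\<close>, and the equation at x, where the source vanishes,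
    removes x itself.\<close>
  have up: "updiag w L (rev x) * \<psi> x = site w x * \<psi> x - (if x = [] then 0 else \<psi> (butlast x))"
    if "y = x @ u" for x u
    using that
  proof (induction x arbitrary: u rule: rev_induct)
    case Nil
    then show ?case by (simp add: site_def)
  next
    case (snoc c x)
    have IH: "updiag w L (rev x) * \<psi> x = site w x * \<psi> x - (if x = [] then 0 else \<psi> (butlast x))"
      using snoc.IH[of "c # u"] snoc.prems by simp
    have lx: "length x < L" using snoc.prems y by simp
    have sib: "\<psi> (x @ [\<not> c]) = \<psi> x / denom w L (Suc (length x)) (\<not> c)"
      using off[of "x @ [\<not> c]"] lx snoc.prems by auto
    have e: "site w x * \<psi> x - adj \<psi> x = 0" using eq[of x] lx snoc.prems by simp
    have a: "adj \<psi> x = \<psi> (x @ [c]) + \<psi> (x @ [\<not> c]) + (if x = [] then 0 else \<psi> (butlast x))"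
      by (cases c) (auto simp: adj_def)
    let ?d = "updiag w L (rev x) - 1 / denom w L (Suc (length x)) (\<not> c)"
    have "?d * \<psi> x = \<psi> (x @ [c])"
      using IH e a sib by (simp add: algebra_simps)
    moreover have "?d \<noteq> 0"
    proof -
      have "Im (updiag w L (rev x)) < 0"
      proof -
        have "Im (updiag w L (rev x)) \<le> Im (site w x)"
          using Im_updiag_le[of L w "rev x"] neg lx by (simp add: hd_rev site_def)
        moreover have "Im (site w x) < 0" using neg lx by (simp add: site_def)
        ultimately show ?thesis by simp
      qed
      moreover have "Im (1 / denom w L (Suc (length x)) (\<not> c)) > 0"
        by (rule Im_inverse_pos, rule Im_denom_neg) (use neg lx in auto)
      ultimately have "Im ?d < 0" by (simp)
      then show ?thesis by force
    qed
    ultimately have "\<psi> x = \<psi> (x @ [c]) / ?d" by (simp add: field_simps)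
    then show ?case by (simp add: site_def algebra_simps)
  qed
  have U: "updiag w L (rev y) * \<psi> y = site w y * \<psi> y - (if y = [] then 0 else \<psi> (butlast y))"
    using up[of y "[]"] by simp
  have E: "site w y * \<psi> y - adj \<psi> y = 1" using eq[OF y] by simp
  have C: "\<psi> (y @ [False]) + \<psi> (y @ [True]) = self_energy w (length y) (L - length y) * \<psi> y"
  proof (cases "length y < L")
    case True
    have "\<psi> (y @ [c]) = \<psi> y / denom w L (Suc (length y)) c" for c
      using off[of "y @ [c]"] True by simp
    then show ?thesis using self_energy_denom[OF True, of w] by (simp add: algebra_simps)
  next
    case False
    then show ?thesis using y van by simp
  qed
  let ?b = "updiag w L (rev y) - self_energy w (length y) (L - length y)"
  have "?b * \<psi> y = 1" using U E C by (simp add: adj_def algebra_simps)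
  then show ?thesis unfolding green_diag_def by (metis mult_zero_left nonzero_eq_divide_eq mult.commute zero_neq_one)
qed

section \<open>Spectral theorem for symmetric matrices\<close>

text \<open>First variation: for small e the linear term dominates. The choice
  \<open>b / (\<bar>c\<bar> + 1)\<close> makes the quadratic correction at most half of the linear
  term.\<close>

lemma quadratic_perturbation_zero:
  fixes b c :: real
  assumes "\<And>e. e > 0 \<Longrightarrow> 2 * e * b + e\<^sup>2 * c \<le> 0" and "b \<ge> 0"
  shows "b = 0"
proof (rule ccontr)
  assume "b \<noteq> 0"
  then have b: "b > 0" using assms by simp
  define e where "e = b / (\<bar>c\<bar> + 1)"
  have e: "e > 0" unfolding e_def using b by (simp add: add_nonneg_pos)
  have "e * (2 * b + e * c) \<le> 0"
    using assms(1)[OF e] by (simp add: power2_eq_square algebra_simps)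
  then have "2 * b + e * c \<le> 0" using e by (simp add: mult_le_0_iff)
  moreover have "e * \<bar>c\<bar> \<le> b" unfolding e_def using b by (simp add: field_simps)
  moreover have "e * c \<ge> - (e * \<bar>c\<bar>)" using e by (simp add: abs_if)
  ultimately show False using b by linarith
qed

text \<open>The squared distance from the delta at x to the span of the family has two uses: it is
  positive for some x while n < \<open>card X\<close>, which gives a new start vector, and it
  vanishes for every x when n = \<open>card X\<close>, which gives completeness.\<close>

lemma orthonormal_family_Bessel:
  fixes p :: "nat \<Rightarrow> 'a \<Rightarrow> real"
  assumes fin: "finite X" and x: "x \<in> X"
    and on: "\<And>i j. i < n \<Longrightarrow> j < n \<Longrightarrow> (\<Sum>z\<in>X. p i z * p j z) = (if i = j then 1 else 0)"
  shows "(\<Sum>z\<in>X. ((if z = x then 1 else 0) - (\<Sum>i<n. p i x * p i z))\<^sup>2) = 1 - (\<Sum>i<n. (p i x)\<^sup>2)"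
proof -
  let ?s = "\<lambda>z. \<Sum>i<n. p i x * p i z"
  have 1: "(\<Sum>z\<in>X. (?s z)\<^sup>2) = (\<Sum>i<n. (p i x)\<^sup>2)"
  proof -
    have "(\<Sum>z\<in>X. (?s z)\<^sup>2) = (\<Sum>z\<in>X. \<Sum>i<n. \<Sum>j<n. (p i x * p j x) * (p i z * p j z))"
      by (simp add: power2_eq_square sum_product algebra_simps)
    also have "\<dots> = (\<Sum>i<n. \<Sum>j<n. \<Sum>z\<in>X. (p i x * p j x) * (p i z * p j z))"
      by (subst sum.swap, rule sum.cong[OF refl], rule sum.swap)
    also have "\<dots> = (\<Sum>i<n. \<Sum>j<n. (p i x * p j x) * (if i = j then 1 else 0))"
      by (intro sum.cong refl) (simp add: on flip: sum_distrib_left)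
    also have "\<dots> = (\<Sum>i<n. (p i x)\<^sup>2)"
      by (simp add: if_distrib[of "(*) _"] power2_eq_square cong: if_cong)
    finally show ?thesis .
  qed
  have "(\<Sum>z\<in>X. ((if z = x then 1 else 0) - ?s z)\<^sup>2)
      = (\<Sum>z\<in>X. (if z = x then 1 else 0) - 2 * (if z = x then ?s z else 0) + (?s z)\<^sup>2)"
    by (intro sum.cong refl) (simp add: power2_eq_square algebra_simps)
  also have "\<dots> = 1 - 2 * ?s x + (\<Sum>i<n. (p i x)\<^sup>2)"
    using fin x by (simp add: sum.distrib sum_subtractf 1 flip: sum_distrib_left)
  finally show ?thesis by (simp add: power2_eq_square)
qed

text \<open>Rayleigh's principle: maximize the quadratic form over unit vectors orthogonal to the
  eigenvectors already found. The vector \<open>f0\<close> certifies that there are such unit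
  vectors.\<close>

lemma symmetric_eigenvector_exists:
  fixes a :: "'a::countable \<Rightarrow> 'a \<Rightarrow> real" and p :: "nat \<Rightarrow> 'a \<Rightarrow> real"
  assumes fin: "finite X" and sym: "\<And>x y. x \<in> X \<Longrightarrow> y \<in> X \<Longrightarrow> a x y = a y x"
    and eig: "\<And>i x. i < n \<Longrightarrow> x \<in> X \<Longrightarrow> (\<Sum>y\<in>X. a x y * p i y) = e i * p i x"
    and f0: "\<And>i. i < n \<Longrightarrow> (\<Sum>z\<in>X. p i z * f0 z) = 0" "(\<Sum>z\<in>X. (f0 z)\<^sup>2) > 0"
  shows "\<exists>f \<mu>. (\<forall>x. x \<notin> X \<longrightarrow> f x = 0) \<and> (\<Sum>z\<in>X. (f z)\<^sup>2) = 1 \<and>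
    (\<forall>i<n. (\<Sum>z\<in>X. p i z * f z) = 0) \<and> (\<forall>x\<in>X. (\<Sum>y\<in>X. a x y * f y) = \<mu> * f x)"
proof -
  define N where "N f = (\<Sum>z\<in>X. (f z)\<^sup>2)" for f :: "'a \<Rightarrow> real"
  define A where "A f x = (\<Sum>y\<in>X. a x y * f y)" for f :: "'a \<Rightarrow> real" and x
  define q where "q f = (\<Sum>x\<in>X. f x * A f x)" for f
  \<comment> \<open>Forcing the value 0 off X makes the constraint set a closed part of a product of
    compact sets, so the maximum is attained.\<close>
  define B where "B = PiE UNIV (\<lambda>x. if x \<in> X then {-1..1} else {0::real})"
  define C where "C = B \<inter> {f. N f = 1 \<and> (\<forall>i<n. (\<Sum>z\<in>X. p i z * f z) = 0)}"
  have coord: "continuous_on UNIV (\<lambda>f::'a \<Rightarrow> real. f x)" for x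
    by (rule continuous_on_product_coordinates)
  have "compact B" unfolding B_def compactin_euclidean_iff[symmetric] euclidean_product_topology[symmetric]
    by (subst compactin_PiE) auto
  moreover have "closed {f. N f = 1 \<and> (\<forall>i<n. (\<Sum>z\<in>X. p i z * f z) = 0)}"
    unfolding N_def
    by (intro closed_Collect_conj closed_Collect_all closed_Collect_imp closed_Collect_eq
       continuous_intros coord open_Collect_const)
  ultimately have C: "compact C" unfolding C_def by (rule compact_Int_closed)
  have normalize: "(\<lambda>x. if x \<in> X then f x / sqrt (N f) else 0) \<in> C"
    if "N f > 0" "\<And>i. i < n \<Longrightarrow> (\<Sum>z\<in>X. p i z * f z) = 0" for f
  proof -
    have "(f x)\<^sup>2 \<le> N f" if "x \<in> X" for x
      unfolding N_def using fin that by (intro member_le_sum) auto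
    then have "\<bar>f x\<bar> \<le> sqrt (N f)" if "x \<in> X" for x
      using that real_sqrt_le_mono[of "(f x)\<^sup>2" "N f"] by simp
    then have "\<bar>f x / sqrt (N f)\<bar> \<le> 1" if "x \<in> X" for x
      using that \<open>N f > 0\<close> by (simp add: abs_divide)
    then have "- 1 \<le> f x / sqrt (N f) \<and> f x / sqrt (N f) \<le> 1" if "x \<in> X" for x
      using that by (metis abs_le_iff minus_le_iff)
    then have 1: "(\<lambda>x. if x \<in> X then f x / sqrt (N f) else 0) \<in> B"
      unfolding B_def by auto
    have "N (\<lambda>x. if x \<in> X then f x / sqrt (N f) else 0) = (\<Sum>z\<in>X. (f z)\<^sup>2 / N f)"
      unfolding N_def[of "\<lambda>x. if x \<in> X then f x / sqrt (N f) else 0"]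
      using that(1) by (intro sum.cong) (auto simp: power_divide)
    also have "\<dots> = 1" using that(1) by (simp add: N_def flip: sum_divide_distrib)
    finally have 2: "N (\<lambda>x. if x \<in> X then f x / sqrt (N f) else 0) = 1" .
    have "(\<Sum>z\<in>X. p i z * (if z \<in> X then f z / sqrt (N f) else 0)) = (\<Sum>z\<in>X. p i z * f z) / sqrt (N f)" for i
      by (simp add: sum_divide_distrib)
    with 1 2 that(2) show ?thesis unfolding C_def by simp
  qed
  have "C \<noteq> {}" using normalize[of f0] f0 by (auto simp: N_def)
  moreover have "continuous_on C q"
    unfolding q_def A_def by (intro continuous_intros continuous_on_subset[OF coord]) auto
  ultimately obtain f where fC: "f \<in> C" and max: "\<And>g. g \<in> C \<Longrightarrow> q g \<le> q f"
    using continuous_attains_sup[OF C] by blast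
  have Nf: "N f = 1" and orth: "\<And>i. i < n \<Longrightarrow> (\<Sum>z\<in>X. p i z * f z) = 0"
    and supp: "\<And>x. x \<notin> X \<Longrightarrow> f x = 0"
    using fC unfolding C_def B_def by (auto simp: PiE_iff split: if_splits)
  have qhom: "q (\<lambda>x. if x \<in> X then g x / r else 0) = q g / r\<^sup>2" for g r
    unfolding q_def A_def by (simp add: sum_divide_distrib power2_eq_square sum_distrib_left field_simps)
  have max': "q g \<le> q f * N g" if "N g > 0" "\<And>i. i < n \<Longrightarrow> (\<Sum>z\<in>X. p i z * g z) = 0" for g
    using max[OF normalize[OF that]] that(1) by (simp add: qhom field_simps)
  have symA: "(\<Sum>x\<in>X. g x * A h x) = (\<Sum>x\<in>X. A g x * h x)" for g h
  proof -
    have "(\<Sum>x\<in>X. g x * A h x) = (\<Sum>x\<in>X. \<Sum>y\<in>X. a x y * g x * h y)"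
      unfolding A_def by (simp add: sum_distrib_left algebra_simps)
    also have "\<dots> = (\<Sum>y\<in>X. \<Sum>x\<in>X. a x y * g x * h y)" by (rule sum.swap)
    also have "\<dots> = (\<Sum>y\<in>X. \<Sum>x\<in>X. a y x * g x * h y)" using sym by (intro sum.cong refl) auto
    also have "\<dots> = (\<Sum>y\<in>X. A g y * h y)" unfolding A_def by (simp add: sum_distrib_right)
    finally show ?thesis .
  qed
  \<comment> \<open>This is the residual of the eigenvalue equation. It is orthogonal to f and, by
    symmetry of a, to every \<open>p i\<close>, so f + \<epsilon> g is an admissible variation;
    maximality then forces \<open>N g = 0\<close>.\<close>
  define g where "g x = A f x - q f * f x" for x
  have fg: "(\<Sum>x\<in>X. f x * g x) = 0"
  proof -
    have "(\<Sum>x\<in>X. f x * g x) = (\<Sum>x\<in>X. f x * A f x - q f * (f x)\<^sup>2)"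
      unfolding g_def by (intro sum.cong refl) (simp add: power2_eq_square algebra_simps)
    also have "\<dots> = q f - q f * N f"
      unfolding N_def sum_distrib_left sum_subtractf by (simp add: q_def)
    finally have "(\<Sum>x\<in>X. f x * g x) = q f - q f * N f" .
    then show ?thesis using Nf by simp
  qed
  have pg: "(\<Sum>z\<in>X. p i z * g z) = 0" if "i < n" for i
  proof -
    have "(\<Sum>z\<in>X. p i z * g z) = (\<Sum>z\<in>X. p i z * A f z) - q f * (\<Sum>z\<in>X. p i z * f z)"
      unfolding g_def by (simp add: right_diff_distrib sum_subtractf sum_distrib_left algebra_simps)
    also have "(\<Sum>z\<in>X. p i z * A f z) = (\<Sum>z\<in>X. A (p i) z * f z)" by (rule symA)
    also have "\<dots> = e i * (\<Sum>z\<in>X. p i z * f z)"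
      unfolding A_def using eig[OF that] by (simp add: sum_distrib_left mult.assoc)
    finally show ?thesis using orth[OF that] by simp
  qed
  have Ng: "N g \<ge> 0" unfolding N_def by (intro sum_nonneg) auto
  have "N g = 0"
  proof (rule quadratic_perturbation_zero[of _ "q g - q f * N g"])
    fix \<epsilon> :: real assume e: "\<epsilon> > 0"
    let ?h = "\<lambda>x. f x + \<epsilon> * g x"
    have Nh: "N ?h = 1 + \<epsilon>\<^sup>2 * N g"
    proof -
      have "N ?h = N f + 2 * \<epsilon> * (\<Sum>x\<in>X. f x * g x) + \<epsilon>\<^sup>2 * N g"
        unfolding N_def by (simp add: power2_eq_square sum.distrib sum_distrib_left algebra_simps)
      then show ?thesis using fg Nf by simp
    qed
    have Ah: "A ?h x = A f x + \<epsilon> * A g x" for x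
      unfolding A_def by (simp add: distrib_left sum.distrib sum_distrib_left algebra_simps)
    have gAf: "(\<Sum>x\<in>X. g x * A f x) = N g"
    proof -
      have "(\<Sum>x\<in>X. g x * A f x) = (\<Sum>x\<in>X. g x * g x + q f * (f x * g x))"
        unfolding g_def by (intro sum.cong refl) (simp add: algebra_simps)
      then show ?thesis using fg by (simp add: N_def power2_eq_square sum.distrib flip: sum_distrib_left)
    qed
    have fAg: "(\<Sum>x\<in>X. f x * A g x) = N g" using symA[of f g] gAf by (simp add: mult.commute)
    have "q ?h = q f + \<epsilon> * (\<Sum>x\<in>X. g x * A f x) + \<epsilon> * (\<Sum>x\<in>X. f x * A g x) + \<epsilon>\<^sup>2 * q g"
      unfolding q_def Ah by (simp add: power2_eq_square sum.distrib sum_distrib_left algebra_simps)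
    then have "q ?h = q f + 2 * \<epsilon> * N g + \<epsilon>\<^sup>2 * q g" using gAf fAg by simp
    moreover have "q ?h \<le> q f * N ?h"
    proof (rule max')
      show "N ?h > 0" unfolding Nh using Ng by (simp add: add_pos_nonneg)
      show "(\<Sum>z\<in>X. p i z * ?h z) = 0" if "i < n" for i
      proof -
        have "(\<Sum>z\<in>X. p i z * ?h z) = (\<Sum>z\<in>X. p i z * f z) + \<epsilon> * (\<Sum>z\<in>X. p i z * g z)"
          by (simp add: distrib_left sum.distrib sum_distrib_left algebra_simps)
        then show ?thesis using orth pg that by simp
      qed
    qed
    ultimately show "2 * \<epsilon> * N g + \<epsilon>\<^sup>2 * (q g - q f * N g) \<le> 0"
      unfolding Nh by (simp add: algebra_simps)
  qed (rule Ng)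
  then have "g x = 0" if "x \<in> X" for x
    using that fin unfolding N_def by (simp add: sum_nonneg_eq_0_iff)
  then have "\<And>x. x \<in> X \<Longrightarrow> (\<Sum>y\<in>X. a x y * f y) = q f * f x"
    unfolding g_def A_def by simp
  with supp Nf orth show ?thesis
    unfolding N_def by (intro exI[of _ f] exI[of _ "q f"]) simp
qed

lemma symmetric_orthonormal_eigenvectors:
  fixes a :: "'a::countable \<Rightarrow> 'a \<Rightarrow> real"
  assumes fin: "finite X" and sym: "\<And>x y. x \<in> X \<Longrightarrow> y \<in> X \<Longrightarrow> a x y = a y x"
    and "n \<le> card X"
  shows "\<exists>(p :: nat \<Rightarrow> 'a \<Rightarrow> real) (e :: nat \<Rightarrow> real). (\<forall>i<n. \<forall>x. x \<notin> X \<longrightarrow> p i x = 0) \<and>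
    (\<forall>i<n. \<forall>j<n. (\<Sum>z\<in>X. p i z * p j z) = (if i = j then 1 else (0::real))) \<and>
    (\<forall>i<n. \<forall>x\<in>X. (\<Sum>y\<in>X. a x y * p i y) = e i * p i x)"
    (is "\<exists>p e. ?Q n p e")
  using assms(3)
proof (induction n)
  case (Suc n)
  from Suc.IH[OF Suc_leD[OF Suc.prems]] obtain p where "\<exists>e. ?Q n p e" ..
  then obtain e where pe: "?Q n p e" ..
  then have supp: "\<And>i x. i < n \<Longrightarrow> x \<notin> X \<Longrightarrow> p i x = 0"
    and on: "\<And>i j. i < n \<Longrightarrow> j < n \<Longrightarrow> (\<Sum>z\<in>X. p i z * p j z) = (if i = j then 1 else 0)"
    and eig: "\<And>i x. i < n \<Longrightarrow> x \<in> X \<Longrightarrow> (\<Sum>y\<in>X. a x y * p i y) = e i * p i x"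
    by blast+
  \<comment> \<open>A trace count: n orthonormal vectors take only n out of the total
    \<open>card X\<close>, so some delta lies outside their span.\<close>
  have "(\<Sum>x\<in>X. 1 - (\<Sum>i<n. (p i x)\<^sup>2)) = card X - n"
  proof -
    have "(\<Sum>x\<in>X. \<Sum>i<n. (p i x)\<^sup>2) = (\<Sum>i<n. \<Sum>x\<in>X. p i x * p i x)"
      by (subst sum.swap) (simp add: power2_eq_square)
    also have "\<dots> = n" by (simp add: on)
    finally show ?thesis using Suc.prems by (simp add: sum_subtractf)
  qed
  then have "(\<Sum>x\<in>X. 1 - (\<Sum>i<n. (p i x)\<^sup>2)) > 0" using Suc.prems by simp
  then obtain x where x: "x \<in> X" "1 - (\<Sum>i<n. (p i x)\<^sup>2) > 0"
    by (meson sum_nonpos not_le)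
  define f0 where "f0 z = (if z = x then 1 else 0) - (\<Sum>i<n. p i x * p i z)" for z
  have f0: "(\<Sum>z\<in>X. (f0 z)\<^sup>2) > 0"
    unfolding f0_def using orthonormal_family_Bessel[OF fin x(1), of n p] on x(2) by simp
  have orth: "(\<Sum>z\<in>X. p i z * f0 z) = 0" if "i < n" for i
  proof -
    have "(\<Sum>z\<in>X. p i z * f0 z) = (\<Sum>z\<in>X. if z = x then p i z else 0) - (\<Sum>z\<in>X. \<Sum>j<n. p j x * (p i z * p j z))"
      unfolding f0_def sum_subtractf[symmetric]
      by (intro sum.cong refl) (simp add: algebra_simps sum_distrib_left)
    also have "(\<Sum>z\<in>X. \<Sum>j<n. p j x * (p i z * p j z)) = (\<Sum>j<n. p j x * (if i = j then 1 else 0))"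
      by (subst sum.swap) (simp add: on that flip: sum_distrib_left)
    also have "\<dots> = p i x" using that by (simp add: if_distrib[of "(*) _"] cong: if_cong)
    finally show ?thesis using fin x(1) by simp
  qed
  let ?R = "\<lambda>f \<mu>. (\<forall>x. x \<notin> X \<longrightarrow> f x = 0) \<and> (\<Sum>z\<in>X. (f z)\<^sup>2) = 1 \<and>
    (\<forall>i<n. (\<Sum>z\<in>X. p i z * f z) = 0) \<and> (\<forall>x\<in>X. (\<Sum>y\<in>X. a x y * f y) = \<mu> * f x)"
  have "\<exists>f \<mu>. ?R f \<mu>"
    by (rule symmetric_eigenvector_exists[of X a n p e f0]) (use fin sym eig orth f0 in auto)
  then obtain f where "\<exists>\<mu>. ?R f \<mu>" ..
  then obtain \<mu> where "?R f \<mu>" ..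
  then have f: "\<And>x. x \<notin> X \<Longrightarrow> f x = 0" "(\<Sum>z\<in>X. (f z)\<^sup>2) = 1"
    "\<And>i. i < n \<Longrightarrow> (\<Sum>z\<in>X. p i z * f z) = 0"
    "\<And>x. x \<in> X \<Longrightarrow> (\<Sum>y\<in>X. a x y * f y) = \<mu> * f x"
    by blast+
  have "(\<Sum>z\<in>X. (p(n := f)) i z * (p(n := f)) j z) = (if i = j then 1 else 0)"
    if "i < Suc n" "j < Suc n" for i j
    using that f(2) f(3)[of i] f(3)[of j] on[of i j]
    by (auto simp: less_Suc_eq power2_eq_square mult.commute)
  then show ?case
    using f supp eig
    by (intro exI[of _ "p(n := f)"] exI[of _ "e(n := \<mu>)"]) (auto simp: less_Suc_eq)
qed auto

theorem symmetric_spectral_decomposition: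
  fixes a :: "'a::countable \<Rightarrow> 'a \<Rightarrow> real"
  assumes fin: "finite X" and sym: "\<And>x y. x \<in> X \<Longrightarrow> y \<in> X \<Longrightarrow> a x y = a y x"
  obtains p :: "nat \<Rightarrow> 'a \<Rightarrow> real" and e where
    "\<And>i x. i < card X \<Longrightarrow> x \<notin> X \<Longrightarrow> p i x = 0"
    "\<And>i j. i < card X \<Longrightarrow> j < card X \<Longrightarrow> (\<Sum>z\<in>X. p i z * p j z) = (if i = j then 1 else 0)"
    "\<And>i x. i < card X \<Longrightarrow> x \<in> X \<Longrightarrow> (\<Sum>y\<in>X. a x y * p i y) = e i * p i x"
    "\<And>x y. x \<in> X \<Longrightarrow> y \<in> X \<Longrightarrow> (\<Sum>i<card X. p i x * p i y) = (if x = y then 1 else 0)"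
proof -
  let ?Q = "\<lambda>p e. (\<forall>i<card X. \<forall>x. x \<notin> X \<longrightarrow> p i x = 0) \<and>
    (\<forall>i<card X. \<forall>j<card X. (\<Sum>z\<in>X. p i z * p j z) = (if i = j then 1 else (0::real))) \<and>
    (\<forall>i<card X. \<forall>x\<in>X. (\<Sum>y\<in>X. a x y * p i y) = e i * p i x)"
  have "\<exists>p e. ?Q p e" by (rule symmetric_orthonormal_eigenvectors) (use fin sym in auto)
  then obtain p where "\<exists>e. ?Q p e" ..
  then obtain e where pe: "?Q p e" ..
  then have supp: "\<And>i x. i < card X \<Longrightarrow> x \<notin> X \<Longrightarrow> p i x = 0"
    and on: "\<And>i j. i < card X \<Longrightarrow> j < card X \<Longrightarrow> (\<Sum>z\<in>X. p i z * p j z) = (if i = j then 1 else 0)"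
    and eig: "\<And>i x. i < card X \<Longrightarrow> x \<in> X \<Longrightarrow> (\<Sum>y\<in>X. a x y * p i y) = e i * p i x"
    by blast+
  have bessel: "(\<Sum>z\<in>X. ((if z = x then 1 else 0) - (\<Sum>i<card X. p i x * p i z))\<^sup>2)
      = 1 - (\<Sum>i<card X. (p i x)\<^sup>2)" if "x \<in> X" for x
    by (rule orthonormal_family_Bessel[of X x "card X" p, OF fin that]) (rule on)
  \<comment> \<open>At full cardinality the nonnegative residuals sum to zero, so every delta lies
    in the span.\<close>
  have "(\<Sum>x\<in>X. 1 - (\<Sum>i<card X. (p i x)\<^sup>2)) = 0"
  proof -
    have "(\<Sum>x\<in>X. \<Sum>i<card X. (p i x)\<^sup>2) = (\<Sum>i<card X. \<Sum>x\<in>X. p i x * p i x)"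
      by (subst sum.swap) (simp add: power2_eq_square)
    also have "\<dots> = card X" by (simp add: on)
    finally show ?thesis by (simp add: sum_subtractf)
  qed
  moreover have "1 - (\<Sum>i<card X. (p i x)\<^sup>2) \<ge> 0" if "x \<in> X" for x
    unfolding bessel[OF that, symmetric] by (intro sum_nonneg) simp
  ultimately have 1: "1 - (\<Sum>i<card X. (p i x)\<^sup>2) = 0" if "x \<in> X" for x
    using that fin by (simp add: sum_nonneg_eq_0_iff)
  have "(\<Sum>i<card X. p i x * p i y) = (if x = y then 1 else 0)" if "x \<in> X" "y \<in> X" for x y
  proof -
    have "(\<Sum>z\<in>X. ((if z = x then 1 else 0) - (\<Sum>i<card X. p i x * p i z))\<^sup>2) = 0"
      using bessel[OF that(1)] 1[OF that(1)] by simp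
    then have "(if y = x then 1 else 0) - (\<Sum>i<card X. p i x * p i y) = 0"
      using fin that(2) by (simp add: sum_nonneg_eq_0_iff)
    then show ?thesis by auto
  qed
  with supp on eig that show ?thesis by blast
qed

section \<open>Eigenvectors of the finite tree\<close>

definition tree_box :: "nat \<Rightarrow> vertex set" where
  "tree_box L = {x. length x \<le> L}"

definition neighbour :: "vertex \<Rightarrow> vertex \<Rightarrow> bool" where
  "neighbour x y \<longleftrightarrow> (y \<noteq> [] \<and> butlast y = x) \<or> (x \<noteq> [] \<and> butlast x = y)"

text \<open>Since each \<open>p i\<close> vanishes off the box, \<open>schr\<close> on the infinite
  tree acts on it, at box vertices, as the truncated matrix. The equation is therefore asked only
  there, and no separate finite operator has to be introduced.\<close>

definition box_eigenbasis :: "nat \<Rightarrow> (vertex \<Rightarrow> real) \<Rightarrow> (nat \<Rightarrow> vertex \<Rightarrow> real) \<Rightarrow> (nat \<Rightarrow> real) \<Rightarrow> bool" where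
  "box_eigenbasis L V p e \<longleftrightarrow>
     (\<forall>i<card (tree_box L). \<forall>x. x \<notin> tree_box L \<longrightarrow> p i x = 0) \<and>
     (\<forall>i<card (tree_box L). \<forall>j<card (tree_box L). (\<Sum>z\<in>tree_box L. p i z * p j z) = (if i = j then 1 else 0)) \<and>
     (\<forall>i<card (tree_box L). \<forall>x\<in>tree_box L. schr V (\<lambda>x. of_real (p i x)) x = of_real (e i * p i x)) \<and>
     (\<forall>x\<in>tree_box L. \<forall>y\<in>tree_box L. (\<Sum>i<card (tree_box L). p i x * p i y) = (if x = y then 1 else 0))"

lemma finite_tree_box [simp]: "finite (tree_box L)"
  using finite_lists_length_le[of "UNIV :: bool set" L] by (simp add: tree_box_def)

lemma neighbour_sym: "neighbour x y \<longleftrightarrow> neighbour y x"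
  by (auto simp: neighbour_def)

lemma neighbour_iff:
  "neighbour x y \<longleftrightarrow> y = x @ [False] \<or> y = x @ [True] \<or> (x \<noteq> [] \<and> y = butlast x)"
proof -
  have "y \<noteq> [] \<and> butlast y = x \<longleftrightarrow> y = x @ [False] \<or> y = x @ [True]"
    by (metis append_butlast_last_id butlast_snoc snoc_eq_iff_butlast)
  then show ?thesis by (auto simp: neighbour_def)
qed

lemma sum_neighbours_eq_adj:
  assumes "\<And>y. y \<notin> tree_box L \<Longrightarrow> f y = 0"
  shows "(\<Sum>y\<in>tree_box L. if neighbour x y then f y else 0) = adj f x"
proof -
  let ?N = "{x @ [False], x @ [True]} \<union> (if x = [] then {} else {butlast x})"
  have N: "{y. neighbour x y} = ?N" by (auto simp: neighbour_iff)
  have "(\<Sum>y\<in>tree_box L. if neighbour x y then f y else 0) = sum f (tree_box L \<inter> {y. neighbour x y})"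
    by (simp add: sum.inter_restrict)
  also have "\<dots> = sum f {y. neighbour x y}"
    by (rule sum.mono_neutral_left) (use assms in \<open>auto simp: N\<close>)
  also have "\<dots> = adj f x"
  proof (cases "x = []")
    case False
    have "butlast x \<noteq> x @ [c]" for c
    proof
      assume "butlast x = x @ [c]"
      then have "length (butlast x) = Suc (length x)" by simp
      then show False by simp
    qed
    then show ?thesis using False unfolding N adj_def by (auto simp: add.commute add.left_commute)
  next
    case True
    then show ?thesis unfolding N adj_def by simp
  qed
  finally show ?thesis .
qed

lemma of_real_sum_neighbours:
  assumes "\<And>y. y \<notin> tree_box L \<Longrightarrow> f y = (0::real)"
  shows "complex_of_real (\<Sum>y\<in>tree_box L. if neighbour x y then f y else 0) = adj (\<lambda>x. of_real (f x)) x"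
proof -
  have "complex_of_real (\<Sum>y\<in>tree_box L. if neighbour x y then f y else 0)
      = (\<Sum>y\<in>tree_box L. if neighbour x y then complex_of_real (f y) else 0)"
    unfolding of_real_sum by (intro sum.cong) auto
  also have "\<dots> = adj (\<lambda>x. of_real (f x)) x" by (rule sum_neighbours_eq_adj) (simp add: assms)
  finally show ?thesis .
qed

lemma box_eigenbasis_exists: "\<exists>p e. box_eigenbasis L V p e"
proof -
  define a where "a x y = (if x = y then V x else 0) - (if neighbour x y then 1 else 0)" for x y
  have sym: "a x y = a y x" for x y unfolding a_def by (auto simp: neighbour_sym)
  obtain p :: "nat \<Rightarrow> vertex \<Rightarrow> real" and e where
    p: "\<And>i x. i < card (tree_box L) \<Longrightarrow> x \<notin> tree_box L \<Longrightarrow> p i x = 0"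
    "\<And>i j. i < card (tree_box L) \<Longrightarrow> j < card (tree_box L) \<Longrightarrow> (\<Sum>z\<in>tree_box L. p i z * p j z) = (if i = j then 1 else 0)"
    "\<And>i x. i < card (tree_box L) \<Longrightarrow> x \<in> tree_box L \<Longrightarrow> (\<Sum>y\<in>tree_box L. a x y * p i y) = e i * p i x"
    "\<And>x y. x \<in> tree_box L \<Longrightarrow> y \<in> tree_box L \<Longrightarrow> (\<Sum>i<card (tree_box L). p i x * p i y) = (if x = y then 1 else 0)"
    by (rule symmetric_spectral_decomposition[of "tree_box L" a, OF finite_tree_box sym], rule that)
  have "schr V (\<lambda>x. of_real (p i x)) x = of_real (e i * p i x)"
    if i: "i < card (tree_box L)" and x: "x \<in> tree_box L" for i x
  proof -
    have "(\<Sum>y\<in>tree_box L. a x y * p i y)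
        = (\<Sum>y\<in>tree_box L. (if x = y then V x * p i y else 0) - (if neighbour x y then p i y else 0))"
      unfolding a_def by (intro sum.cong) (auto simp: algebra_simps)
    also have "\<dots> = V x * p i x - (\<Sum>y\<in>tree_box L. if neighbour x y then p i y else 0)"
      using x by (simp add: sum_subtractf)
    finally have "e i * p i x = V x * p i x - (\<Sum>y\<in>tree_box L. if neighbour x y then p i y else 0)"
      using p(3)[OF i x] by simp
    then have "complex_of_real (e i * p i x) = of_real (V x * p i x) - adj (\<lambda>x. of_real (p i x)) x"
      using of_real_sum_neighbours[of L "p i" x] p(1)[OF i] by simp
    then show ?thesis by (simp add: schr_def)
  qed
  then show ?thesis unfolding box_eigenbasis_def using p by blast
qed

context
  fixes L V p e
  assumes basis: "box_eigenbasis L V p e"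
begin

lemma eigenbasis_support: "i < card (tree_box L) \<Longrightarrow> x \<notin> tree_box L \<Longrightarrow> p i x = 0"
  and eigenbasis_orthonormal: "i < card (tree_box L) \<Longrightarrow> j < card (tree_box L) \<Longrightarrow>
    (\<Sum>z\<in>tree_box L. p i z * p j z) = (if i = j then 1 else 0)"
  and eigenbasis_eq: "i < card (tree_box L) \<Longrightarrow> x \<in> tree_box L \<Longrightarrow>
    schr V (\<lambda>x. of_real (p i x)) x = of_real (e i * p i x)"
  and eigenbasis_complete: "x \<in> tree_box L \<Longrightarrow> y \<in> tree_box L \<Longrightarrow>
    (\<Sum>i<card (tree_box L). p i x * p i y) = (if x = y then 1 else 0)"
  using basis unfolding box_eigenbasis_def by blast+

lemma eigenbasis_norm: "i < card (tree_box L) \<Longrightarrow> (\<Sum>z\<in>tree_box L. (p i z)\<^sup>2) = 1"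
  using eigenbasis_orthonormal[of i i] by (simp add: power2_eq_square)

lemma eigenbasis_abs_le_1:
  assumes "i < card (tree_box L)"
  shows "\<bar>p i x\<bar> \<le> 1"
proof (cases "x \<in> tree_box L")
  case True
  have "(p i x)\<^sup>2 \<le> (\<Sum>z\<in>tree_box L. (p i z)\<^sup>2)" using True by (intro member_le_sum) auto
  then show ?thesis using eigenbasis_norm[OF assms] by (simp add: abs_square_le_1)
qed (simp add: eigenbasis_support assms)

text \<open>The eigenvalue equation is read off at a vertex where the eigenvector has maximal modulus.\<close>

lemma eigenbasis_energy_bound:
  assumes i: "i < card (tree_box L)" and B: "\<And>x. \<bar>V x\<bar> \<le> B"
  shows "\<bar>e i\<bar> \<le> B + 3"
proof -
  have ne: "tree_box L \<noteq> {}" by (auto simp: tree_box_def intro: exI[of _ "[]"])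
  define s where "s = Max ((\<lambda>x. \<bar>p i x\<bar>) ` tree_box L)"
  have "s \<in> (\<lambda>x. \<bar>p i x\<bar>) ` tree_box L" unfolding s_def using ne by (intro Max_in) auto
  then obtain x where x: "x \<in> tree_box L" "\<bar>p i x\<bar> = s" by auto
  have le0: "\<bar>p i y\<bar> \<le> s" if "y \<in> tree_box L" for y
    unfolding s_def by (rule Max_ge) (use that in auto)
  have le: "\<bar>p i y\<bar> \<le> s" for y
    using le0[of y] eigenbasis_support[OF i, of y] x(2) by (cases "y \<in> tree_box L") auto
  have s: "s > 0"
  proof (rule ccontr)
    assume "\<not> s > 0"
    then have "p i y = 0" for y using le[of y] by simp
    then show False using eigenbasis_norm[OF i] by simp
  qed
  let ?f = "\<lambda>x. complex_of_real (p i x)"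
  have "cmod (adj ?f x) \<le> cmod (?f (x @ [False]) + ?f (x @ [True])) + cmod (if x = [] then 0 else ?f (butlast x))"
    unfolding adj_def by (rule norm_triangle_ineq)
  also have "\<dots> \<le> (cmod (?f (x @ [False])) + cmod (?f (x @ [True]))) + cmod (if x = [] then 0 else ?f (butlast x))"
    by (intro add_mono norm_triangle_ineq order_refl)
  also have "\<dots> \<le> 3 * s"
    using le[of "x @ [False]"] le[of "x @ [True]"] le[of "butlast x"] s by auto
  finally have a: "cmod (adj ?f x) \<le> 3 * s" .
  have "of_real (e i * p i x) = - adj ?f x + of_real (V x * p i x)"
    using eigenbasis_eq[OF i x(1)] by (simp add: schr_def)
  then have "cmod (of_real (e i * p i x)) \<le> cmod (- adj ?f x) + cmod (of_real (V x * p i x))"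
    by (simp only: norm_triangle_ineq)
  also have "\<dots> \<le> 3 * s + B * s"
  proof (rule add_mono)
    show "cmod (of_real (V x * p i x)) \<le> B * s"
      using mult_right_mono[OF B[of x], of s] s x(2) by (simp only: norm_of_real abs_mult)
  qed (simp add: a)
  finally have "\<bar>e i\<bar> * s \<le> (B + 3) * s" 
    using x(2) by (simp only: norm_of_real abs_mult distrib_right add.commute)
  then show ?thesis using s by simp
qed

end

definition on_tree :: "(nat \<Rightarrow> bool \<Rightarrow> 'a) \<Rightarrow> vertex \<Rightarrow> 'a" where
  "on_tree v x = v (length x) (x \<noteq> [] \<and> last x)"

definition shifted :: "(nat \<Rightarrow> bool \<Rightarrow> real) \<Rightarrow> complex \<Rightarrow> nat \<Rightarrow> bool \<Rightarrow> complex" where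
  "shifted v z j c = complex_of_real (v j c) - z"

text \<open>The resolvent column at y, expanded in the eigenbasis, solves the equation of
  \<open>green_diag_eq\<close>. Taking imaginary parts turns each pole into a Poisson kernel, so the
  continued fraction carries the spectral measure of y.\<close>

lemma Im_green_diag_eq:
  assumes basis: "box_eigenbasis L (on_tree v) p e" and y: "length y \<le> L" and \<eta>: "\<eta> > 0"
  shows "Im (green_diag (shifted v (Complex E \<eta>)) L y)
    = (\<Sum>i<card (tree_box L). (p i y)\<^sup>2 * (\<eta> / ((e i - E)\<^sup>2 + \<eta>\<^sup>2)))"
proof -
  let ?z = "Complex E \<eta>" and ?n = "card (tree_box L)"
  let ?w = "shifted v ?z"
  define c where "c i = complex_of_real (p i y) / (of_real (e i) - ?z)" for i
  have nz: "complex_of_real (e i) - ?z \<noteq> 0" for i using \<eta> by (simp add: complex_eq_iff)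
  define \<psi> where "\<psi> x = (\<Sum>i<?n. c i * complex_of_real (p i x))" for x
  have y': "y \<in> tree_box L" using y by (simp add: tree_box_def)
  have adj: "adj \<psi> x = (\<Sum>i<?n. c i * adj (\<lambda>x. complex_of_real (p i x)) x)" for x
    unfolding adj_def \<psi>_def
    by (simp add: sum.distrib[symmetric] distrib_left) 
  have "\<psi> y = green_diag ?w L y"
  proof (rule green_diag_eq[OF _ y])
    show "Im (?w j b) < 0" for j b using \<eta> by (simp add: shifted_def)
    show "\<psi> x = 0" if "L < length x" for x
      unfolding \<psi>_def using that eigenbasis_support[OF basis] by (intro sum.neutral) (auto simp: tree_box_def)
    show "site ?w x * \<psi> x - adj \<psi> x = (if x = y then 1 else 0)" if "length x \<le> L" for x
    proof -
      have x: "x \<in> tree_box L" using that by (simp add: tree_box_def)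
      have site: "site ?w x = of_real (on_tree v x) - ?z" by (simp add: site_def shifted_def on_tree_def)
      have "site ?w x * \<psi> x - adj \<psi> x
          = (\<Sum>i<?n. c i * (schr (on_tree v) (\<lambda>x. of_real (p i x)) x - ?z * of_real (p i x)))"
        unfolding adj site \<psi>_def schr_def
        by (simp add: sum_distrib_left sum_subtractf[symmetric] algebra_simps)
      also have "\<dots> = (\<Sum>i<?n. complex_of_real (p i x * p i y))"
      proof (rule sum.cong[OF refl])
        fix i assume "i \<in> {..<?n}"
        then have i: "i < ?n" by simp
        have "c i * (schr (on_tree v) (\<lambda>x. of_real (p i x)) x - ?z * of_real (p i x))
            = c i * ((of_real (e i) - ?z) * of_real (p i x))"
          using eigenbasis_eq[OF basis i x] by (simp add: algebra_simps)
        then show "c i * (schr (on_tree v) (\<lambda>x. of_real (p i x)) x - ?z * of_real (p i x))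
            = complex_of_real (p i x * p i y)"
          unfolding c_def using nz[of i] by simp
      qed
      also have "\<dots> = (if x = y then 1 else 0)"
        using eigenbasis_complete[OF basis x y'] by (simp flip: of_real_sum of_real_mult)
      finally show ?thesis .
    qed
  qed
  then have "Im (green_diag ?w L y) = (\<Sum>i<?n. Im (c i * complex_of_real (p i y)))"
    by (metis \<psi>_def Im_sum)
  also have "\<dots> = (\<Sum>i<?n. (p i y)\<^sup>2 * (\<eta> / ((e i - E)\<^sup>2 + \<eta>\<^sup>2)))"
  proof (rule sum.cong[OF refl])
    fix i
    have "c i * complex_of_real (p i y) = of_real ((p i y)\<^sup>2) * (1 / (of_real (e i) - ?z))"
      unfolding c_def by (simp add: power2_eq_square)
    then show "Im (c i * complex_of_real (p i y)) = (p i y)\<^sup>2 * (\<eta> / ((e i - E)\<^sup>2 + \<eta>\<^sup>2))"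
      by (simp add: Im_divide)
  qed
  finally show ?thesis .
qed

section \<open>Averaging over one level of the radial potential\<close>

text \<open>Multiplying by R^2 - t^2 compensates the singularities of 1 / |Im t| at the two ends of the
  real segment, so Cauchy's theorem on the triangle with vertices -R, R, -iR gives a bound that
  does not depend on the boundary values of f.\<close>

lemma herglotz_weighted_integral_bound:
  assumes hol: "f holomorphic_on {t. Im t < \<eta>}" and \<eta>: "\<eta> > 0" and R: "R > 0"
    and bd: "\<And>t. Im t < 0 \<Longrightarrow> cmod (f t) \<le> 1 / (- Im t)"
  shows "cmod (contour_integral (linepath (of_real (- R)) (of_real R)) (\<lambda>t. (of_real (R\<^sup>2) - t\<^sup>2) * f t))
    \<le> 16 * R\<^sup>2"
proof -
  let ?a = "complex_of_real (- R)" and ?b = "complex_of_real R" and ?c = "Complex 0 (- R)"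
  let ?g = "\<lambda>t. (of_real (R\<^sup>2) - t\<^sup>2) * f t"
  have holg: "?g holomorphic_on {t. Im t < \<eta>}" by (intro holomorphic_intros hol)
  have cv: "convex {t. Im t < \<eta>}" by (rule convex_halfspace_Im_lt)
  have sub: "convex hull {?a, ?b, ?c} \<subseteq> {t. Im t < \<eta>}"
    by (rule hull_minimal) (use cv \<eta> R in auto)
  have "(?g has_contour_integral 0) (linepath ?a ?b +++ linepath ?b ?c +++ linepath ?c ?a)"
    by (rule Cauchy_theorem_triangle) (rule holomorphic_on_subset[OF holg sub])
  then have sum0: "contour_integral (linepath ?a ?b) ?g + contour_integral (linepath ?b ?c) ?g
      + contour_integral (linepath ?c ?a) ?g = 0"
    by (rule has_chain_integral_chain_integral3)
  have int: "?g contour_integrable_on linepath p q" if "Im p \<le> 0" "Im q \<le> 0" for p q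
  proof (rule contour_integrable_continuous_linepath)
    have "closed_segment p q \<subseteq> {t. Im t < \<eta>}"
      using closed_segment_subset[OF _ _ cv, of p q] that \<eta> by auto
    then show "continuous_on (closed_segment p q) ?g"
      using holomorphic_on_imp_continuous_on[OF holg] continuous_on_subset by blast
  qed
  \<comment> \<open>On the slanted sides one of R - t and R + t has modulus at most 2 s and the
    other at most 2 R, which cancels the 1 / s in the bound on f. At s = 0 the weight itself
    vanishes.\<close>
  have side: "cmod (?g t) \<le> 4 * R" if "\<bar>Re t\<bar> = R - s" "Im t = - s" "0 \<le> s" "s \<le> R" for t s
  proof (cases "s = 0")
    case True
    then have "t\<^sup>2 = of_real (R\<^sup>2)"
      using that by (auto simp: complex_eq_iff power2_eq_square abs_if split: if_splits)
    then show ?thesis using R by simp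
  next
    case False
    then have s: "s > 0" using that by simp
    have prod: "of_real (R\<^sup>2) - t\<^sup>2 = (of_real R - t) * (of_real R + t)"
      by (simp add: power2_eq_square algebra_simps)
    have small: "cmod (of_real R - t) * cmod (of_real R + t) \<le> (2 * s) * (2 * R)"
    proof (cases "Re t \<ge> 0")
      case True
      have "cmod (of_real R - t) \<le> 2 * s"
        using cmod_le[of "of_real R - t"] that True by simp
      moreover have "cmod (of_real R + t) \<le> 2 * R"
        using cmod_le[of "of_real R + t"] that True by simp
      ultimately show ?thesis by (intro mult_mono) (use s in auto)
    next
      case False
      have "cmod (of_real R + t) \<le> 2 * s"
        using cmod_le[of "of_real R + t"] that False by simp
      moreover have "cmod (of_real R - t) \<le> 2 * R"
        using cmod_le[of "of_real R - t"] that False by simp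
      ultimately have "cmod (of_real R + t) * cmod (of_real R - t) \<le> (2 * s) * (2 * R)"
        by (intro mult_mono) (use s in auto)
      then show ?thesis by (simp add: mult.commute)
    qed
    have "cmod (?g t) = (cmod (of_real R - t) * cmod (of_real R + t)) * cmod (f t)"
      unfolding prod by (simp add: norm_mult)
    also have "\<dots> \<le> ((2 * s) * (2 * R)) * (1 / s)"
    proof (rule mult_mono[OF small])
      show "cmod (f t) \<le> 1 / s" using bd[of t] that s by simp
    qed (use s R in auto)
    also have "\<dots> = 4 * R" using s by simp
    finally show ?thesis .
  qed
  have bc: "cmod (?g t) \<le> 4 * R" if t: "t \<in> closed_segment ?b ?c" for t
  proof -
    obtain u where u: "0 \<le> u" "u \<le> 1" "t = (1 - u) *\<^sub>R ?b + u *\<^sub>R ?c" using t by (auto simp: in_segment)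
    have "Re t = (1 - u) * R" "Im t = - (u * R)" by (simp_all add: u(3))
    moreover from this have "\<bar>Re t\<bar> = (1 - u) * R" using u(1,2) R by simp
    ultimately show ?thesis using u(1,2) R by (intro side[of t "u * R"]) (simp_all add: abs_mult algebra_simps)
  qed
  have ca: "cmod (?g t) \<le> 4 * R" if t: "t \<in> closed_segment ?c ?a" for t
  proof -
    obtain u where u: "0 \<le> u" "u \<le> 1" "t = (1 - u) *\<^sub>R ?c + u *\<^sub>R ?a" using t by (auto simp: in_segment)
    have "Re t = - (u * R)" "Im t = - ((1 - u) * R)" by (simp_all add: u(3))
    then show ?thesis using u(1,2) R by (intro side[of t "(1 - u) * R"]) (simp_all add: abs_mult algebra_simps)
  qed
  \<comment> \<open>Each slanted side has supremum at most 4 R and length at most 2 R; the two sides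
    together give the constant 16.\<close>
  have "cmod (contour_integral (linepath ?b ?c) ?g) \<le> 4 * R * cmod (?c - ?b)"
    by (rule contour_integral_bound_linepath) (use int R bc in auto)
  moreover have "cmod (contour_integral (linepath ?c ?a) ?g) \<le> 4 * R * cmod (?a - ?c)"
    by (rule contour_integral_bound_linepath) (use int R ca in auto)
  moreover have "cmod (?c - ?b) \<le> 2 * R" using cmod_le[of "?c - ?b"] R by simp
  moreover have "cmod (?a - ?c) \<le> 2 * R" using cmod_le[of "?a - ?c"] R by simp
  ultimately have "cmod (contour_integral (linepath ?b ?c) ?g) \<le> 4 * R * (2 * R)"
    "cmod (contour_integral (linepath ?c ?a) ?g) \<le> 4 * R * (2 * R)"
    using R by (meson mult_left_mono order_trans less_imp_le mult_nonneg_nonneg zero_le_numeral)+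
  moreover have "contour_integral (linepath ?a ?b) ?g
      = - (contour_integral (linepath ?b ?c) ?g + contour_integral (linepath ?c ?a) ?g)"
    using sum0 by (simp only: eq_neg_iff_add_eq_0 add.assoc)
  then have "cmod (contour_integral (linepath ?a ?b) ?g)
      \<le> cmod (contour_integral (linepath ?b ?c) ?g) + cmod (contour_integral (linepath ?c ?a) ?g)"
    by (simp only: norm_minus_cancel norm_triangle_ineq)
  ultimately show ?thesis by (simp add: power2_eq_square)
qed

lemma herglotz_real_average:
  assumes hol: "f holomorphic_on {t. Im t < \<eta>}" and \<eta>: "\<eta> > 0" and K: "K > 0"
    and bd: "\<And>t. Im t < 0 \<Longrightarrow> cmod (f t) \<le> 1 / (- Im t)"
    and pos: "\<And>t. t \<in> \<real> \<Longrightarrow> Im (f t) \<ge> 0"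
  shows "(\<integral>\<^sup>+t. ennreal (Im (f (of_real t))) * indicator {-K..K} t \<partial>lborel) \<le> 22"
proof -
  \<comment> \<open>With this R the weight R^2 - t^2 is at least 3 K^2 on {-K..K}, and 16 R^2 / (3
    K^2) = 64/3 \<le> 22.\<close>
  define R where "R = 2 * K"
  have R: "R > 0" using K by (simp add: R_def)
  let ?g = "\<lambda>t. (of_real (R\<^sup>2) - t\<^sup>2) * f t"
  define h where "h t = (R\<^sup>2 - t\<^sup>2) * Im (f (of_real t))" for t :: real
  have hg: "h t = Im (?g (of_real t))" for t
    unfolding h_def by (simp flip: of_real_power of_real_diff)
  have cont: "continuous_on {-R..R} (\<lambda>t. ?g (of_real t))"
  proof -
    have "continuous_on {t. Im t < \<eta>} ?g"
      by (intro holomorphic_on_imp_continuous_on holomorphic_intros hol)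
    then show ?thesis
      by (rule continuous_on_compose2) (use \<eta> in \<open>auto intro: continuous_intros\<close>)
  qed
  have int: "(\<lambda>t. ?g (of_real t)) integrable_on {-R..R}" by (rule integrable_continuous_real[OF cont])
  define I where "I = integral {-R..R} h"
  have hI: "(h has_integral I) {-R..R}"
    unfolding I_def hg by (intro integrable_integral integrable_continuous_real continuous_intros cont)
  have "contour_integral (linepath (of_real (- R)) (of_real R)) ?g = integral {-R..R} (\<lambda>t. ?g (of_real t))"
    by (subst contour_integral_linepath_Reals_eq) (use R in auto)
  then have "cmod (integral {-R..R} (\<lambda>t. ?g (of_real t))) \<le> 16 * R\<^sup>2"
    using herglotz_weighted_integral_bound[OF hol \<eta> R bd] by simp
  moreover have "I = Im (integral {-R..R} (\<lambda>t. ?g (of_real t)))"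
    unfolding I_def hg using integral_linear[OF int bounded_linear_Im] by (simp add: o_def)
  ultimately have I: "I \<le> 16 * R\<^sup>2"
    using abs_Im_le_cmod[of "integral {-R..R} (\<lambda>t. ?g (of_real t))"] by linarith
  have h0: "h t \<ge> 0" if "t \<in> {-R..R}" for t
    unfolding h_def using that pos[of "of_real t"] abs_le_square_iff[of t R] R by (intro mult_nonneg_nonneg) (auto simp: abs_le_iff)
  have "(\<integral>\<^sup>+t. ennreal (3 * K\<^sup>2) * (ennreal (Im (f (of_real t))) * indicator {-K..K} t) \<partial>lborel)
      \<le> (\<integral>\<^sup>+t. ennreal (h t) * indicator {-R..R} t \<partial>lborel)"
  proof (rule nn_integral_mono)
    fix t :: real
    have "3 * K\<^sup>2 * Im (f (of_real t)) \<le> h t" if t: "t \<in> {-K..K}"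
    proof -
      have "t\<^sup>2 \<le> K\<^sup>2" using t K by (intro power2_le_iff_abs_le[THEN iffD2]) auto
      then have "3 * K\<^sup>2 \<le> R\<^sup>2 - t\<^sup>2" by (simp add: R_def power_mult_distrib)
      then show ?thesis unfolding h_def using pos[of "of_real t"] by (intro mult_right_mono) auto
    qed
    then show "ennreal (3 * K\<^sup>2) * (ennreal (Im (f (of_real t))) * indicator {-K..K} t)
        \<le> ennreal (h t) * indicator {-R..R} t"
      using K pos[of "of_real t"] by (auto simp: R_def indicator_def ennreal_mult[symmetric] intro!: ennreal_leI)
  qed
  also have "\<dots> = ennreal I" by (rule nn_integral_has_integral_lebesgue'[OF h0 hI])
  also have "\<dots> \<le> ennreal (3 * K\<^sup>2) * 22"
  proof -
    have "I \<le> 64 * K\<^sup>2" using I by (simp add: R_def power_mult_distrib)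
    then have "I \<le> 3 * K\<^sup>2 * 22" using zero_le_power2[of K] by linarith
    then have "ennreal I \<le> ennreal (3 * K\<^sup>2 * 22)" by (rule ennreal_leI)
    then show ?thesis by (simp only: ennreal_mult'' ennreal_numeral zero_le_numeral)
  qed
  finally have *: "(\<integral>\<^sup>+t. ennreal (3 * K\<^sup>2) * (ennreal (Im (f (of_real t))) * indicator {-K..K} t) \<partial>lborel)
      \<le> ennreal (3 * K\<^sup>2) * 22" .
  have [measurable]: "(\<lambda>t. ennreal (Im (f (of_real t))) * indicator {-K..K} t) \<in> borel_measurable borel"
  proof -
    have "continuous_on {t. Im t < \<eta>} f" by (rule holomorphic_on_imp_continuous_on[OF hol])
    then have "continuous_on UNIV (\<lambda>t. f (complex_of_real t))"
      by (rule continuous_on_compose2) (use \<eta> in \<open>auto intro: continuous_intros\<close>)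
    then have "(\<lambda>t. Im (f (complex_of_real t))) \<in> borel_measurable borel"
      by (intro borel_measurable_continuous_onI continuous_intros)
    then show ?thesis by measurable
  qed
  have "(\<integral>\<^sup>+t. ennreal (3 * K\<^sup>2) * (ennreal (Im (f (of_real t))) * indicator {-K..K} t) \<partial>lborel)
      = ennreal (3 * K\<^sup>2) * (\<integral>\<^sup>+t. ennreal (Im (f (of_real t))) * indicator {-K..K} t \<partial>lborel)"
    by (rule nn_integral_cmult) simp
  then show ?thesis using * K by (simp add: ennreal_mult_le_mult_iff)
qed

section \<open>Holomorphic dependence of the resolvent on a level shift\<close>

lemma holomorphic_self_energy:
  assumes hol: "\<And>j c. (\<lambda>t. W t j c) holomorphic_on U"
    and neg: "\<And>t j c. t \<in> U \<Longrightarrow> Im (W t j c) < 0"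
  shows "(\<lambda>t. self_energy (W t) n k) holomorphic_on U"
proof (induction k arbitrary: n)
  case (Suc k)
  have "W t (Suc n) c - self_energy (W t) (Suc n) k \<noteq> 0" if "t \<in> U" for t c
  proof -
    have "Im (self_energy (W t) (Suc n) k) \<ge> 0" by (rule Im_self_energy_nonneg) (use neg that in auto)
    then have "Im (W t (Suc n) c - self_energy (W t) (Suc n) k) < 0" using neg[OF that, of "Suc n" c] by simp
    then show ?thesis by force
  qed
  then show ?case unfolding self_energy.simps by (intro holomorphic_intros hol Suc.IH) auto
qed simp

lemma holomorphic_green_diag:
  assumes hol: "\<And>j c. (\<lambda>t. W t j c) holomorphic_on U"
    and neg: "\<And>t j c. t \<in> U \<Longrightarrow> Im (W t j c) < 0" and y: "length y \<le> L"
  shows "(\<lambda>t. green_diag (W t) L y) holomorphic_on U"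
proof -
  note se = holomorphic_self_energy[where W = W and U = U, OF hol neg]
  have up: "(\<lambda>t. updiag (W t) L r) holomorphic_on U" if "length r \<le> L" for r
    using that
  proof (induction r)
    case (Cons c r)
    have dn: "Im (denom (W t) L (Suc (length r)) (\<not> c)) < 0" if "t \<in> U" for t
      by (rule Im_denom_neg) (use neg that Cons in auto)
    have "updiag (W t) L r - 1 / denom (W t) L (Suc (length r)) (\<not> c) \<noteq> 0" if "t \<in> U" for t
    proof -
      have "Im (updiag (W t) L r) \<le> Im (W t (length r) (r \<noteq> [] \<and> hd r))"
        by (rule Im_updiag_le) (use neg that Cons in auto)
      then have "Im (updiag (W t) L r - 1 / denom (W t) L (Suc (length r)) (\<not> c)) < 0"
        using neg[OF that, of "length r" "r \<noteq> [] \<and> hd r"] Im_inverse_pos[OF dn[OF that]] by simp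
      then show ?thesis by force
    qed
    moreover have "denom (W t) L (Suc (length r)) (\<not> c) \<noteq> 0" if "t \<in> U" for t
      using dn[OF that] by force
    moreover have "(\<lambda>t. denom (W t) L (Suc (length r)) (\<not> c)) holomorphic_on U"
      unfolding denom_def by (intro holomorphic_intros hol se)
    ultimately show ?case unfolding updiag.simps using Cons by (intro holomorphic_intros hol) auto
  qed (simp add: hol)
  have "updiag (W t) L (rev y) - self_energy (W t) (length y) (L - length y) \<noteq> 0" if "t \<in> U" for t
  proof -
    have "Im (updiag (W t) L (rev y) - self_energy (W t) (length y) (L - length y)) \<le> Im (site (W t) y)"
      by (rule Im_green_denominator_le) (use neg that y in auto)
    also have "\<dots> < 0" using neg that by (simp add: site_def)
    finally show ?thesis by force
  qed
  then show ?thesis unfolding green_diag_def using y by (intro holomorphic_intros se up) auto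
qed

text \<open>A shift t of the whole level with negative imaginary part only lowers the coefficients
  of that level further, and at y their imaginary part becomes Im t - \<eta>. This gives the modulus
  bound 1 / |Im t|, and the final constant depends on none of \<eta>, E, L and v.\<close>

lemma green_diag_level_average:
  fixes v :: "nat \<Rightarrow> bool \<Rightarrow> real"
  assumes y: "length y \<le> L" and \<eta>: "\<eta> > 0" and K: "K > 0"
  shows "(\<integral>\<^sup>+t. ennreal (Im (green_diag
      (shifted (\<lambda>j c. v j c + (if j = length y then t else 0)) (Complex E \<eta>)) L y)) * indicator {-K..K} t \<partial>lborel)
    \<le> 22"
proof -
  define W where "W t j c = shifted v (Complex E \<eta>) j c + (if j = length y then t else 0)" for t :: complex and j c
  have W: "shifted (\<lambda>j c. v j c + (if j = length y then t else 0)) (Complex E \<eta>) = W (of_real t)" for t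
    by (auto simp: fun_eq_iff W_def shifted_def)
  have hol: "(\<lambda>t. W t j c) holomorphic_on U" for j c U
    unfolding W_def by (cases "j = length y") (auto intro!: holomorphic_intros)
  have neg: "Im (W t j c) < 0" if "t \<in> {t. Im t < \<eta>}" for t j c
    using that \<eta> by (simp add: W_def shifted_def)
  show ?thesis unfolding W
  proof (rule herglotz_real_average[OF _ \<eta> K])
    show "(\<lambda>t. green_diag (W t) L y) holomorphic_on {t. Im t < \<eta>}"
      by (rule holomorphic_green_diag[OF hol neg y])
    show "cmod (green_diag (W t) L y) \<le> 1 / (- Im t)" if t: "Im t < 0" for t
    proof -
      have site: "Im (site (W t) y) = Im t - \<eta>" by (simp add: site_def W_def shifted_def)
      have "cmod (green_diag (W t) L y) \<le> 1 / (- Im (site (W t) y))"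
        by (rule cmod_green_diag_le(1)) (use neg t \<eta> y in auto)
      also have "\<dots> \<le> 1 / (- Im t)" unfolding site using t \<eta> by (intro divide_left_mono mult_pos_pos) auto
      finally show ?thesis .
    qed
    show "0 \<le> Im (green_diag (W t) L y)" if "t \<in> \<real>" for t
      by (rule less_imp_le, rule cmod_green_diag_le(2)) (use neg that \<eta> y in \<open>auto elim!: Reals_cases\<close>)
  qed
qed

section \<open>Decay and concentration of finite-volume eigenvectors\<close>

text \<open>Values in \<open>ennreal\<close> turn a vanishing denominator into \<infinity>, so no
  energies have to be excluded when averaging.\<close>

definition level_factor :: "(nat \<Rightarrow> bool \<Rightarrow> real) \<Rightarrow> nat \<Rightarrow> real \<Rightarrow> nat \<Rightarrow> ennreal" where
  "level_factor v L E j = ennreal (1/8) +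
     (inverse (ennreal (sqrt (cmod (denom (shifted v (of_real E)) L j False)))) +
      inverse (ennreal (sqrt (cmod (denom (shifted v (of_real E)) L j True)))))"

definition tail_weight :: "(nat \<Rightarrow> bool \<Rightarrow> real) \<Rightarrow> nat \<Rightarrow> nat \<Rightarrow> real \<Rightarrow> ennreal" where
  "tail_weight v m L E = (\<Sum>n\<le>L - m. 2 ^ n * (\<Prod>j\<in>{m<..m + n}. level_factor v L E j))"

definition regular :: "(nat \<Rightarrow> bool \<Rightarrow> real) \<Rightarrow> nat \<Rightarrow> nat \<Rightarrow> real \<Rightarrow> bool" where
  "regular v m L E \<longleftrightarrow> (\<forall>j c. m < j \<longrightarrow> j \<le> L \<longrightarrow> denom (shifted v (of_real E)) L j c \<noteq> 0)"

section \<open>Semicontinuity of the weight in the energy\<close>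

lemma tendsto_self_energy:
  assumes "\<And>j c. n < j \<Longrightarrow> j \<le> n + k \<Longrightarrow> denom (shifted v (of_real E)) (n + k) j c \<noteq> 0"
  shows "((\<lambda>E. self_energy (shifted v (of_real E)) n k) \<longlongrightarrow> self_energy (shifted v (of_real E)) n k) (nhds E)"
  using assms
proof (induction k arbitrary: n)
  case (Suc k)
  have id: "((\<lambda>x. x) \<longlongrightarrow> E) (nhds E)" by (rule filterlim_ident)
  have IH: "((\<lambda>E. self_energy (shifted v (of_real E)) (Suc n) k) \<longlongrightarrow> self_energy (shifted v (of_real E)) (Suc n) k) (nhds E)"
  proof (rule Suc.IH)
    fix j c assume "Suc n < j" "j \<le> Suc n + k"
    then show "denom (shifted v (of_real E)) (Suc n + k) j c \<noteq> 0" using Suc.prems[of j c] by simp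
  qed
  have "shifted v (of_real E) (Suc n) c - self_energy (shifted v (of_real E)) (Suc n) k \<noteq> 0" for c
    using Suc.prems[of "Suc n" c] by (simp add: denom_def)
  then show ?case unfolding self_energy.simps
    by (intro tendsto_intros IH) (auto simp: shifted_def intro!: tendsto_intros id)
qed simp

text \<open>The condition \<open>regular v j L E\<close> concerns only levels beyond j, so the
  denominator at level j may itself be zero at E. This is the case needed at a singular
  energy.\<close>

lemma tendsto_denom:
  assumes reg: "regular v j L E" and "j \<le> L"
  shows "((\<lambda>E. denom (shifted v (of_real E)) L j c) \<longlongrightarrow> denom (shifted v (of_real E)) L j c) (nhds E)"
proof -
  have id: "((\<lambda>x. x) \<longlongrightarrow> E) (nhds E)" by (rule filterlim_ident)
  have "((\<lambda>E. self_energy (shifted v (of_real E)) j (L - j)) \<longlongrightarrow> self_energy (shifted v (of_real E)) j (L - j)) (nhds E)"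
    by (rule tendsto_self_energy) (use assms in \<open>auto simp: regular_def\<close>)
  then show ?thesis unfolding denom_def by (auto simp: shifted_def intro!: tendsto_intros id)
qed

lemma tendsto_inverse_ennreal:
  fixes f :: "'a \<Rightarrow> ennreal"
  assumes "(f \<longlongrightarrow> l) F"
  shows "((\<lambda>x. inverse (f x)) \<longlongrightarrow> inverse l) F"
proof -
  have "continuous_on UNIV (\<lambda>x::ennreal. inverse x)" by (intro continuous_intros)
  from continuous_on_tendsto_compose[OF this assms] show ?thesis by simp
qed

lemma tendsto_level_factor:
  assumes reg: "regular v j L E" and "j \<le> L"
  shows "((\<lambda>E. level_factor v L E j) \<longlongrightarrow> level_factor v L E j) (nhds E)"
  unfolding level_factor_def
  by (intro tendsto_intros tendsto_inverse_ennreal tendsto_ennrealI tendsto_denom assms)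

lemma level_factor_ge: "level_factor v L E j \<ge> ennreal (1/8)"
  unfolding level_factor_def by simp

lemma level_factor_finite:
  assumes "regular v m L E" "m < j" "j \<le> L"
  shows "level_factor v L E j < \<top>"
  using assms by (simp add: level_factor_def regular_def less_top[symmetric])

text \<open>Eigenvalues at which elimination breaks down must be counted as bad as well; this makes
  the weight large in a neighbourhood of them, where the Poisson kernel can detect it.\<close>

lemma tail_weight_lower_semicontinuous:
  assumes "M < \<top>" and "\<not> regular v m L E \<or> M < tail_weight v m L E"
  shows "\<forall>\<^sub>F E' in nhds E. M < tail_weight v m L E'"
proof (cases "regular v m L E")
  case True
  have reg: "regular v j L E" if "j \<ge> m" for j using True that by (simp add: regular_def)
  \<comment> \<open>Finiteness is carried along with the limit because multiplication in
    \<open>ennreal\<close> is not continuous at 0 times \<infinity>.\<close>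
  have prod: "((\<lambda>E. \<Prod>j\<in>{m<..m + n}. level_factor v L E j) \<longlongrightarrow> (\<Prod>j\<in>{m<..m + n}. level_factor v L E j)) (nhds E)
      \<and> (\<Prod>j\<in>{m<..m + n}. level_factor v L E j) < \<top>"
    if "m + n \<le> L" for n
    using that
  proof (induction n)
    case (Suc n)
    have eq: "{m<..m + Suc n} = insert (m + Suc n) {m<..m + n}" by auto
    have 1: "level_factor v L E (m + Suc n) < \<top>" by (rule level_factor_finite[OF True]) (use Suc in auto)
    have 2: "((\<lambda>E. level_factor v L E (m + Suc n)) \<longlongrightarrow> level_factor v L E (m + Suc n)) (nhds E)"
      by (rule tendsto_level_factor) (use Suc reg in auto)
    have ins: "(\<Prod>j\<in>insert (m + Suc n) {m<..m + n}. g j) = g (m + Suc n) * (\<Prod>j\<in>{m<..m + n}. g j)"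
      for g :: "nat \<Rightarrow> ennreal" by simp
    have 3: "((\<lambda>E. \<Prod>j\<in>{m<..m + n}. level_factor v L E j) \<longlongrightarrow> (\<Prod>j\<in>{m<..m + n}. level_factor v L E j)) (nhds E)"
      and 4: "(\<Prod>j\<in>{m<..m + n}. level_factor v L E j) < \<top>"
      using Suc by auto
    show ?case unfolding eq ins
      by (intro conjI tendsto_mult_ennreal[OF 2 3]) (use 1 4 in \<open>auto simp: ennreal_mult_less_top\<close>)
  qed simp
  have "((\<lambda>E. tail_weight v m L E) \<longlongrightarrow> tail_weight v m L E) (nhds E)"
    unfolding tail_weight_def
  proof (intro tendsto_sum tendsto_mult_ennreal tendsto_const)
    fix n assume n: "n \<in> {..L - m}"
    show "((\<lambda>E. \<Prod>j\<in>{m<..m + n}. level_factor v L E j) \<longlongrightarrow> (\<Prod>j\<in>{m<..m + n}. level_factor v L E j)) (nhds E)"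
    proof (cases "m \<le> L")
      case True
      then show ?thesis using prod[of n] n by simp
    next
      case False
      then show ?thesis using n by simp
    qed
    show "\<not> ((2::ennreal) ^ n = 0 \<and> (\<Prod>j\<in>{m<..m + n}. level_factor v L E j) = \<infinity> \<or>
        (2::ennreal) ^ n = \<infinity> \<and> (\<Prod>j\<in>{m<..m + n}. level_factor v L E j) = 0)"
    proof -
      have "(2::ennreal) ^ n = ennreal (2 ^ n)" using ennreal_power[of 2 n] by simp
      then show ?thesis by simp
    qed
  qed
  moreover have "M < tail_weight v m L E" using assms(2) True by simp
  ultimately show ?thesis by (rule order_tendstoD(1))
next
  case False
  \<comment> \<open>The deepest singular level is the right one to look at: beyond it elimination is
    regular, so its factor is continuous at E with value \<infinity>. For the shallower levels only
    the lower bound 1/8 is used.\<close>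
  define S where "S = {j. m < j \<and> j \<le> L \<and> (\<exists>c. denom (shifted v (of_real E)) L j c = 0)}"
  have S: "finite S" "S \<noteq> {}" using False by (auto simp: S_def regular_def)
  define j where "j = Max S"
  have "j \<in> S" unfolding j_def using S by (rule Max_in)
  then obtain c where j: "m < j" "j \<le> L" and c: "denom (shifted v (of_real E)) L j c = 0" by (auto simp: S_def)
  have reg: "regular v j L E"
    unfolding regular_def
  proof (intro allI impI notI)
    fix i b assume "j < i" "i \<le> L" "denom (shifted v (of_real E)) L i b = 0"
    then have "i \<in> S" using j by (auto simp: S_def)
    then have "i \<le> j" unfolding j_def using S(1) by simp
    then show False using \<open>j < i\<close> by simp
  qed
  have "level_factor v L E j = \<top>"
    using c by (cases c) (auto simp: level_factor_def)
  then have lim: "((\<lambda>E. level_factor v L E j) \<longlongrightarrow> \<top>) (nhds E)"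
    using tendsto_level_factor[OF reg j(2)] by simp
  \<comment> \<open>The number of levels strictly between m and j. Each may shrink the product by at
    most 1/8, which the threshold 8^k (M + 1) compensates.\<close>
  define k where "k = j - m - 1"
  have fin: "8 ^ k * (M + 1) < (\<top>::ennreal)"
    using assms(1) by (simp add: ennreal_mult_less_top power_less_top_ennreal)
  have ev: "\<forall>\<^sub>F E' in nhds E. 8 ^ k * (M + 1) < level_factor v L E' j"
    using lim fin by (rule order_tendstoD(1))
  have ge: "tail_weight v m L E' \<ge> ennreal ((1/8) ^ k) * level_factor v L E' j" for E'
  proof -
    have eq: "{m<..m + (j - m)} = insert j {m<..<j}" using j by auto
    have "ennreal (1/8) ^ card A \<le> (\<Prod>i\<in>A. level_factor v L E' i)" for A
      by (induction A rule: infinite_finite_induct) (auto intro!: mult_mono level_factor_ge)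
    then have "ennreal ((1/8) ^ k) \<le> (\<Prod>i\<in>{m<..<j}. level_factor v L E' i)"
      using ennreal_power[of "1/8" k] by (metis card_greaterThanLessThan diff_Suc_eq_diff_pred diff_diff_left
          k_def plus_1_eq_Suc add.commute zero_le_divide_1_iff zero_le_numeral)
    then have "ennreal ((1/8) ^ k) * level_factor v L E' j
        \<le> (\<Prod>i\<in>{m<..m + (j - m)}. level_factor v L E' i)"
      unfolding eq by (simp add: mult.commute mult_left_mono)
    also have "\<dots> \<le> 2 ^ (j - m) * (\<Prod>i\<in>{m<..m + (j - m)}. level_factor v L E' i)"
      using mult_right_mono[of 1 "2 ^ (j - m) :: ennreal"] by (simp add: one_le_power)
    also have "\<dots> \<le> tail_weight v m L E'"
      unfolding tail_weight_def by (rule member_le_sum) (use j in auto)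
    finally show ?thesis .
  qed
  show ?thesis using ev
  proof eventually_elim
    case (elim E')
    have "M < M + 1" using assms(1) by (cases M) (auto simp: ennreal_plus[symmetric] ennreal_less_iff simp del: ennreal_plus)
    also have "M + 1 = ennreal ((1/8) ^ k) * (8 ^ k * (M + 1))"
    proof -
      have "ennreal ((1/8) ^ k) * 8 ^ k = ennreal ((1/8) ^ k * 8 ^ k)"
        by (simp add: ennreal_mult ennreal_power[symmetric])
      also have "(1/8) ^ k * 8 ^ k = (1::real)" by (simp add: power_mult_distrib[symmetric])
      finally show ?thesis by (simp add: mult.assoc[symmetric])
    qed
    also have "\<dots> \<le> ennreal ((1/8) ^ k) * level_factor v L E' j"
      using elim by (intro mult_left_mono) auto
    also have "\<dots> \<le> tail_weight v m L E'" by (rule ge)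
    finally show ?case .
  qed
qed

section \<open>Decay of eigenvectors from level to level\<close>

definition level_amplitude :: "(vertex \<Rightarrow> real) \<Rightarrow> nat \<Rightarrow> real" where
  "level_amplitude f n = (\<Sum>x | length x = n. sqrt \<bar>f x\<bar>)"

lemma finite_level [simp]: "finite {x :: vertex. length x = n}"
  using finite_lists_length_eq[of "UNIV :: bool set" n] by simp

lemma card_level: "card {x :: vertex. length x = n} = 2 ^ n"
  using card_lists_length_eq[of "UNIV :: bool set" n] by simp

lemma sum_level_Suc:
  "(\<Sum>x | length x = Suc n. f x) = (\<Sum>x | length x = n. f (x @ [False]) + f (x @ [True]))"
  for f :: "vertex \<Rightarrow> 'b::comm_monoid_add"
proof -
  have eq: "{x :: vertex. length x = Suc n} =
      (\<lambda>x. x @ [False]) ` {x. length x = n} \<union> (\<lambda>x. x @ [True]) ` {x. length x = n}"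
  proof (rule set_eqI)
    fix x :: vertex
    show "x \<in> {x. length x = Suc n} \<longleftrightarrow> x \<in> (\<lambda>x. x @ [False]) ` {x. length x = n} \<union> (\<lambda>x. x @ [True]) ` {x. length x = n}"
    proof (cases x rule: rev_cases)
      case (snoc z c)
      then show ?thesis by (cases c) auto
    qed auto
  qed
  have "(\<Sum>x | length x = Suc n. f x) = sum f ((\<lambda>x. x @ [False]) ` {x. length x = n})
      + sum f ((\<lambda>x. x @ [True]) ` {x. length x = n})"
    unfolding eq by (rule sum.union_disjoint) auto
  also have "\<dots> = (\<Sum>x | length x = n. f (x @ [False])) + (\<Sum>x | length x = n. f (x @ [True]))"
    by (subst (1 2) sum.reindex) (auto simp: inj_on_def)
  finally show ?thesis by (simp add: sum.distrib)
qed

lemma sum_squares_le_level_amplitude: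
  assumes "\<And>x. \<bar>f x\<bar> \<le> 1"
  shows "(\<Sum>x | length x = n. (f x)\<^sup>2) \<le> level_amplitude f n"
  unfolding level_amplitude_def
proof (rule sum_mono)
  fix x
  have le: "\<bar>f x\<bar>\<^sup>2 \<le> \<bar>f x\<bar>"
    using mult_left_le[of "\<bar>f x\<bar>" "\<bar>f x\<bar>"] assms[of x] by (simp only: power2_eq_square abs_ge_zero)
  then have "(f x)\<^sup>2 \<le> \<bar>f x\<bar>" by (simp only: power2_abs)
  also have "\<dots> \<le> sqrt \<bar>f x\<bar>" using le by (rule real_le_rsqrt)
  finally show "(f x)\<^sup>2 \<le> sqrt \<bar>f x\<bar>" .
qed

context
  fixes L v p e
  assumes basis: "box_eigenbasis L (on_tree v) p e"
begin

text \<open>As \<open>denom\<close> depends on level and label only, every vertex of level n passes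
  the same two ratios to its children, and these factor out of the sum over the level.\<close>

lemma level_amplitude_Suc_le:
  assumes i: "i < card (tree_box L)" and reg: "regular v m L (e i)" and n: "m \<le> n" "n < L"
  shows "ennreal (level_amplitude (p i) (Suc n)) \<le> ennreal (level_amplitude (p i) n) * level_factor v L (e i) (Suc n)"
proof -
  let ?w = "shifted v (of_real (e i))"
  let ?d = "\<lambda>c. sqrt (cmod (denom ?w L (Suc n) c))"
  have d: "?d c > 0" for c using reg n by (simp add: regular_def)
  have child: "sqrt \<bar>p i (x @ [c])\<bar> = sqrt \<bar>p i x\<bar> * inverse (?d c)" if x: "length x = n" for x c
  proof -
    have "denom ?w L (length (x @ [c])) (last (x @ [c])) * complex_of_real (p i (x @ [c]))
        = complex_of_real (p i (butlast (x @ [c])))"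
    proof (rule denom_mult_eq_parent)
      show "complex_of_real (p i x) = 0" if "L < length x" for x
        using eigenbasis_support[OF basis i, of x] that by (simp add: tree_box_def)
      show "site ?w ((x @ [c]) @ u) * complex_of_real (p i ((x @ [c]) @ u)) = adj (\<lambda>x. complex_of_real (p i x)) ((x @ [c]) @ u)"
        if "length ((x @ [c]) @ u) \<le> L" for u
        using eigenbasis_eq[OF basis i, of "(x @ [c]) @ u"] that
        by (simp add: tree_box_def schr_def site_def shifted_def on_tree_def algebra_simps)
      show "denom ?w L j b \<noteq> 0" if "length (x @ [c]) < j" "j \<le> L" for j b
        using reg that n x by (simp add: regular_def)
    qed (use x n in auto)
    then have "denom ?w L (Suc n) c * complex_of_real (p i (x @ [c])) = complex_of_real (p i x)"
      using x by simp
    then have "cmod (denom ?w L (Suc n) c) * \<bar>p i (x @ [c])\<bar> = \<bar>p i x\<bar>"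
      by (metis norm_mult norm_of_real)
    then have "?d c * sqrt \<bar>p i (x @ [c])\<bar> = sqrt \<bar>p i x\<bar>"
      by (simp flip: real_sqrt_mult)
    then show ?thesis using d[of c] by (simp add: field_simps)
  qed
  have "level_amplitude (p i) (Suc n) = level_amplitude (p i) n * (inverse (?d False) + inverse (?d True))"
    unfolding level_amplitude_def sum_level_Suc sum_distrib_right
    by (intro sum.cong refl) (simp add: child distrib_left)
  also have "ennreal \<dots> = ennreal (level_amplitude (p i) n) * ennreal (inverse (?d False) + inverse (?d True))"
    using d by (intro ennreal_mult) (auto simp: level_amplitude_def intro!: sum_nonneg add_nonneg_nonneg)
  also have "ennreal (inverse (?d False) + inverse (?d True)) \<le> level_factor v L (e i) (Suc n)"
    using d[of False] d[of True] unfolding level_factor_def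
    by (subst (1 2) inverse_ennreal) (auto simp: add_increasing simp del: real_sqrt_gt_0_iff)
  finally show ?thesis by (simp add: mult_left_mono)
qed

text \<open>One factor 2^m is the trivial bound at level m, which has 2^m vertices with values at
  most 1; the other converts the gain 2^(n - m) of the weight into 2^n.\<close>

lemma level_amplitude_tail:
  assumes i: "i < card (tree_box L)" and reg: "regular v m L (e i)"
    and M: "tail_weight v m L (e i) \<le> ennreal M" "M \<ge> 0" and n: "m \<le> n" "n \<le> L"
  shows "level_amplitude (p i) n \<le> 4 ^ m * M / 2 ^ n"
proof -
  have ind: "ennreal (level_amplitude (p i) (m + k))
      \<le> 2 ^ m * (\<Prod>j\<in>{m<..m + k}. level_factor v L (e i) j)" if "m + k \<le> L" for k
    using that
  proof (induction k)
    case 0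
    have "level_amplitude (p i) m \<le> (\<Sum>x\<in>{x::vertex. length x = m}. 1)"
      unfolding level_amplitude_def
      by (rule sum_mono) (use eigenbasis_abs_le_1[OF basis i] in auto)
    then have "ennreal (level_amplitude (p i) m) \<le> ennreal (2 ^ m)"
      by (intro ennreal_leI) (simp add: card_level)
    then show ?case by (simp add: ennreal_power[symmetric])
  next
    case (Suc k)
    have eq: "{m<..m + Suc k} = insert (m + Suc k) {m<..m + k}" by auto
    have "ennreal (level_amplitude (p i) (Suc (m + k)))
        \<le> ennreal (level_amplitude (p i) (m + k)) * level_factor v L (e i) (Suc (m + k))"
      by (rule level_amplitude_Suc_le[OF i reg]) (use Suc in auto)
    also have "\<dots> \<le> (2 ^ m * (\<Prod>j\<in>{m<..m + k}. level_factor v L (e i) j)) * level_factor v L (e i) (Suc (m + k))"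
      using Suc by (intro mult_right_mono) auto
    finally show ?case unfolding eq by (simp add: mult_ac)
  qed
  define k where "k = n - m"
  have k: "n = m + k" "m + k \<le> L" using n by (auto simp: k_def)
  have "2 ^ k * (\<Prod>j\<in>{m<..m + k}. level_factor v L (e i) j) \<le> tail_weight v m L (e i)"
    unfolding tail_weight_def by (rule member_le_sum) (use k in auto)
  also have "\<dots> \<le> ennreal M" by (rule M)
  finally have t: "2 ^ k * (\<Prod>j\<in>{m<..m + k}. level_factor v L (e i) j) \<le> ennreal M" .
  have "2 ^ k * ennreal (level_amplitude (p i) n) \<le> 2 ^ k * (2 ^ m * (\<Prod>j\<in>{m<..m + k}. level_factor v L (e i) j))"
    unfolding k(1) by (intro mult_left_mono ind k) simp
  also have "\<dots> = 2 ^ m * (2 ^ k * (\<Prod>j\<in>{m<..m + k}. level_factor v L (e i) j))" by (simp add: mult_ac)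
  also have "\<dots> \<le> 2 ^ m * ennreal M" by (intro mult_left_mono t) simp
  finally have "ennreal (2 ^ k * level_amplitude (p i) n) \<le> ennreal (2 ^ m * M)"
    by (simp add: ennreal_mult' ennreal_power[symmetric])
  then have "2 ^ k * level_amplitude (p i) n \<le> 2 ^ m * M"
    using M(2) by (subst (asm) ennreal_le_iff) auto
  then have "2 ^ m * (2 ^ k * level_amplitude (p i) n) \<le> 2 ^ m * (2 ^ m * M)" by simp
  moreover have "(2::real) ^ m * 2 ^ m = 4 ^ m" by (simp flip: power_mult_distrib)
  ultimately have "2 ^ n * level_amplitude (p i) n \<le> 4 ^ m * M"
    by (simp add: k(1) power_add mult.assoc[symmetric])
  then show ?thesis by (simp add: field_simps)
qed

text \<open>The geometric tail from level n0 on is at most 2 A / 2^n0 with A = 4^m M, hence at most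
  half of the unit mass. The choice of n0 does not involve L.\<close>

lemma eigenvector_mass_near_root:
  assumes i: "i < card (tree_box L)" and reg: "regular v m L (e i)"
    and M: "tail_weight v m L (e i) \<le> ennreal M" "M \<ge> 0" and n0: "m \<le> n0" "4 * (4 ^ m * M) \<le> 2 ^ n0"
  shows "(\<Sum>x\<in>tree_box n0. (p i x)\<^sup>2) \<ge> 1 / 2"
proof -
  define A where "A = 4 ^ m * M"
  have A: "A \<ge> 0" using M by (simp add: A_def)
  have "(\<Sum>x\<in>tree_box L. (p i x)\<^sup>2) \<le> (\<Sum>x\<in>tree_box n0. (p i x)\<^sup>2) + (\<Sum>x\<in>(\<Union>n\<in>{n0..L}. {x. length x = n}). (p i x)\<^sup>2)"
  proof -
    have "(\<Sum>x\<in>tree_box L. (p i x)\<^sup>2) \<le> (\<Sum>x\<in>tree_box n0 \<union> (\<Union>n\<in>{n0..L}. {x. length x = n}). (p i x)\<^sup>2)"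
      by (rule sum_mono2) (auto simp: tree_box_def[of L] tree_box_def[of n0, symmetric], auto simp: tree_box_def)
    also have "\<dots> \<le> (\<Sum>x\<in>tree_box n0. (p i x)\<^sup>2) + (\<Sum>x\<in>(\<Union>n\<in>{n0..L}. {x. length x = n}). (p i x)\<^sup>2)"
    proof -
      let ?U = "\<Union>n\<in>{n0..L}. {x::vertex. length x = n}"
      have "(\<Sum>x\<in>tree_box n0 \<union> ?U. (p i x)\<^sup>2) + (\<Sum>x\<in>tree_box n0 \<inter> ?U. (p i x)\<^sup>2)
          = (\<Sum>x\<in>tree_box n0. (p i x)\<^sup>2) + (\<Sum>x\<in>?U. (p i x)\<^sup>2)"
        by (rule sum.union_inter) auto
      moreover have "(\<Sum>x\<in>tree_box n0 \<inter> ?U. (p i x)\<^sup>2) \<ge> 0" by (intro sum_nonneg) auto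
      ultimately show ?thesis by linarith
    qed
    finally show ?thesis .
  qed
  moreover have "(\<Sum>x\<in>(\<Union>n\<in>{n0..L}. {x. length x = n}). (p i x)\<^sup>2) \<le> 2 * A / 2 ^ n0"
  proof -
    have "(\<Sum>x\<in>(\<Union>n\<in>{n0..L}. {x. length x = n}). (p i x)\<^sup>2)
        = (\<Sum>n\<in>{n0..L}. \<Sum>x | length x = n. (p i x)\<^sup>2)"
      by (rule sum.UNION_disjoint) auto
    also have "\<dots> \<le> (\<Sum>n\<in>{n0..L}. A / 2 ^ n)"
    proof (rule sum_mono)
      fix n assume n: "n \<in> {n0..L}"
      have "(\<Sum>x | length x = n. (p i x)\<^sup>2) \<le> level_amplitude (p i) n"
        by (rule sum_squares_le_level_amplitude) (rule eigenbasis_abs_le_1[OF basis i])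
      also have "\<dots> \<le> A / 2 ^ n" unfolding A_def
        by (rule level_amplitude_tail[OF i reg M]) (use n n0 in auto)
      finally show "(\<Sum>x | length x = n. (p i x)\<^sup>2) \<le> A / 2 ^ n" .
    qed
    also have "\<dots> \<le> 2 * A / 2 ^ n0"
    proof -
      \<comment> \<open>Subtracting the last term makes the bound on the geometric sum
        inductive.\<close>
      have "(\<Sum>n\<in>{n0..L}. A / 2 ^ n) \<le> 2 * A / 2 ^ n0 - (if n0 \<le> L then A / 2 ^ L else 0)"
      proof (cases "n0 \<le> L")
        case True
        then show ?thesis
        proof (induction L rule: dec_induct)
          case (step n)
          have "(\<Sum>n\<in>{n0..Suc n}. A / 2 ^ n) = (\<Sum>n\<in>{n0..n}. A / 2 ^ n) + A / 2 ^ Suc n"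
            using step by simp
          moreover have "A / 2 ^ n = 2 * (A / 2 ^ Suc n)" by simp
          moreover have "(\<Sum>n\<in>{n0..n}. A / 2 ^ n) \<le> 2 * A / 2 ^ n0 - A / 2 ^ n" using step by simp
          ultimately have "(\<Sum>n\<in>{n0..Suc n}. A / 2 ^ n) \<le> 2 * A / 2 ^ n0 - A / 2 ^ Suc n" by linarith
          then show ?case using step by simp
        qed simp
      qed (use A in simp)
      then show ?thesis using A by (auto split: if_splits intro: order_trans)
    qed
    finally show ?thesis .
  qed
  moreover have "2 * A / 2 ^ n0 \<le> 1 / 2" using n0(2) unfolding A_def by (simp add: field_simps)
  ultimately show ?thesis using eigenbasis_norm[OF basis i] by linarith
qed

text \<open>Each counted eigenvector puts mass at least 1/2 into a box fixed independently of L,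
  while by completeness all eigenvectors together have mass at most 1 at each vertex.\<close>

lemma card_localized_eigenvectors:
  assumes M: "M \<ge> 0" and n0: "m \<le> n0" "4 * (4 ^ m * M) \<le> 2 ^ n0"
  shows "card {i. i < card (tree_box L) \<and> regular v m L (e i) \<and> tail_weight v m L (e i) \<le> ennreal M}
    \<le> 2 * card (tree_box n0)" (is "card ?G \<le> _")
proof -
  have "real (card ?G) * (1 / 2) = (\<Sum>i\<in>?G. 1 / 2)" by simp
  also have "\<dots> \<le> (\<Sum>i\<in>?G. \<Sum>x\<in>tree_box n0. (p i x)\<^sup>2)"
    by (rule sum_mono) (use eigenvector_mass_near_root M n0 in auto)
  also have "\<dots> = (\<Sum>x\<in>tree_box n0. \<Sum>i\<in>?G. (p i x)\<^sup>2)" by (rule sum.swap)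
  also have "\<dots> \<le> (\<Sum>x\<in>tree_box n0. 1)"
  proof (rule sum_mono)
    fix x
    have "(\<Sum>i\<in>?G. (p i x)\<^sup>2) \<le> (\<Sum>i<card (tree_box L). (p i x)\<^sup>2)" by (rule sum_mono2) auto
    also have "\<dots> \<le> 1"
    proof (cases "x \<in> tree_box L")
      case True
      then show ?thesis using eigenbasis_complete[OF basis True True] by (simp add: power2_eq_square)
    next
      case False
      then show ?thesis using eigenbasis_support[OF basis] by simp
    qed
    finally show "(\<Sum>i\<in>?G. (p i x)\<^sup>2) \<le> 1" .
  qed
  finally have "real (card ?G) \<le> real (2 * card (tree_box n0))" by simp
  then show ?thesis by (simp only: of_nat_le_iff)
qed

text \<open>The Poisson kernel of width 1/(k+1) has mass at least 1 on the interval of radius 1/(k+1)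
  around an eigenvalue, and by lower semicontinuity the weight exceeds M there once k is large.\<close>

lemma delocalized_mass_bound:
  assumes B: "\<And>x. \<bar>on_tree v x\<bar> \<le> B" and y: "length y \<le> L"
  shows "ennreal M * ennreal (\<Sum>i | i < card (tree_box L) \<and>
        \<not> (regular v m L (e i) \<and> tail_weight v m L (e i) \<le> ennreal M). (p i y)\<^sup>2)
    \<le> liminf (\<lambda>k. \<integral>\<^sup>+E. ennreal (Im (green_diag (shifted v (Complex E (1 / Suc k))) L y)) *
          tail_weight v m L E * indicator {-(B + 4)..B + 4} E \<partial>lborel)"
    (is "_ * ennreal (\<Sum>i\<in>?D. _) \<le> liminf ?J")
proof (rule Liminf_bounded)
  have finD: "finite ?D" by simp
  have "\<forall>\<^sub>F E in nhds (e i). ennreal M < tail_weight v m L E" if "i \<in> ?D" for i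
    by (rule tail_weight_lower_semicontinuous) (use that in auto)
  then have "\<forall>i\<in>?D. \<exists>d>0. \<forall>E. dist E (e i) < d \<longrightarrow> ennreal M < tail_weight v m L E"
    by (simp only: eventually_nhds_metric) blast
  then have "\<exists>d. \<forall>i\<in>?D. d i > 0 \<and> (\<forall>E. dist E (e i) < d i \<longrightarrow> ennreal M < tail_weight v m L E)"
    by (rule bchoice)
  then obtain d where d: "\<And>i. i \<in> ?D \<Longrightarrow> d i > 0"
    "\<And>i E. i \<in> ?D \<Longrightarrow> dist E (e i) < d i \<Longrightarrow> ennreal M < tail_weight v m L E" by blast
  have "\<forall>\<^sub>F k in sequentially. \<forall>i\<in>?D. 1 / real (Suc k) < d i"
  proof (rule eventually_ball_finite[OF finD], rule ballI)
    fix i assume "i \<in> ?D"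
    then show "\<forall>\<^sub>F k in sequentially. 1 / real (Suc k) < d i"
      using order_tendstoD(2)[OF LIMSEQ_inverse_real_of_nat d(1)[of i]] by (simp add: inverse_eq_divide)
  qed
  then show "\<forall>\<^sub>F k in sequentially. ennreal M * ennreal (\<Sum>i\<in>?D. (p i y)\<^sup>2) \<le> ?J k"
  proof eventually_elim
    case (elim k)
    define \<eta> where "\<eta> = 1 / real (Suc k)"
    have \<eta>: "0 < \<eta>" "\<eta> \<le> 1" "\<And>i. i \<in> ?D \<Longrightarrow> \<eta> < d i" using elim by (auto simp: \<eta>_def)
    \<comment> \<open>Eigenvalues lie within B + 3 and the width is at most 1, which explains the
      energy window of radius B + 4.\<close>
    have eb: "\<bar>e i\<bar> \<le> B + 3" if "i \<in> ?D" for i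
      using eigenbasis_energy_bound[OF basis _ B] that by auto
    have point: "(\<Sum>i\<in>?D. ennreal M * ennreal ((p i y)\<^sup>2 / (2 * \<eta>)) * indicator {e i - \<eta>..e i + \<eta>} E)
        \<le> ennreal (Im (green_diag (shifted v (Complex E \<eta>)) L y)) *
          tail_weight v m L E * indicator {-(B + 4)..B + 4} E" for E
    proof -
      let ?D' = "{i \<in> ?D. E \<in> {e i - \<eta>..e i + \<eta>}}"
      have lhs: "(\<Sum>i\<in>?D. ennreal M * ennreal ((p i y)\<^sup>2 / (2 * \<eta>)) * indicator {e i - \<eta>..e i + \<eta>} E)
          = ennreal M * ennreal (\<Sum>i\<in>?D'. (p i y)\<^sup>2 / (2 * \<eta>))"
      proof -
        have "(\<Sum>i\<in>?D. ennreal M * ennreal ((p i y)\<^sup>2 / (2 * \<eta>)) * indicator {e i - \<eta>..e i + \<eta>} E)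
            = (\<Sum>i\<in>?D'. ennreal M * ennreal ((p i y)\<^sup>2 / (2 * \<eta>)))"
          by (rule sum.mono_neutral_cong_right[OF finD]) (auto simp: indicator_def split: if_splits)
        also have "\<dots> = ennreal M * (\<Sum>i\<in>?D'. ennreal ((p i y)\<^sup>2 / (2 * \<eta>)))" by (rule sum_distrib_left[symmetric])
        also have "(\<Sum>i\<in>?D'. ennreal ((p i y)\<^sup>2 / (2 * \<eta>))) = ennreal (\<Sum>i\<in>?D'. (p i y)\<^sup>2 / (2 * \<eta>))"
          by (rule sum_ennreal) (use \<eta> in auto)
        finally show ?thesis .
      qed
      show ?thesis
      proof (cases "?D' = {}")
        case True
        show ?thesis unfolding lhs True by simp
      next
        case False
        then obtain i where i: "i \<in> ?D" "E \<in> {e i - \<eta>..e i + \<eta>}" by blast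
        have "dist E (e i) < d i" using i(2) \<eta>(3)[OF i(1)] by (auto simp: dist_real_def abs_less_iff)
        then have w: "ennreal M \<le> tail_weight v m L E" using d(2)[OF i(1)] by (simp add: less_imp_le)
        have ind: "indicator {-(B + 4)..B + 4} E = (1::ennreal)"
          using i(2) eb[OF i(1)] \<eta>(2) by (auto simp: abs_le_iff)
        have "(\<Sum>i\<in>?D'. (p i y)\<^sup>2 / (2 * \<eta>)) \<le> (\<Sum>i\<in>?D'. (p i y)\<^sup>2 * (\<eta> / ((e i - E)\<^sup>2 + \<eta>\<^sup>2)))"
        proof (rule sum_mono)
          fix i assume "i \<in> ?D'"
          then have "\<bar>e i - E\<bar> \<le> \<bar>\<eta>\<bar>" using \<eta> by (auto simp: abs_le_iff)
          then have le: "(e i - E)\<^sup>2 \<le> \<eta>\<^sup>2" by (simp only: abs_le_square_iff)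
          have pos: "(e i - E)\<^sup>2 + \<eta>\<^sup>2 > 0" using \<eta>(1) by (simp add: add_nonneg_pos)
          \<comment> \<open>Within distance \<eta> of its eigenvalue a Poisson kernel is smallest at
            the ends of the interval, where it equals 1 / (2 \<eta>); the interval has length 2
            \<eta>.\<close>
          have "1 / (2 * \<eta>) = \<eta> / (2 * \<eta>\<^sup>2)" using \<eta>(1) by (simp add: power2_eq_square)
          also have "\<dots> \<le> \<eta> / ((e i - E)\<^sup>2 + \<eta>\<^sup>2)" using le pos \<eta>(1) by (intro divide_left_mono mult_pos_pos) auto
          finally have "(p i y)\<^sup>2 * (1 / (2 * \<eta>)) \<le> (p i y)\<^sup>2 * (\<eta> / ((e i - E)\<^sup>2 + \<eta>\<^sup>2))"
            by (rule mult_left_mono) simp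
          then show "(p i y)\<^sup>2 / (2 * \<eta>) \<le> (p i y)\<^sup>2 * (\<eta> / ((e i - E)\<^sup>2 + \<eta>\<^sup>2))" by simp
        qed
        also have "\<dots> \<le> (\<Sum>i<card (tree_box L). (p i y)\<^sup>2 * (\<eta> / ((e i - E)\<^sup>2 + \<eta>\<^sup>2)))"
          by (rule sum_mono2) (use \<eta>(1) in auto)
        also have "\<dots> = Im (green_diag (shifted v (Complex E \<eta>)) L y)"
          by (rule Im_green_diag_eq[OF basis y \<eta>(1), symmetric])
        finally have "ennreal (\<Sum>i\<in>?D'. (p i y)\<^sup>2 / (2 * \<eta>)) \<le> ennreal (Im (green_diag (shifted v (Complex E \<eta>)) L y))"
          by (rule ennreal_leI)
        then have "ennreal M * ennreal (\<Sum>i\<in>?D'. (p i y)\<^sup>2 / (2 * \<eta>))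
            \<le> tail_weight v m L E * ennreal (Im (green_diag (shifted v (Complex E \<eta>)) L y))"
          using w by (intro mult_mono) auto
        then show ?thesis unfolding lhs ind by (simp add: mult.commute)
      qed
    qed
    have "ennreal M * ennreal (\<Sum>i\<in>?D. (p i y)\<^sup>2) = (\<Sum>i\<in>?D. ennreal M * ennreal ((p i y)\<^sup>2))"
    proof -
      have "ennreal (\<Sum>i\<in>?D. (p i y)\<^sup>2) = (\<Sum>i\<in>?D. ennreal ((p i y)\<^sup>2))"
        by (rule sum_ennreal[symmetric]) simp
      then show ?thesis by (simp only: sum_distrib_left)
    qed
    also have "\<dots> = (\<Sum>i\<in>?D. \<integral>\<^sup>+E. ennreal M * ennreal ((p i y)\<^sup>2 / (2 * \<eta>)) * indicator {e i - \<eta>..e i + \<eta>} E \<partial>lborel)"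
    proof (rule sum.cong[OF refl])
      fix i
      have "(\<integral>\<^sup>+E. ennreal M * ennreal ((p i y)\<^sup>2 / (2 * \<eta>)) * indicator {e i - \<eta>..e i + \<eta>} E \<partial>lborel)
          = ennreal M * ennreal ((p i y)\<^sup>2 / (2 * \<eta>)) * ennreal (2 * \<eta>)"
        using \<eta>(1) by (subst nn_integral_cmult_indicator) auto
      also have "\<dots> = ennreal M * ennreal ((p i y)\<^sup>2)"
      proof -
        have "ennreal ((p i y)\<^sup>2 / (2 * \<eta>)) * ennreal (2 * \<eta>) = ennreal ((p i y)\<^sup>2)"
          using \<eta>(1) by (subst ennreal_mult[symmetric]) auto
        then show ?thesis by (simp only: mult.assoc)
      qed
      finally show "ennreal M * ennreal ((p i y)\<^sup>2)
          = (\<integral>\<^sup>+E. ennreal M * ennreal ((p i y)\<^sup>2 / (2 * \<eta>)) * indicator {e i - \<eta>..e i + \<eta>} E \<partial>lborel)" ..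
    qed
    also have "\<dots> = (\<integral>\<^sup>+E. (\<Sum>i\<in>?D. ennreal M * ennreal ((p i y)\<^sup>2 / (2 * \<eta>)) * indicator {e i - \<eta>..e i + \<eta>} E) \<partial>lborel)"
      by (rule nn_integral_sum[symmetric]) auto
    also have "\<dots> \<le> ?J k" unfolding \<eta>_def[symmetric] by (rule nn_integral_mono) (rule point)
    finally show ?case .
  qed
qed

end

section \<open>Fractional moments\<close>

definition level_potential :: "real \<Rightarrow> (nat \<Rightarrow> real) \<times> (nat \<Rightarrow> real \<times> real) \<Rightarrow> nat \<Rightarrow> bool \<Rightarrow> real" where
  "level_potential \<kappa> \<omega> j c =
     fst \<omega> j + \<kappa> * (if j = 0 then 0 else if c then snd (snd \<omega> j) else fst (snd \<omega> j))"

lemma potential_eq_on_tree: "potential \<kappa> \<omega> = on_tree (level_potential \<kappa> \<omega>)"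
  by (auto simp: fun_eq_iff potential_def on_tree_def level_potential_def label_def)

lemma self_energy_cong:
  assumes "\<And>j c. n < j \<Longrightarrow> w j c = w' j c"
  shows "self_energy w n k = self_energy w' n k"
  using assms by (induction k arbitrary: n) auto

lemma level_factor_cong:
  assumes "\<And>i c. j \<le> i \<Longrightarrow> v i c = v' i c"
  shows "level_factor v L E j = level_factor v' L E j"
proof -
  have "self_energy (shifted v (of_real E)) j k = self_energy (shifted v' (of_real E)) j k" for k
    by (rule self_energy_cong) (use assms in \<open>auto simp: shifted_def\<close>)
  then show ?thesis using assms[of j] by (simp add: level_factor_def denom_def shifted_def)
qed

text \<open>The factors with j > m see only levels beyond m. This is the independence that lets the
  weight leave the average over \<open>q m\<close>.\<close>

lemma tail_weight_cong:
  assumes "\<And>j c. m < j \<Longrightarrow> v j c = v' j c"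
  shows "tail_weight v m L E = tail_weight v' m L E"
  unfolding tail_weight_def
  by (intro sum.cong prod.cong refl arg_cong2[where f = "(*)"] level_factor_cong assms) auto

section \<open>Measurability of the eliminated quantities, and resampling of one coordinate\<close>

lemma measurable_self_energy:
  assumes "\<And>j c. (\<lambda>x. W x j c) \<in> borel_measurable M"
  shows "(\<lambda>x. self_energy (W x) n k) \<in> borel_measurable M"
proof (induction k arbitrary: n)
  case (Suc k)
  note [measurable] = Suc assms
  show ?case unfolding self_energy.simps by measurable
qed simp

lemma measurable_denom:
  assumes [measurable]: "\<And>j c. (\<lambda>x. W x j c) \<in> borel_measurable M"
  shows "(\<lambda>x. denom (W x) L j c) \<in> borel_measurable M"
proof -
  note [measurable] = measurable_self_energy[OF assms]
  show ?thesis unfolding denom_def by measurable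
qed

lemma measurable_green_diag:
  assumes [measurable]: "\<And>j c. (\<lambda>x. W x j c) \<in> borel_measurable M"
  shows "(\<lambda>x. green_diag (W x) L y) \<in> borel_measurable M"
proof -
  note [measurable] = measurable_self_energy[OF assms] measurable_denom[OF assms]
  have [measurable]: "(\<lambda>x. updiag (W x) L r) \<in> borel_measurable M" for r
    by (induction r) (auto simp del: add_uminus_conv_diff intro!: borel_measurable_diff borel_measurable_divide)
  show ?thesis unfolding green_diag_def by measurable
qed

lemma measurable_tail_weight:
  assumes [measurable]: "\<And>j c. (\<lambda>x. V x j c) \<in> borel_measurable M" "e \<in> borel_measurable M"
  shows "(\<lambda>x. tail_weight (V x) m L (e x)) \<in> borel_measurable M"
    and "(\<lambda>x. level_factor (V x) L (e x) j) \<in> borel_measurable M"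
proof -
  have "(\<lambda>x. shifted (V x) (of_real (e x)) j c) \<in> borel_measurable M" for j c
    unfolding shifted_def by measurable
  note [measurable] = measurable_denom[OF this]
  show [measurable]: "(\<lambda>x. level_factor (V x) L (e x) j) \<in> borel_measurable M" for j
    unfolding level_factor_def by measurable
  show "(\<lambda>x. tail_weight (V x) m L (e x)) \<in> borel_measurable M"
    unfolding tail_weight_def by measurable
qed

text \<open>Stands in for conditional expectation given all other coordinates: an estimate of the
  inner integral in every fixed environment passes to the full average.\<close>

lemma nn_integral_PiM_resample:
  fixes N :: "'i \<Rightarrow> 'a measure"
  assumes N: "\<And>i. prob_space (N i)" and f: "f \<in> borel_measurable (PiM UNIV N)"
  shows "(\<integral>\<^sup>+q. f q \<partial>PiM UNIV N) = (\<integral>\<^sup>+q. \<integral>\<^sup>+x. f (q(i := x)) \<partial>N i \<partial>PiM UNIV N)"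
proof -
  interpret Ni: prob_space "N i" by (rule N)
  interpret P: prob_space "PiM UNIV N" by (rule prob_space_PiM[OF N])
  interpret pair_sigma_finite "N i" "PiM UNIV N" ..
  have eq: "distr (N i \<Otimes>\<^sub>M PiM UNIV N) (PiM UNIV N) (\<lambda>(x, X). X(i := x)) = PiM UNIV N"
    using distr_pair_PiM_eq_PiM[of UNIV N i] N by simp
  have m: "(\<lambda>(x, X). X(i := x)) \<in> N i \<Otimes>\<^sub>M PiM UNIV N \<rightarrow>\<^sub>M PiM UNIV N"
    using measurable_fun_upd[of UNIV UNIV i "\<lambda>p. snd p" "N i \<Otimes>\<^sub>M PiM UNIV N" N fst]
    by (simp add: case_prod_beta')
  have "(\<integral>\<^sup>+q. f q \<partial>PiM UNIV N) = (\<integral>\<^sup>+p. f (case p of (x, X) \<Rightarrow> X(i := x)) \<partial>(N i \<Otimes>\<^sub>M PiM UNIV N))"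
  proof -
    have "(\<integral>\<^sup>+q. f q \<partial>PiM UNIV N) = (\<integral>\<^sup>+q. f q \<partial>distr (N i \<Otimes>\<^sub>M PiM UNIV N) (PiM UNIV N) (\<lambda>(x, X). X(i := x)))"
      by (simp only: eq)
    also have "\<dots> = (\<integral>\<^sup>+p. f (case p of (x, X) \<Rightarrow> X(i := x)) \<partial>(N i \<Otimes>\<^sub>M PiM UNIV N))"
      by (rule nn_integral_distr[OF m]) (simp add: f)
    finally show ?thesis .
  qed
  also have "\<dots> = (\<integral>\<^sup>+q. \<integral>\<^sup>+x. f (case (x, q) of (x, X) \<Rightarrow> X(i := x)) \<partial>N i \<partial>PiM UNIV N)"
    by (rule nn_integral_snd[symmetric]) (rule measurable_compose[OF m f])
  finally show ?thesis by simp
qed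

lemma nn_integral_inverse_sqrt:
  assumes "A \<ge> 0"
  shows "(\<integral>\<^sup>+u. ennreal (u powr (-1/2)) * indicator {0..A} u \<partial>lborel) = ennreal (2 * sqrt A)"
proof -
  have "((\<lambda>x. x powr (-1/2)) has_integral (A powr (-1/2 + 1) / (-1/2 + 1))) {0..A}"
    by (rule has_integral_powr_from_0) (use assms in auto)
  then have "((\<lambda>x. x powr (-1/2)) has_integral (2 * sqrt A)) {0..A}"
    using assms by (simp add: powr_half_sqrt mult.commute)
  then show ?thesis by (intro nn_integral_has_integral_lebesgue') auto
qed

text \<open>Put u = \<kappa> x + b and cut at |u| = 1024. Outside, the integrand is at most 1/32.
  Inside, |u|^(-1/2) has Lebesgue integral 128, hence 128 / \<kappa> in the variable x, and C times
  this is at most 1/32 as soon as \<kappa> \<ge> 4096 C.\<close>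

lemma fractional_moment_bound:
  fixes \<mu> :: "real measure"
  assumes \<mu>: "\<mu> = density lborel (\<lambda>x. ennreal (f x))" "f \<in> borel_measurable lborel"
    and f: "\<And>x. f x \<le> C" and C: "C > 0" and prob: "prob_space \<mu>" and \<kappa>: "\<kappa> \<ge> 4096 * C"
  shows "(\<integral>\<^sup>+x. inverse (ennreal (sqrt \<bar>\<kappa> * x + b\<bar>)) \<partial>\<mu>) \<le> ennreal (1/16)"
proof -
  interpret prob_space \<mu> by fact
  have sets[measurable_cong]: "sets \<mu> = sets borel" using \<mu> by simp
  have \<kappa>0: "\<kappa> > 0" using \<kappa> C by (meson less_le_trans mult_pos_pos zero_less_numeral)
  define g where "g u = ennreal (u powr (-1/2)) * indicator {0..1024} u" for u :: real
  have [measurable]: "g \<in> borel_measurable borel" unfolding g_def by measurable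
  \<comment> \<open>Since \<open>g\<close> lives on {0..1024}, the first summand covers u \<ge> 0
    and the second, by reflection, u \<le> 0.\<close>
  define h where "h x = g (b + \<kappa> * x) + g (- b + - \<kappa> * x)" for x
  have [measurable]: "h \<in> borel_measurable borel" unfolding h_def by measurable
  have gint: "(\<integral>\<^sup>+u. g u \<partial>lborel) = ennreal 64"
    unfolding g_def using nn_integral_inverse_sqrt[of 1024] real_sqrt_unique[of 32 1024] by simp
  have aff: "(\<integral>\<^sup>+x. g (t + c * x) \<partial>lborel) = ennreal (64 / \<bar>c\<bar>)" if "c \<noteq> 0" for t c
  proof -
    have "ennreal \<bar>c\<bar> * (\<integral>\<^sup>+x. g (t + c * x) \<partial>lborel) = ennreal 64"
      using nn_integral_real_affine[of g c t] that gint by simp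
    then have "ennreal (1 / \<bar>c\<bar>) * (ennreal \<bar>c\<bar> * (\<integral>\<^sup>+x. g (t + c * x) \<partial>lborel)) = ennreal (1 / \<bar>c\<bar>) * ennreal 64"
      by simp
    moreover have "ennreal (1 / \<bar>c\<bar>) * ennreal \<bar>c\<bar> = 1"
      using that by (subst ennreal_mult[symmetric]) auto
    moreover have "ennreal (1 / \<bar>c\<bar>) * ennreal 64 = ennreal (64 / \<bar>c\<bar>)"
      by (subst ennreal_mult[symmetric]) auto
    ultimately show ?thesis by (simp only: mult.assoc[symmetric] mult_1)
  qed
  have hint: "(\<integral>\<^sup>+x. h x \<partial>lborel) = ennreal (128 / \<kappa>)"
    unfolding h_def using \<kappa>0 aff[of \<kappa> b] aff[of "- \<kappa>" "- b"]
    by (subst nn_integral_add) (auto simp flip: ennreal_plus)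
  have AE: "AE x in lborel. inverse (ennreal (sqrt \<bar>\<kappa> * x + b\<bar>)) \<le> ennreal (1/32) + h x"
  proof -
    have "AE x in lborel. x \<noteq> - b / \<kappa>" by (rule AE_lborel_singleton)
    then show ?thesis
    proof eventually_elim
      case (elim x)
      define u where "u = \<kappa> * x + b"
      have u: "u \<noteq> 0" using elim \<kappa>0 by (auto simp: u_def field_simps)
      have inv: "inverse (ennreal (sqrt \<bar>u\<bar>)) = ennreal (inverse (sqrt \<bar>u\<bar>))"
        using u by (intro inverse_ennreal) simp
      have powr: "w powr (-1/2) = inverse (sqrt w)" if "w > 0" for w :: real
        using that by (simp add: powr_minus powr_half_sqrt)
      show ?case
      proof (cases "\<bar>u\<bar> \<le> 1024")
        case True
        have "ennreal (inverse (sqrt \<bar>u\<bar>)) \<le> h x"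
        proof (cases "u > 0")
          case True
          then have "g (b + \<kappa> * x) = ennreal (inverse (sqrt \<bar>u\<bar>))"
            using \<open>\<bar>u\<bar> \<le> 1024\<close> powr[of u] by (simp add: g_def u_def add.commute)
          then show ?thesis unfolding h_def by simp
        next
          case False
          then have "g (- b + - \<kappa> * x) = ennreal (inverse (sqrt \<bar>u\<bar>))"
            using \<open>\<bar>u\<bar> \<le> 1024\<close> powr[of "- u"] u by (simp add: g_def u_def add.commute)
          then show ?thesis unfolding h_def by simp
        qed
        then show ?thesis unfolding u_def[symmetric] inv by (simp add: add_increasing)
      next
        case False
        have "32 \<le> sqrt \<bar>u\<bar>" by (rule real_le_rsqrt) (use False in simp)
        then have "inverse (sqrt \<bar>u\<bar>) \<le> 1/32" using le_imp_inverse_le[of 32 "sqrt \<bar>u\<bar>"] by simp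
        then have "ennreal (inverse (sqrt \<bar>u\<bar>)) \<le> ennreal (1/32)" by (rule ennreal_leI)
        then show ?thesis unfolding u_def[symmetric] inv by (simp add: add_increasing2)
      qed
    qed
  qed
  have "AE x in \<mu>. inverse (ennreal (sqrt \<bar>\<kappa> * x + b\<bar>)) \<le> ennreal (1/32) + h x"
    unfolding \<mu>(1) using AE \<mu>(2) by (subst AE_density) auto
  then have "(\<integral>\<^sup>+x. inverse (ennreal (sqrt \<bar>\<kappa> * x + b\<bar>)) \<partial>\<mu>) \<le> (\<integral>\<^sup>+x. ennreal (1/32) + h x \<partial>\<mu>)"
    by (rule nn_integral_mono_AE)
  also have "\<dots> = ennreal (1/32) + (\<integral>\<^sup>+x. h x \<partial>\<mu>)"
    by (subst nn_integral_add) (auto simp: emeasure_space_1)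
  also have "(\<integral>\<^sup>+x. h x \<partial>\<mu>) = (\<integral>\<^sup>+x. ennreal (f x) * h x \<partial>lborel)"
    unfolding \<mu>(1) using \<mu>(2) by (subst nn_integral_density) auto
  also have "\<dots> \<le> (\<integral>\<^sup>+x. ennreal C * h x \<partial>lborel)"
    by (intro nn_integral_mono mult_right_mono ennreal_leI f) auto
  also have "\<dots> = ennreal C * ennreal (128 / \<kappa>)"
    by (subst nn_integral_cmult) (auto simp: hint)
  also have "\<dots> = ennreal (C * (128 / \<kappa>))" using C \<kappa>0 by (subst ennreal_mult) auto
  also have "\<dots> \<le> ennreal (1/32)" using \<kappa> \<kappa>0 by (intro ennreal_leI) (simp add: field_simps)
  also have "ennreal (1/32) + ennreal (1/32) = ennreal (1/16)" by (subst ennreal_plus[symmetric]) auto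
  finally show ?thesis by (simp add: add_left_mono)
qed

section \<open>Expectation bounds\<close>

text \<open>An explicit bound, in contrast to \<open>has_bounded_density\<close>, so that the laws
  of all potentials can share one C.\<close>

definition density_bounded_by :: "real \<Rightarrow> real measure \<Rightarrow> bool" where
  "density_bounded_by C \<mu> \<longleftrightarrow>
     (\<exists>f. f \<in> borel_measurable lborel \<and> (\<forall>x. 0 \<le> f x \<and> f x \<le> C) \<and> \<mu> = density lborel (\<lambda>x. ennreal (f x)))"

lemma ennreal_inverse_antimono: "a \<le> b \<Longrightarrow> inverse b \<le> inverse a" for a b :: ennreal
  including ennreal.lifting by transfer (rule ereal_inverse_antimono)

locale strongly_disordered_tree =
  fixes \<nu>0 \<nu> :: "real measure" and \<sigma> :: "(real \<times> real) measure" and K C \<kappa> :: real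
  assumes prob: "prob_space \<nu>0" "prob_space \<nu>" "prob_space \<sigma>"
    and dens: "density_bounded_by C \<nu>0" "density_bounded_by C \<nu>"
      "density_bounded_by C (distr \<sigma> borel fst)" "density_bounded_by C (distr \<sigma> borel snd)"
    and supp: "emeasure \<nu>0 (- {-K..K}) = 0" "emeasure \<nu> (- {-K..K}) = 0"
      "emeasure \<sigma> (- ({-1..1} \<times> {-1..1})) = 0"
    and sets_\<sigma>: "sets \<sigma> = sets borel"
    and C: "C > 0" and K: "K > 0" and \<kappa>: "\<kappa> \<ge> 4096 * C"
begin

abbreviation law :: "nat \<Rightarrow> real measure" where
  "law n \<equiv> (if n = 0 then \<nu>0 else \<nu>)"

abbreviation "P \<equiv> PiM UNIV law"
abbreviation "Q \<equiv> PiM UNIV (\<lambda>_::nat. \<sigma>)"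
abbreviation "T \<equiv> tree_model \<nu>0 \<nu> \<sigma>"
abbreviation "vpot \<equiv> level_potential \<kappa>"

lemma T_eq: "T = P \<Otimes>\<^sub>M Q"
  by (simp add: tree_model_def)

lemma prob_law: "prob_space (law n)"
  using prob by simp

sublocale P: prob_space P by (rule prob_space_PiM[OF prob_law])
sublocale Q: prob_space Q by (rule prob_space_PiM[OF prob(3)])
sublocale PQ: pair_prob_space P Q ..
sublocale T: prob_space T unfolding T_eq by unfold_locales

lemma sets_law: "sets (law n) = sets borel"
  using dens by (auto simp: density_bounded_by_def)

lemma sets_\<sigma>_prod: "sets \<sigma> = sets (borel \<Otimes>\<^sub>M borel)"
  unfolding borel_prod by (rule sets_\<sigma>)

lemma borel_measurable_law: "h \<in> borel_measurable borel \<Longrightarrow> h \<in> borel_measurable (law i)"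
  using measurable_cong_sets[OF sets_law refl] by blast

lemma \<kappa>_pos: "\<kappa> > 0"
  using C \<kappa> by (meson less_le_trans mult_pos_pos zero_less_numeral)

lemma measurable_fst_coordinate [measurable]: "(\<lambda>\<omega>. fst \<omega> j) \<in> borel_measurable T"
proof -
  have "(\<lambda>q. q j) \<in> P \<rightarrow>\<^sub>M law j" by (rule measurable_component_singleton) simp
  then have "(\<lambda>q. q j) \<in> borel_measurable P" by (simp add: measurable_cong_sets[OF refl sets_law] del: if_split)
  then show ?thesis unfolding T_eq by (rule measurable_compose[OF measurable_fst])
qed

lemma measurable_snd_coordinate: "(\<lambda>\<omega>. snd \<omega> j) \<in> T \<rightarrow>\<^sub>M (borel :: (real \<times> real) measure)"
proof -
  have "(\<lambda>q. q j) \<in> Q \<rightarrow>\<^sub>M \<sigma>" by (rule measurable_component_singleton) simp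
  then have "(\<lambda>q. q j) \<in> Q \<rightarrow>\<^sub>M (borel :: (real \<times> real) measure)" by (simp add: measurable_cong_sets[OF refl sets_\<sigma>])
  then show ?thesis unfolding T_eq by (rule measurable_compose[OF measurable_snd])
qed

lemma measurable_snd_fst [measurable]: "(\<lambda>\<omega>. fst (snd \<omega> j)) \<in> borel_measurable T"
  by (rule measurable_compose[OF measurable_snd_coordinate]) (simp add: borel_prod[symmetric])

lemma measurable_snd_snd [measurable]: "(\<lambda>\<omega>. snd (snd \<omega> j)) \<in> borel_measurable T"
  by (rule measurable_compose[OF measurable_snd_coordinate]) (simp add: borel_prod[symmetric])

lemma measurable_vpot [measurable]: "(\<lambda>\<omega>. vpot \<omega> j c) \<in> borel_measurable T"
  unfolding level_potential_def by measurable

lemma measurable_vpot_transversal: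
  "(\<lambda>x. vpot (q, p(i := x)) j c) \<in> borel_measurable \<sigma>"
proof -
  note [measurable_cong] = sets_\<sigma>_prod
  have [measurable]: "(\<lambda>x. fst ((p(i := x)) j)) \<in> borel_measurable \<sigma>" "(\<lambda>x. snd ((p(i := x)) j)) \<in> borel_measurable \<sigma>"
    by (cases "j = i"; simp)+
  show ?thesis unfolding level_potential_def fst_conv snd_conv by measurable
qed

lemma measurable_integrand:
  assumes [measurable]: "g \<in> M \<rightarrow>\<^sub>M T" "e \<in> borel_measurable M"
  shows "(\<lambda>x. ennreal (Im (green_diag (shifted (vpot (g x)) (Complex (e x) \<eta>)) L y))) \<in> borel_measurable M"
    and "(\<lambda>x. tail_weight (vpot (g x)) m L (e x)) \<in> borel_measurable M"
    and "(\<lambda>x. level_factor (vpot (g x)) L (e x) j) \<in> borel_measurable M"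
proof -
  have "(\<lambda>x. vpot (g x) j c) \<in> borel_measurable M" for j c
    by (rule measurable_compose[OF assms(1) measurable_vpot])
  note v[measurable] = this
  have "(\<lambda>x. shifted (vpot (g x)) (Complex (e x) \<eta>) j c) \<in> borel_measurable M" for j c
    unfolding shifted_def Complex_eq by measurable
  note [measurable] = measurable_green_diag[OF this]
  show "(\<lambda>x. ennreal (Im (green_diag (shifted (vpot (g x)) (Complex (e x) \<eta>)) L y))) \<in> borel_measurable M"
    by measurable
  show "(\<lambda>x. tail_weight (vpot (g x)) m L (e x)) \<in> borel_measurable M"
    "(\<lambda>x. level_factor (vpot (g x)) L (e x) j) \<in> borel_measurable M"
    by (intro measurable_tail_weight v assms)+
qed

lemma measurable_integrand_fixed_energy [measurable]:
  "(\<lambda>\<omega>. ennreal (Im (green_diag (shifted (vpot \<omega>) (Complex E \<eta>)) L y))) \<in> borel_measurable T"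
  "(\<lambda>\<omega>. tail_weight (vpot \<omega>) m L E) \<in> borel_measurable T"
  "(\<lambda>\<omega>. level_factor (vpot \<omega>) L E j) \<in> borel_measurable T"
  by (rule measurable_integrand; simp)+

lemma radial_average:
  assumes f: "f \<in> borel_measurable T" and g: "g \<in> borel_measurable T"
    and le: "\<And>q p. (\<integral>\<^sup>+x. f (q(i := x), p) \<partial>law i) \<le> g (q, p)"
  shows "(\<integral>\<^sup>+\<omega>. f \<omega> \<partial>T) \<le> (\<integral>\<^sup>+\<omega>. g \<omega> \<partial>T)"
proof -
  have f': "f \<in> borel_measurable (P \<Otimes>\<^sub>M Q)" and g': "g \<in> borel_measurable (P \<Otimes>\<^sub>M Q)"
    using f g by (simp_all add: T_eq)
  have "(\<integral>\<^sup>+\<omega>. f \<omega> \<partial>T) = (\<integral>\<^sup>+p. \<integral>\<^sup>+q. f (q, p) \<partial>P \<partial>Q)"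
    unfolding T_eq by (rule PQ.nn_integral_snd[OF f', symmetric])
  also have "\<dots> \<le> (\<integral>\<^sup>+p. \<integral>\<^sup>+q. g (q, p) \<partial>P \<partial>Q)"
  proof (rule nn_integral_mono)
    fix p assume p: "p \<in> space Q"
    have "(\<integral>\<^sup>+q. f (q, p) \<partial>P) = (\<integral>\<^sup>+q. \<integral>\<^sup>+x. f (q(i := x), p) \<partial>law i \<partial>P)"
      by (rule nn_integral_PiM_resample[OF prob_law]) (rule measurable_compose[OF measurable_Pair2'[OF p] f'])
    also have "\<dots> \<le> (\<integral>\<^sup>+q. g (q, p) \<partial>P)" by (rule nn_integral_mono) (rule le)
    finally show "(\<integral>\<^sup>+q. f (q, p) \<partial>P) \<le> (\<integral>\<^sup>+q. g (q, p) \<partial>P)" .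
  qed
  also have "\<dots> = (\<integral>\<^sup>+\<omega>. g \<omega> \<partial>T)" unfolding T_eq by (rule PQ.nn_integral_snd[OF g'])
  finally show ?thesis .
qed

lemma transversal_average:
  assumes f: "f \<in> borel_measurable T" and g: "g \<in> borel_measurable T"
    and le: "\<And>q p. (\<integral>\<^sup>+x. f (q, p(i := x)) \<partial>\<sigma>) \<le> g (q, p)"
  shows "(\<integral>\<^sup>+\<omega>. f \<omega> \<partial>T) \<le> (\<integral>\<^sup>+\<omega>. g \<omega> \<partial>T)"
proof -
  have f': "f \<in> borel_measurable (P \<Otimes>\<^sub>M Q)" and g': "g \<in> borel_measurable (P \<Otimes>\<^sub>M Q)"
    using f g by (simp_all add: T_eq)
  have "(\<integral>\<^sup>+\<omega>. f \<omega> \<partial>T) = (\<integral>\<^sup>+q. \<integral>\<^sup>+p. f (q, p) \<partial>Q \<partial>P)"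
    unfolding T_eq by (rule Q.nn_integral_fst[OF f', symmetric])
  also have "\<dots> \<le> (\<integral>\<^sup>+q. \<integral>\<^sup>+p. g (q, p) \<partial>Q \<partial>P)"
  proof (rule nn_integral_mono)
    fix q assume q: "q \<in> space P"
    have "(\<integral>\<^sup>+p. f (q, p) \<partial>Q) = (\<integral>\<^sup>+p. \<integral>\<^sup>+x. f (q, p(i := x)) \<partial>\<sigma> \<partial>Q)"
      by (rule nn_integral_PiM_resample[OF prob(3)]) (rule measurable_compose[OF measurable_Pair1'[OF q] f'])
    also have "\<dots> \<le> (\<integral>\<^sup>+p. g (q, p) \<partial>Q)" by (rule nn_integral_mono) (rule le)
    finally show "(\<integral>\<^sup>+p. f (q, p) \<partial>Q) \<le> (\<integral>\<^sup>+p. g (q, p) \<partial>Q)" .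
  qed
  also have "\<dots> = (\<integral>\<^sup>+\<omega>. g \<omega> \<partial>T)" unfolding T_eq by (rule Q.nn_integral_fst[OF g'])
  finally show ?thesis .
qed

text \<open>Reduces an average over one radial variable to Lebesgue measure on the support, the form
  in which the contour estimate is available.\<close>

lemma law_integral_le:
  assumes h: "h \<in> borel_measurable borel"
  shows "(\<integral>\<^sup>+x. h x \<partial>law i) \<le> ennreal C * (\<integral>\<^sup>+x. h x * indicator {-K..K} x \<partial>lborel)"
proof -
  have "density_bounded_by C (law i)" using dens by simp
  then obtain f where f: "f \<in> borel_measurable lborel" "\<And>x. 0 \<le> f x \<and> f x \<le> C"
    "law i = density lborel (\<lambda>x. ennreal (f x))" unfolding density_bounded_by_def by blast
  have e: "emeasure (law i) (- {-K..K}) = 0" using supp by simp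
  have "AE x in law i. x \<in> {-K..K}"
    by (rule AE_I[OF _ e]) (auto simp: sets_law simp del: if_split)
  then have "(\<integral>\<^sup>+x. h x \<partial>law i) = (\<integral>\<^sup>+x. h x * indicator {-K..K} x \<partial>law i)"
  proof (intro nn_integral_cong_AE)
    assume "AE x in law i. x \<in> {-K..K}"
    then show "AE x in law i. h x = h x * indicator {-K..K} x" by eventually_elim simp
  qed
  also have "\<dots> = (\<integral>\<^sup>+x. ennreal (f x) * (h x * indicator {-K..K} x) \<partial>lborel)"
    unfolding f(3) using f(1) h by (subst nn_integral_density) auto
  also have "\<dots> \<le> (\<integral>\<^sup>+x. ennreal C * (h x * indicator {-K..K} x) \<partial>lborel)"
    using f(2) by (intro nn_integral_mono mult_right_mono ennreal_leI) auto
  also have "\<dots> = ennreal C * (\<integral>\<^sup>+x. h x * indicator {-K..K} x \<partial>lborel)"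
    using h by (intro nn_integral_cmult) auto
  finally show ?thesis .
qed

text \<open>Resampling \<open>p j\<close> leaves the self-energy at level j unchanged, so each
  denominator is affine in one component of \<open>p j\<close> with slope \<kappa>. The two labels
  are added rather than multiplied, so only the marginals of \<sigma> enter and dependence between
  the components does no harm.\<close>

lemma level_factor_average:
  assumes j: "j \<noteq> 0"
  shows "(\<integral>\<^sup>+x. level_factor (vpot (q, p(j := x))) L E j \<partial>\<sigma>) \<le> ennreal (1/4)"
proof -
  interpret \<sigma>: prob_space \<sigma> by (rule prob(3))
  note [measurable_cong] = sets_\<sigma>_prod
  \<comment> \<open>The denominator is complex by type; its real part is a real affine function of
    one component, and its modulus can only be larger.\<close>
  define b where "b = q j - E - Re (self_energy (shifted (vpot (q, p)) (of_real E)) j (L - j))"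
  have den: "denom (shifted (vpot (q, p(j := x))) (of_real E)) L j c
      = of_real (q j + \<kappa> * (if c then snd x else fst x) - E) - self_energy (shifted (vpot (q, p)) (of_real E)) j (L - j)" for x c
  proof -
    have "self_energy (shifted (vpot (q, p(j := x))) (of_real E)) j (L - j)
        = self_energy (shifted (vpot (q, p)) (of_real E)) j (L - j)"
      by (rule self_energy_cong) (auto simp: shifted_def level_potential_def)
    then show ?thesis using j by (simp add: denom_def shifted_def level_potential_def)
  qed
  have cm: "\<bar>\<kappa> * (if c then snd x else fst x) + b\<bar> \<le> cmod (denom (shifted (vpot (q, p(j := x))) (of_real E)) L j c)" for x c
    using abs_Re_le_cmod[of "denom (shifted (vpot (q, p(j := x))) (of_real E)) L j c"]
    unfolding den b_def by (simp add: algebra_simps)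
  have le: "inverse (ennreal (sqrt (cmod (denom (shifted (vpot (q, p(j := x))) (of_real E)) L j c))))
      \<le> inverse (ennreal (sqrt \<bar>\<kappa> * (if c then snd x else fst x) + b\<bar>))" for x c
    using cm[of c x] by (intro ennreal_inverse_antimono ennreal_leI real_sqrt_le_mono)
  have fst: "(\<integral>\<^sup>+x. inverse (ennreal (sqrt \<bar>\<kappa> * fst x + b\<bar>)) \<partial>\<sigma>) \<le> ennreal (1/16)"
  proof -
    obtain f where f: "f \<in> borel_measurable lborel" "\<And>x. 0 \<le> f x \<and> f x \<le> C"
      "distr \<sigma> borel fst = density lborel (\<lambda>x. ennreal (f x))" using dens(3) unfolding density_bounded_by_def by blast
    have "(\<integral>\<^sup>+x. inverse (ennreal (sqrt \<bar>\<kappa> * fst x + b\<bar>)) \<partial>\<sigma>)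
        = (\<integral>\<^sup>+x. inverse (ennreal (sqrt \<bar>\<kappa> * x + b\<bar>)) \<partial>distr \<sigma> borel fst)"
      by (subst nn_integral_distr) auto
    also have "\<dots> \<le> ennreal (1/16)"
      by (rule fractional_moment_bound[OF f(3,1) _ C _ \<kappa>]) (use f(2) in \<open>auto intro!: \<sigma>.prob_space_distr\<close>)
    finally show ?thesis .
  qed
  have snd: "(\<integral>\<^sup>+x. inverse (ennreal (sqrt \<bar>\<kappa> * snd x + b\<bar>)) \<partial>\<sigma>) \<le> ennreal (1/16)"
  proof -
    obtain f where f: "f \<in> borel_measurable lborel" "\<And>x. 0 \<le> f x \<and> f x \<le> C"
      "distr \<sigma> borel snd = density lborel (\<lambda>x. ennreal (f x))" using dens(4) unfolding density_bounded_by_def by blast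
    have "(\<integral>\<^sup>+x. inverse (ennreal (sqrt \<bar>\<kappa> * snd x + b\<bar>)) \<partial>\<sigma>)
        = (\<integral>\<^sup>+x. inverse (ennreal (sqrt \<bar>\<kappa> * x + b\<bar>)) \<partial>distr \<sigma> borel snd)"
      by (subst nn_integral_distr) auto
    also have "\<dots> \<le> ennreal (1/16)"
      by (rule fractional_moment_bound[OF f(3,1) _ C _ \<kappa>]) (use f(2) in \<open>auto intro!: \<sigma>.prob_space_distr\<close>)
    finally show ?thesis .
  qed
  have "(\<integral>\<^sup>+x. level_factor (vpot (q, p(j := x))) L E j \<partial>\<sigma>)
      \<le> (\<integral>\<^sup>+x. ennreal (1/8) + (inverse (ennreal (sqrt \<bar>\<kappa> * fst x + b\<bar>)) + inverse (ennreal (sqrt \<bar>\<kappa> * snd x + b\<bar>))) \<partial>\<sigma>)"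
    unfolding level_factor_def
    by (intro nn_integral_mono add_mono order_refl) (use le[of _ False] le[of _ True] in auto)
  also have "\<dots> = ennreal (1/8) + ((\<integral>\<^sup>+x. inverse (ennreal (sqrt \<bar>\<kappa> * fst x + b\<bar>)) \<partial>\<sigma>)
      + (\<integral>\<^sup>+x. inverse (ennreal (sqrt \<bar>\<kappa> * snd x + b\<bar>)) \<partial>\<sigma>))"
    by (subst nn_integral_add; (subst nn_integral_add)?) (auto simp: \<sigma>.emeasure_space_1)
  also have "\<dots> \<le> ennreal (1/8) + (ennreal (1/16) + ennreal (1/16))"
    by (intro add_mono fst snd order_refl)
  also have "\<dots> = ennreal (1/4)" by (simp flip: ennreal_plus)
  finally show ?thesis .
qed

text \<open>The level nearest the root is averaged first: the deeper factors do not depend on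
  \<open>p (Suc m)\<close>, whereas the first factor depends on the deeper levels. The inner bound
  1/4 holds for every environment, so nothing is lost.\<close>

lemma level_factor_prod_expectation:
  "(\<integral>\<^sup>+\<omega>. (\<Prod>j\<in>{m<..m + n}. level_factor (vpot \<omega>) L E j) \<partial>T) \<le> ennreal (1/4) ^ n"
proof (induction n arbitrary: m)
  case (Suc n)
  let ?r = "\<lambda>\<omega>. \<Prod>j\<in>{Suc m<..Suc m + n}. level_factor (vpot \<omega>) L E j"
  have eq: "{m<..m + Suc n} = insert (Suc m) {Suc m<..Suc m + n}" by auto
  have "(\<integral>\<^sup>+\<omega>. (\<Prod>j\<in>{m<..m + Suc n}. level_factor (vpot \<omega>) L E j) \<partial>T)
      = (\<integral>\<^sup>+\<omega>. level_factor (vpot \<omega>) L E (Suc m) * ?r \<omega> \<partial>T)"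
    unfolding eq by simp
  also have "\<dots> \<le> (\<integral>\<^sup>+\<omega>. ennreal (1/4) * ?r \<omega> \<partial>T)"
  proof (rule transversal_average[where i = "Suc m"])
    fix q :: "nat \<Rightarrow> real" and p :: "nat \<Rightarrow> real \<times> real"
    have r: "?r (q, p(Suc m := x)) = ?r (q, p)" for x
      by (intro prod.cong refl level_factor_cong) (auto simp: level_potential_def)
    have "(\<integral>\<^sup>+x. level_factor (vpot (q, p(Suc m := x))) L E (Suc m) * ?r (q, p(Suc m := x)) \<partial>\<sigma>)
        = (\<integral>\<^sup>+x. level_factor (vpot (q, p(Suc m := x))) L E (Suc m) \<partial>\<sigma>) * ?r (q, p)"
      unfolding r by (intro nn_integral_multc measurable_tail_weight(2) measurable_vpot_transversal) simp
    also have "\<dots> \<le> ennreal (1/4) * ?r (q, p)"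
      by (intro mult_right_mono level_factor_average) auto
    finally show "(\<integral>\<^sup>+x. level_factor (vpot (q, p(Suc m := x))) L E (Suc m) * ?r (q, p(Suc m := x)) \<partial>\<sigma>)
        \<le> ennreal (1/4) * ?r (q, p)" .
  qed measurable
  also have "\<dots> = ennreal (1/4) * (\<integral>\<^sup>+\<omega>. ?r \<omega> \<partial>T)" by (rule nn_integral_cmult) measurable
  also have "\<dots> \<le> ennreal (1/4) * ennreal (1/4) ^ n" by (intro mult_left_mono Suc.IH) simp
  finally show ?case by simp
qed (simp add: T.emeasure_space_1)

lemma tail_weight_expectation: "(\<integral>\<^sup>+\<omega>. tail_weight (vpot \<omega>) m L E \<partial>T) \<le> 2"
proof -
  have "(\<integral>\<^sup>+\<omega>. tail_weight (vpot \<omega>) m L E \<partial>T)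
      = (\<Sum>n\<le>L - m. 2 ^ n * (\<integral>\<^sup>+\<omega>. (\<Prod>j\<in>{m<..m + n}. level_factor (vpot \<omega>) L E j) \<partial>T))"
    unfolding tail_weight_def by (subst nn_integral_sum) (auto intro!: sum.cong nn_integral_cmult)
  also have "\<dots> \<le> (\<Sum>n\<le>L - m. 2 ^ n * ennreal (1/4) ^ n)"
    by (intro sum_mono mult_left_mono level_factor_prod_expectation) simp
  also have "\<dots> = (\<Sum>n\<le>L - m. ennreal ((1/2) ^ n))"
  proof (rule sum.cong[OF refl])
    fix n
    have "(2::ennreal) ^ n * ennreal (1/4) ^ n = ennreal 2 ^ n * ennreal (1/4) ^ n" by simp
    also have "\<dots> = ennreal (2 ^ n * (1/4) ^ n)" by (subst (1 2) ennreal_power) (auto simp: ennreal_mult)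
    also have "2 ^ n * (1/4) ^ n = ((1/2) ^ n :: real)" by (simp flip: power_mult_distrib)
    finally show "(2::ennreal) ^ n * ennreal (1/4) ^ n = ennreal ((1/2) ^ n)" .
  qed
  also have "\<dots> = ennreal (\<Sum>n\<le>L - m. (1/2) ^ n)" by (rule sum_ennreal) simp
  also have "\<dots> \<le> ennreal 2"
  proof (rule ennreal_leI)
    have "(\<Sum>n\<le>N. (1/2) ^ n) \<le> (2::real) - (1/2) ^ N" for N by (induction N) auto
    from this[of "L - m"] show "(\<Sum>n\<le>L - m. (1/2) ^ n) \<le> (2::real)"
      by (rule order_trans) simp
  qed
  finally show ?thesis by simp
qed

text \<open>The weight is constant in \<open>q m\<close>, so the average over \<open>q m\<close>
  falls on the resolvent entry alone and gives 22 C; the mean of the remaining weight contributes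
  the factor 2.\<close>

lemma green_tail_expectation:
  assumes y: "length y \<le> L" and \<eta>: "\<eta> > 0"
  shows "(\<integral>\<^sup>+\<omega>. ennreal (Im (green_diag (shifted (vpot \<omega>) (Complex E \<eta>)) L y)) *
      tail_weight (vpot \<omega>) (length y) L E \<partial>T) \<le> ennreal (44 * C)"
proof -
  let ?m = "length y"
  have "(\<integral>\<^sup>+\<omega>. ennreal (Im (green_diag (shifted (vpot \<omega>) (Complex E \<eta>)) L y)) * tail_weight (vpot \<omega>) ?m L E \<partial>T)
      \<le> (\<integral>\<^sup>+\<omega>. ennreal (22 * C) * tail_weight (vpot \<omega>) ?m L E \<partial>T)"
  proof (rule radial_average[where i = ?m])
    fix q :: "nat \<Rightarrow> real" and p :: "nat \<Rightarrow> real \<times> real"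
    have t: "tail_weight (vpot (q(?m := x), p)) ?m L E = tail_weight (vpot (q, p)) ?m L E" for x
      by (rule tail_weight_cong) (auto simp: level_potential_def)
    \<comment> \<open>Resetting \<open>q m\<close> to 0 exhibits the integration variable as a pure
      shift of the level of y.\<close>
    define u where "u = vpot (q(?m := 0), p)"
    have v: "vpot (q(?m := x), p) = (\<lambda>j c. u j c + (if j = ?m then x else 0))" for x
      by (auto simp: fun_eq_iff u_def level_potential_def)
    define h where "h x = ennreal (Im (green_diag (shifted (\<lambda>j c. u j c + (if j = ?m then x else 0)) (Complex E \<eta>)) L y))" for x
    have "(\<lambda>x. shifted (\<lambda>j c. u j c + (if j = ?m then x else 0)) (Complex E \<eta>) j c) \<in> borel_measurable borel" for j c
      unfolding shifted_def by measurable
    note [measurable] = measurable_green_diag[OF this]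
    have h[measurable]: "h \<in> borel_measurable borel" unfolding h_def by measurable
    have "(\<integral>\<^sup>+x. ennreal (Im (green_diag (shifted (vpot (q(?m := x), p)) (Complex E \<eta>)) L y)) *
        tail_weight (vpot (q(?m := x), p)) ?m L E \<partial>law ?m) = (\<integral>\<^sup>+x. h x * tail_weight (vpot (q, p)) ?m L E \<partial>law ?m)"
      unfolding t by (simp add: v h_def)
    also have "\<dots> = (\<integral>\<^sup>+x. h x \<partial>law ?m) * tail_weight (vpot (q, p)) ?m L E"
      by (rule nn_integral_multc[OF borel_measurable_law[OF h]])
    also have "\<dots> \<le> ennreal (22 * C) * tail_weight (vpot (q, p)) ?m L E"
    proof (rule mult_right_mono)
      have "(\<integral>\<^sup>+x. h x \<partial>law ?m) \<le> ennreal C * (\<integral>\<^sup>+x. h x * indicator {-K..K} x \<partial>lborel)"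
        by (rule law_integral_le[OF h])
      also have "\<dots> \<le> ennreal C * 22"
        unfolding h_def by (intro mult_left_mono green_diag_level_average y \<eta> K) simp
      also have "\<dots> = ennreal (22 * C)" using C by (simp add: ennreal_mult' mult.commute)
      finally show "(\<integral>\<^sup>+x. h x \<partial>law ?m) \<le> ennreal (22 * C)" .
    qed simp
    finally show "(\<integral>\<^sup>+x. ennreal (Im (green_diag (shifted (vpot (q(?m := x), p)) (Complex E \<eta>)) L y)) *
        tail_weight (vpot (q(?m := x), p)) ?m L E \<partial>law ?m) \<le> ennreal (22 * C) * tail_weight (vpot (q, p)) ?m L E" .
  qed measurable
  also have "\<dots> = ennreal (22 * C) * (\<integral>\<^sup>+\<omega>. tail_weight (vpot \<omega>) ?m L E \<partial>T)"
    by (rule nn_integral_cmult) measurable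
  also have "\<dots> \<le> ennreal (22 * C) * 2" by (intro mult_left_mono tail_weight_expectation) simp
  also have "\<dots> = ennreal (22 * C * 2)" using C by (subst ennreal_mult) auto
  also have "22 * C * 2 = 44 * C" by simp
  finally show ?thesis .
qed

text \<open>The right-hand side of \<open>delocalized_mass_bound\<close> for B = K + \<kappa>, the
  almost sure bound on the potential.\<close>

definition localization_bound :: "(nat \<Rightarrow> real) \<times> (nat \<Rightarrow> real \<times> real) \<Rightarrow> vertex \<Rightarrow> nat \<Rightarrow> ennreal" where
  "localization_bound \<omega> y L = liminf (\<lambda>k. \<integral>\<^sup>+E. ennreal (Im (green_diag (shifted (vpot \<omega>) (Complex E (1 / Suc k))) L y)) *
     tail_weight (vpot \<omega>) (length y) L E * indicator {-(K + \<kappa> + 4)..K + \<kappa> + 4} E \<partial>lborel)"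

text \<open>Tonelli exchanges energy and disorder, and each energy in the window costs at most 44 C.
  Fatou is applied twice, for the shrinking widths and for the growing boxes. The shift by
  \<open>length y\<close> keeps y inside the box.\<close>

lemma AE_localization_bound:
  "AE \<omega> in T. liminf (\<lambda>L. localization_bound \<omega> y (L + length y)) \<noteq> \<infinity>"
proof (rule nn_integral_PInf_AE)
  let ?I = "{-(K + \<kappa> + 4)..K + \<kappa> + 4}"
  let ?f = "\<lambda>L k \<omega> E. ennreal (Im (green_diag (shifted (vpot \<omega>) (Complex E (1 / Suc k))) L y)) *
     tail_weight (vpot \<omega>) (length y) L E * indicator ?I E"
  have [measurable]: "(\<lambda>x. ?f L k (fst x) (snd x)) \<in> borel_measurable (T \<Otimes>\<^sub>M lborel)" for L k
  proof -
    have "(\<lambda>x. snd x) \<in> borel_measurable (T \<Otimes>\<^sub>M lborel)" by measurable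
    note [measurable] = measurable_integrand[OF measurable_fst this]
    show ?thesis by measurable
  qed
  then have m: "(\<lambda>(\<omega>, E). ?f L k \<omega> E) \<in> borel_measurable (T \<Otimes>\<^sub>M lborel)" for L k
    by (simp add: case_prod_beta')
  have mk[measurable]: "(\<lambda>\<omega>. \<integral>\<^sup>+E. ?f L k \<omega> E \<partial>lborel) \<in> borel_measurable T" for L k
    using lborel.borel_measurable_nn_integral[OF m] by simp
  have ml[measurable]: "(\<lambda>\<omega>. localization_bound \<omega> y L) \<in> borel_measurable T" for L
    unfolding localization_bound_def by measurable
  show "(\<lambda>\<omega>. liminf (\<lambda>L. localization_bound \<omega> y (L + length y))) \<in> borel_measurable T" by measurable
  let ?c = "ennreal (44 * C) * ennreal (2 * (K + \<kappa> + 4))"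
  have 1: "(\<integral>\<^sup>+\<omega>. \<integral>\<^sup>+E. ?f L k \<omega> E \<partial>lborel \<partial>T) \<le> ?c" if L: "length y \<le> L" for L k
  proof -
    interpret pair_sigma_finite T lborel ..
    have "(\<integral>\<^sup>+\<omega>. \<integral>\<^sup>+E. ?f L k \<omega> E \<partial>lborel \<partial>T) = (\<integral>\<^sup>+E. \<integral>\<^sup>+\<omega>. ?f L k \<omega> E \<partial>T \<partial>lborel)"
      by (rule Fubini'[OF m, symmetric])
    also have "\<dots> \<le> (\<integral>\<^sup>+E. ennreal (44 * C) * indicator ?I E \<partial>lborel)"
    proof (rule nn_integral_mono)
      fix E :: real
          have "(\<integral>\<^sup>+\<omega>. ?f L k \<omega> E \<partial>T) = (\<integral>\<^sup>+\<omega>. ennreal (Im (green_diag (shifted (vpot \<omega>) (Complex E (1 / Suc k))) L y)) *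
          tail_weight (vpot \<omega>) (length y) L E \<partial>T) * indicator ?I E"
        by (rule nn_integral_multc) measurable
      also have "\<dots> \<le> ennreal (44 * C) * indicator ?I E"
        by (intro mult_right_mono green_tail_expectation L) auto
      finally show "(\<integral>\<^sup>+\<omega>. ?f L k \<omega> E \<partial>T) \<le> ennreal (44 * C) * indicator ?I E" .
    qed
    also have "\<dots> = ennreal (44 * C) * emeasure lborel ?I" by (rule nn_integral_cmult_indicator) simp
    also have "emeasure lborel ?I = ennreal (2 * (K + \<kappa> + 4))"
      using K \<kappa>_pos by (subst emeasure_lborel_Icc) (auto intro!: arg_cong[where f = ennreal])
    finally show ?thesis .
  qed
  have 2: "(\<integral>\<^sup>+\<omega>. localization_bound \<omega> y L \<partial>T) \<le> ?c" if "length y \<le> L" for L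
  proof -
    have "(\<integral>\<^sup>+\<omega>. localization_bound \<omega> y L \<partial>T) \<le> liminf (\<lambda>k. \<integral>\<^sup>+\<omega>. \<integral>\<^sup>+E. ?f L k \<omega> E \<partial>lborel \<partial>T)"
      unfolding localization_bound_def by (rule nn_integral_liminf) (rule mk)
    also have "\<dots> \<le> liminf (\<lambda>k::nat. ?c)" by (intro Liminf_mono always_eventually allI 1 that)
    also have "\<dots> = ?c" by (rule Liminf_const) simp
    finally show ?thesis .
  qed
  have "(\<integral>\<^sup>+\<omega>. liminf (\<lambda>L. localization_bound \<omega> y (L + length y)) \<partial>T)
      \<le> liminf (\<lambda>L. \<integral>\<^sup>+\<omega>. localization_bound \<omega> y (L + length y) \<partial>T)"
    by (rule nn_integral_liminf) (rule ml)
  also have "\<dots> \<le> liminf (\<lambda>L::nat. ?c)" by (intro Liminf_mono always_eventually allI 2) simp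
  also have "\<dots> = ?c" by (rule Liminf_const) simp
  also have "\<dots> < \<infinity>" by (simp add: ennreal_mult_less_top)
  finally show "(\<integral>\<^sup>+\<omega>. liminf (\<lambda>L. localization_bound \<omega> y (L + length y)) \<partial>T) \<noteq> \<infinity>" by simp
qed

lemma AE_potential_bounded: "AE \<omega> in T. \<forall>x. \<bar>on_tree (vpot \<omega>) x\<bar> \<le> K + \<kappa>"
proof -
  have 1: "AE \<omega> in T. \<bar>fst \<omega> j\<bar> \<le> K" for j
  proof -
    have e: "emeasure (law j) (- {-K..K}) = 0" using supp by simp
    have "AE x in law j. \<bar>x\<bar> \<le> K"
      by (rule AE_I[OF _ e]) (auto simp: sets_law abs_le_iff simp del: if_split)
    then have "AE q in P. \<bar>q j\<bar> \<le> K" by (intro AE_PiM_component prob_law) auto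
    then have "AE q in P. AE p in Q. \<bar>fst (q, p) j\<bar> \<le> K" by eventually_elim simp
    moreover have "{\<omega> \<in> space T. \<bar>fst \<omega> j\<bar> \<le> K} \<in> sets T" by measurable
    ultimately show ?thesis unfolding T_eq by (intro PQ.AE_pair_measure)
  qed
  have 2: "AE \<omega> in T. \<bar>fst (snd \<omega> j)\<bar> \<le> 1 \<and> \<bar>snd (snd \<omega> j)\<bar> \<le> 1" for j
  proof -
    have "- ({-1..1} \<times> {-1..1}) \<in> sets (borel :: (real \<times> real) measure)"
      by (intro borel_comp closed_Times closed_atLeastAtMost borel_closed)
    then have "AE x in \<sigma>. \<bar>fst x\<bar> \<le> 1 \<and> \<bar>snd x\<bar> \<le> 1"
      by (intro AE_I[OF _ supp(3)]) (auto simp: sets_\<sigma> abs_le_iff)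
    then have "AE p in Q. \<bar>fst (p j)\<bar> \<le> 1 \<and> \<bar>snd (p j)\<bar> \<le> 1"
      by (intro AE_PiM_component[where P = "\<lambda>x. \<bar>fst x\<bar> \<le> 1 \<and> \<bar>snd x\<bar> \<le> 1"] prob(3)) auto
    then have "AE q in P. AE p in Q. \<bar>fst (snd (q, p) j)\<bar> \<le> 1 \<and> \<bar>snd (snd (q, p) j)\<bar> \<le> 1" by simp
    moreover have "{\<omega> \<in> space T. \<bar>fst (snd \<omega> j)\<bar> \<le> 1 \<and> \<bar>snd (snd \<omega> j)\<bar> \<le> 1} \<in> sets T" by measurable
    ultimately show ?thesis unfolding T_eq by (intro PQ.AE_pair_measure)
  qed
  have "AE \<omega> in T. \<forall>j. \<bar>fst \<omega> j\<bar> \<le> K \<and> \<bar>fst (snd \<omega> j)\<bar> \<le> 1 \<and> \<bar>snd (snd \<omega> j)\<bar> \<le> 1"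
    unfolding AE_all_countable using 1 2 by (auto intro: AE_conjI)
  then show ?thesis
  proof eventually_elim
    case (elim \<omega>)
    have t: "\<bar>\<kappa> * s\<bar> \<le> \<kappa>" if "\<bar>s\<bar> \<le> 1" for s
      using mult_left_mono[OF that, of \<kappa>] \<kappa>_pos by (simp add: abs_mult)
    have "\<bar>vpot \<omega> j c\<bar> \<le> K + \<kappa>" for j c
    proof -
      let ?s = "if j = 0 then 0 else if c then snd (snd \<omega> j) else fst (snd \<omega> j)"
      have "\<bar>?s\<bar> \<le> 1" using elim by auto
      then have "\<bar>\<kappa> * ?s\<bar> \<le> \<kappa>" by (rule t)
      moreover have "\<bar>fst \<omega> j\<bar> \<le> K" using elim by simp
      ultimately show ?thesis unfolding level_potential_def by linarith
    qed
    then show ?case by (simp add: on_tree_def)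
  qed
qed

end

section \<open>The infinite-volume limit\<close>

text \<open>Fatou yields a finite liminf rather than a bound for all L, so good boxes are available
  only along a sequence that depends on the sample. Compactness needs no more.\<close>

lemma infinitely_often_below_of_liminf:
  fixes X :: "nat \<Rightarrow> ennreal"
  assumes "liminf X \<noteq> \<infinity>"
  obtains c where "c \<ge> 0" "\<And>n. \<exists>N\<ge>n. X N \<le> ennreal c"
proof -
  obtain r where r: "r \<ge> 0" "liminf X = ennreal r"
    using assms by (cases "liminf X") auto
  have "\<exists>N\<ge>n. X N \<le> ennreal (r + 1)" for n
  proof (rule ccontr)
    assume "\<not> (\<exists>N\<ge>n. X N \<le> ennreal (r + 1))"
    then have "\<forall>\<^sub>F N in sequentially. ennreal (r + 1) \<le> X N"
      by (intro eventually_sequentiallyI[of n]) (metis linear)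
    then have "ennreal (r + 1) \<le> ennreal r" using Liminf_bounded r(2) by metis
    then show False using r(1) by (simp add: ennreal_le_iff)
  qed
  then show ?thesis using that[of "r + 1"] r(1) by simp
qed

section \<open>Compactness of finite-volume eigensystems\<close>

lemma orthogonal_expansion_norm:
  assumes basis: "box_eigenbasis L V p e" and G: "G \<subseteq> {..<card (tree_box L)}"
  shows "(\<Sum>x\<in>tree_box L. (\<Sum>i\<in>G. p i y * p i x)\<^sup>2) = (\<Sum>i\<in>G. (p i y)\<^sup>2)"
proof -
  have fin: "finite G" using G finite_subset by blast
  have "(\<Sum>x\<in>tree_box L. (\<Sum>i\<in>G. p i y * p i x)\<^sup>2)
      = (\<Sum>x\<in>tree_box L. \<Sum>i\<in>G. \<Sum>j\<in>G. (p i y * p j y) * (p i x * p j x))"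
    by (simp add: power2_eq_square sum_product mult_ac)
  also have "\<dots> = (\<Sum>i\<in>G. \<Sum>j\<in>G. \<Sum>x\<in>tree_box L. (p i y * p j y) * (p i x * p j x))"
    by (subst sum.swap, rule sum.cong[OF refl], rule sum.swap)
  also have "\<dots> = (\<Sum>i\<in>G. \<Sum>j\<in>G. if i = j then (p i y)\<^sup>2 else 0)"
  proof (intro sum.cong refl)
    fix i j assume "i \<in> G" "j \<in> G"
    then have "(\<Sum>x\<in>tree_box L. p i x * p j x) = (if i = j then 1 else 0)"
      using G by (intro eigenbasis_orthonormal[OF basis]) auto
    then show "(\<Sum>x\<in>tree_box L. (p i y * p j y) * (p i x * p j x)) = (if i = j then (p i y)\<^sup>2 else 0)"
      by (simp add: sum_distrib_left[symmetric] power2_eq_square)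
  qed
  also have "\<dots> = (\<Sum>i\<in>G. (p i y)\<^sup>2)" using fin by simp
  finally show ?thesis .
qed

text \<open>All conditions are equations at single vertices or bounds on finite sums, hence stable
  under pointwise limits. Mass may escape to infinity in such a limit, so norms are only bounded
  from above.\<close>

definition approximate_eigensystem ::
    "(vertex \<Rightarrow> real) \<Rightarrow> real \<Rightarrow> vertex \<Rightarrow> real \<Rightarrow> nat \<Rightarrow> vertex set \<Rightarrow> (nat \<Rightarrow> vertex \<Rightarrow> real) \<Rightarrow> (nat \<Rightarrow> real) \<Rightarrow> bool" where
  "approximate_eigensystem V R y \<epsilon> N U \<phi> E \<longleftrightarrow>
     (\<forall>i. \<bar>E i\<bar> \<le> R) \<and>
     (\<forall>i A. finite A \<longrightarrow> (\<Sum>x\<in>A. (\<phi> i x)\<^sup>2) \<le> 1) \<and>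
     (\<forall>i. \<forall>x\<in>U. schr V (\<lambda>x. of_real (\<phi> i x)) x = of_real (E i * \<phi> i x)) \<and>
     (\<forall>A. finite A \<longrightarrow> (\<Sum>x\<in>A. ((if x = y then 1 else 0) - (\<Sum>i<N. \<phi> i y * \<phi> i x))\<^sup>2) \<le> \<epsilon>)"

text \<open>The selected eigenvectors are padded by zero functions to exactly N, so that all boxes
  share one index set. The error in expanding the delta at y is carried by the eigenvectors left
  out, and its squared norm is their spectral mass at y.\<close>

lemma finite_volume_eigensystem:
  assumes basis: "box_eigenbasis L V p e" and y: "length y \<le> L"
    and B: "\<And>x. \<bar>V x\<bar> \<le> B" and G: "G \<subseteq> {..<card (tree_box L)}" "card G \<le> N"
    and rest: "(\<Sum>i\<in>{..<card (tree_box L)} - G. (p i y)\<^sup>2) \<le> \<epsilon>"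
  shows "\<exists>\<phi> E. approximate_eigensystem V (B + 3) y \<epsilon> N (tree_box L) \<phi> E"
proof -
  have finG: "finite G" using G finite_subset by blast
  obtain h where h: "bij_betw h {..<card G} G"
    using ex_bij_betw_nat_finite[OF finG] by (auto simp: lessThan_atLeast0)
  have hG: "h i \<in> G" if "i < card G" for i using h that by (auto simp: bij_betw_def)
  have hlt: "h i < card (tree_box L)" if "i < card G" for i using hG[OF that] G by auto
  define \<phi> where "\<phi> i = (if i < card G then p (h i) else (\<lambda>_. 0))" for i
  define E where "E i = (if i < card G then e (h i) else 0)" for i
  have B0: "B \<ge> 0" using B[of "[]"] by linarith
  have E: "\<bar>E i\<bar> \<le> B + 3" for i
    using eigenbasis_energy_bound[OF basis hlt B, of i] B0 by (auto simp: E_def)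
  have bound: "(\<Sum>x\<in>A. (\<phi> i x)\<^sup>2) \<le> 1" if A: "finite A" for i A
  proof (cases "i < card G")
    case True
    have "(\<Sum>x\<in>A. (p (h i) x)\<^sup>2) = (\<Sum>x\<in>A \<inter> tree_box L. (p (h i) x)\<^sup>2)"
      by (rule sum.mono_neutral_right) (use A eigenbasis_support[OF basis hlt[OF True]] in auto)
    also have "\<dots> \<le> (\<Sum>x\<in>tree_box L. (p (h i) x)\<^sup>2)" by (rule sum_mono2) auto
    also have "\<dots> = 1" by (rule eigenbasis_norm[OF basis hlt[OF True]])
    finally show ?thesis using True by (simp add: \<phi>_def)
  qed (simp add: \<phi>_def)
  have eq: "schr V (\<lambda>x. of_real (\<phi> i x)) x = of_real (E i * \<phi> i x)" if "x \<in> tree_box L" for i x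
    using eigenbasis_eq[OF basis hlt that, of i] by (cases "i < card G") (auto simp: \<phi>_def E_def schr_def adj_def)
  have sumG: "(\<Sum>i<N. \<phi> i y * \<phi> i x) = (\<Sum>i\<in>G. p i y * p i x)" for x
  proof -
    have "(\<Sum>i<N. \<phi> i y * \<phi> i x) = (\<Sum>i<card G. \<phi> i y * \<phi> i x)"
      by (rule sum.mono_neutral_right) (use G in \<open>auto simp: \<phi>_def\<close>)
    also have "\<dots> = (\<Sum>i<card G. p (h i) y * p (h i) x)" by (simp add: \<phi>_def)
    also have "\<dots> = (\<Sum>i\<in>G. p i y * p i x)" by (rule sum.reindex_bij_betw[OF h])
    finally show ?thesis .
  qed
  have approx: "(\<Sum>x\<in>A. ((if x = y then 1 else 0) - (\<Sum>i<N. \<phi> i y * \<phi> i x))\<^sup>2) \<le> \<epsilon>" if A: "finite A" for A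
  proof -
    let ?G' = "{..<card (tree_box L)} - G"
    let ?d = "\<lambda>x. (if x = y then 1 else 0) - (\<Sum>i\<in>G. p i y * p i x)"
    have yb: "y \<in> tree_box L" using y by (simp add: tree_box_def)
    have out: "?d x = 0" if "x \<notin> tree_box L" for x
    proof -
      have "(\<Sum>i\<in>G. p i y * p i x) = 0"
        by (rule sum.neutral) (use eigenbasis_support[OF basis _ that] G in auto)
      then show ?thesis using that yb by auto
    qed
    have inside: "?d x = (\<Sum>i\<in>?G'. p i y * p i x)" if "x \<in> tree_box L" for x
    proof -
      have "(\<Sum>i<card (tree_box L). p i y * p i x) = (\<Sum>i\<in>?G'. p i y * p i x) + (\<Sum>i\<in>G. p i y * p i x)"
        by (rule sum.subset_diff) (use G in auto)
      then show ?thesis using eigenbasis_complete[OF basis yb that] by auto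
    qed
    have "(\<Sum>x\<in>A. (?d x)\<^sup>2) = (\<Sum>x\<in>A \<inter> tree_box L. (?d x)\<^sup>2)"
      by (rule sum.mono_neutral_right) (use A out in auto)
    also have "\<dots> \<le> (\<Sum>x\<in>tree_box L. (?d x)\<^sup>2)" by (rule sum_mono2) auto
    also have "\<dots> = (\<Sum>x\<in>tree_box L. (\<Sum>i\<in>?G'. p i y * p i x)\<^sup>2)"
      by (intro sum.cong refl) (simp only: inside)
    also have "\<dots> = (\<Sum>i\<in>?G'. (p i y)\<^sup>2)" by (rule orthogonal_expansion_norm[OF basis]) auto
    also have "\<dots> \<le> \<epsilon>" by (rule rest)
    finally show ?thesis unfolding sumG .
  qed
  show ?thesis unfolding approximate_eigensystem_def using E bound eq approx by blast
qed

lemma pointwise_convergent_subsequence: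
  fixes f :: "nat \<Rightarrow> 'a::countable \<Rightarrow> real"
  assumes "\<And>n a. \<bar>f n a\<bar> \<le> R"
  obtains r l where "strict_mono (r :: nat \<Rightarrow> nat)" "\<And>a. (\<lambda>n. f (r n) a) \<longlonglongrightarrow> l a"
proof -
  have "compact (PiE UNIV (\<lambda>_::'a. {-R..R}))"
    unfolding compactin_euclidean_iff[symmetric] euclidean_product_topology[symmetric]
    by (subst compactin_PiE) auto
  then have "seq_compact (PiE UNIV (\<lambda>_::'a. {-R..R}))" by (rule compact_imp_seq_compact)
  moreover have "\<forall>n. f n \<in> PiE UNIV (\<lambda>_::'a. {-R..R})"
    using assms by (auto simp: abs_le_iff minus_le_iff)
  ultimately obtain l r where r: "strict_mono (r :: nat \<Rightarrow> nat)" and lim: "(f \<circ> r) \<longlonglongrightarrow> l"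
    unfolding seq_compact_def by metis
  have "(\<lambda>n. f (r n) a) \<longlonglongrightarrow> l a" for a
    using continuous_on_tendsto_compose[OF continuous_on_product_coordinates[of a] lim] by simp
  with r that show ?thesis by blast
qed

lemma limit_eigensystem:
  assumes ex: "\<And>n. \<exists>\<phi> E. approximate_eigensystem V R y \<epsilon> N (tree_box n) \<phi> E" and R: "R \<ge> 1"
  shows "\<exists>\<phi> E. approximate_eigensystem V R y \<epsilon> N UNIV \<phi> E"
proof -
  from ex have "\<forall>n. \<exists>c. approximate_eigensystem V R y \<epsilon> N (tree_box n) (fst c) (snd c)" by simp
  then have "\<exists>c. \<forall>n. approximate_eigensystem V R y \<epsilon> N (tree_box n) (fst (c n)) (snd (c n))" by (rule choice)
  then obtain c where c: "\<And>n. approximate_eigensystem V R y \<epsilon> N (tree_box n) (fst (c n)) (snd (c n))" by blast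
  define \<phi> where "\<phi> n = fst (c n)" for n
  define E where "E n = snd (c n)" for n
  have Eb: "\<bar>E n i\<bar> \<le> R" and norm: "finite A \<Longrightarrow> (\<Sum>x\<in>A. (\<phi> n i x)\<^sup>2) \<le> 1"
    and eq: "x \<in> tree_box n \<Longrightarrow> schr V (\<lambda>x. of_real (\<phi> n i x)) x = of_real (E n i * \<phi> n i x)"
    and app: "finite A \<Longrightarrow> (\<Sum>x\<in>A. ((if x = y then 1 else 0) - (\<Sum>i<N. \<phi> n i y * \<phi> n i x))\<^sup>2) \<le> \<epsilon>" for n i A x
    using c[of n] unfolding approximate_eigensystem_def \<phi>_def E_def by blast+
  \<comment> \<open>Energies sit at \<open>None\<close> and values at \<open>Some x\<close> of one
    function on a countable set, so a single subsequence serves both; R \<ge> 1 makes R a common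
    bound.\<close>
  define f where "f n a = (case snd a of None \<Rightarrow> E n (fst a) | Some x \<Rightarrow> \<phi> n (fst a) x)"
    for n and a :: "nat \<times> vertex option"
  have "\<bar>f n a\<bar> \<le> R" for n a
  proof (cases "snd a")
    case None
    then show ?thesis by (simp add: f_def Eb)
  next
    case (Some x)
    have "\<bar>\<phi> n (fst a) x\<bar> \<le> 1" using norm[of "{x}" n "fst a"] by (simp add: abs_square_le_1)
    then show ?thesis using Some R by (simp add: f_def)
  qed
  then obtain r l where r: "strict_mono (r :: nat \<Rightarrow> nat)" and lim: "\<And>a. (\<lambda>n. f (r n) a) \<longlonglongrightarrow> l a"
    using pointwise_convergent_subsequence[of f R] by blast
  define X where "X i x = l (i, Some x)" for i x
  define F where "F i = l (i, None)" for i
  have Xl: "(\<lambda>n. \<phi> (r n) i x) \<longlonglongrightarrow> X i x" for i x using lim[of "(i, Some x)"] by (simp add: f_def X_def)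
  have Fl: "(\<lambda>n. E (r n) i) \<longlonglongrightarrow> F i" for i using lim[of "(i, None)"] by (simp add: f_def F_def)
  have "\<bar>F i\<bar> \<le> R" for i
    by (rule LIMSEQ_le_const2[OF tendsto_rabs[OF Fl]]) (use Eb in auto)
  moreover have "(\<Sum>x\<in>A. (X i x)\<^sup>2) \<le> 1" if "finite A" for A i
  proof (rule LIMSEQ_le_const2)
    show "(\<lambda>n. \<Sum>x\<in>A. (\<phi> (r n) i x)\<^sup>2) \<longlonglongrightarrow> (\<Sum>x\<in>A. (X i x)\<^sup>2)" by (intro tendsto_intros Xl)
  qed (use norm that in auto)
  moreover have "(\<Sum>x\<in>A. ((if x = y then 1 else 0) - (\<Sum>i<N. X i y * X i x))\<^sup>2) \<le> \<epsilon>" if "finite A" for A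
  proof (rule LIMSEQ_le_const2)
    show "(\<lambda>n. \<Sum>x\<in>A. ((if x = y then 1 else 0) - (\<Sum>i<N. \<phi> (r n) i y * \<phi> (r n) i x))\<^sup>2)
        \<longlonglongrightarrow> (\<Sum>x\<in>A. ((if x = y then 1 else 0) - (\<Sum>i<N. X i y * X i x))\<^sup>2)" by (intro tendsto_intros Xl)
  qed (use app that in auto)
  moreover have "schr V (\<lambda>x. of_real (X i x)) x = of_real (F i * X i x)" for i x
  proof (rule LIMSEQ_unique)
    have Xc: "(\<lambda>n. complex_of_real (\<phi> (r n) i x)) \<longlonglongrightarrow> of_real (X i x)" for x by (intro tendsto_intros Xl)
    show "(\<lambda>n. schr V (\<lambda>x. of_real (\<phi> (r n) i x)) x) \<longlonglongrightarrow> schr V (\<lambda>x. of_real (X i x)) x"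
      unfolding schr_def adj_def by (cases "x = []") (auto intro!: tendsto_intros Xc Xl)
    \<comment> \<open>The equation at a fixed x holds once the box contains x, and
      \<open>r n\<close> is at least n.\<close>
    have ev: "\<forall>\<^sub>F n in sequentially. schr V (\<lambda>x. of_real (\<phi> (r n) i x)) x = of_real (E (r n) i * \<phi> (r n) i x)"
    proof (rule eventually_sequentiallyI[of "length x"])
      fix n assume "length x \<le> n"
      then have "x \<in> tree_box (r n)" using seq_suble[OF r, of n] by (simp add: tree_box_def)
      then show "schr V (\<lambda>x. of_real (\<phi> (r n) i x)) x = of_real (E (r n) i * \<phi> (r n) i x)" by (rule eq)
    qed
    have "(\<lambda>n. complex_of_real (E (r n) i * \<phi> (r n) i x)) \<longlonglongrightarrow> of_real (F i * X i x)"
      by (intro tendsto_intros Fl Xl)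
    then show "(\<lambda>n. schr V (\<lambda>x. of_real (\<phi> (r n) i x)) x) \<longlonglongrightarrow> of_real (F i * X i x)"
      by (simp only: tendsto_cong[OF ev])
  qed
  ultimately show ?thesis unfolding approximate_eigensystem_def by blast
qed

section \<open>Density of the span of the eigenvectors\<close>

definition eigenspan :: "(vertex \<Rightarrow> real) \<Rightarrow> (vertex \<Rightarrow> complex) set" where
  "eigenspan V = {h. \<exists>F a. finite F \<and> F \<subseteq> {f. eigenvector V f} \<and> h = (\<lambda>x. \<Sum>f\<in>F. a f * f x)}"

text \<open>The squared distance is bounded through finite sums, so closure under addition and
  scaling involves no summability question.\<close>

definition eigen_approximable :: "(vertex \<Rightarrow> real) \<Rightarrow> (vertex \<Rightarrow> complex) \<Rightarrow> bool" where
  "eigen_approximable V g \<longleftrightarrow>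
     (\<forall>\<epsilon>>0. \<exists>h\<in>eigenspan V. \<forall>A. finite A \<longrightarrow> (\<Sum>x\<in>A. (cmod (g x - h x))\<^sup>2) \<le> \<epsilon>)"

lemma eigenspan_zero: "(\<lambda>_. 0) \<in> eigenspan V"
  unfolding eigenspan_def by (rule CollectI, rule exI[of _ "{}"]) auto

lemma eigenspan_add:
  assumes "g \<in> eigenspan V" "h \<in> eigenspan V"
  shows "(\<lambda>x. g x + h x) \<in> eigenspan V"
proof -
  obtain F a where F: "finite F" "F \<subseteq> {f. eigenvector V f}" "g = (\<lambda>x. \<Sum>f\<in>F. a f * f x)"
    using assms(1) unfolding eigenspan_def by blast
  obtain G b where G: "finite G" "G \<subseteq> {f. eigenvector V f}" "h = (\<lambda>x. \<Sum>f\<in>G. b f * f x)"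
    using assms(2) unfolding eigenspan_def by blast
  let ?c = "\<lambda>f. (if f \<in> F then a f else 0) + (if f \<in> G then b f else 0)"
  have "(\<Sum>f\<in>F \<union> G. ?c f * f x) = g x + h x" for x
  proof -
    have "(\<Sum>f\<in>F \<union> G. ?c f * f x)
        = (\<Sum>f\<in>F \<union> G. (if f \<in> F then a f else 0) * f x) + (\<Sum>f\<in>F \<union> G. (if f \<in> G then b f else 0) * f x)"
      by (simp add: distrib_right sum.distrib)
    also have "(\<Sum>f\<in>F \<union> G. (if f \<in> F then a f else 0) * f x) = g x"
      unfolding F(3) by (rule sum.mono_neutral_cong_right) (use F G in auto)
    also have "(\<Sum>f\<in>F \<union> G. (if f \<in> G then b f else 0) * f x) = h x"
      unfolding G(3) by (rule sum.mono_neutral_cong_right) (use F G in auto)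
    finally show ?thesis .
  qed
  then have "(\<lambda>x. g x + h x) = (\<lambda>x. \<Sum>f\<in>F \<union> G. ?c f * f x)" by simp
  then show ?thesis using F G unfolding eigenspan_def by (intro CollectI exI[of _ "F \<union> G"] exI[of _ ?c]) auto
qed

lemma eigenspan_scale:
  assumes "g \<in> eigenspan V"
  shows "(\<lambda>x. c * g x) \<in> eigenspan V"
proof -
  obtain F a where F: "finite F" "F \<subseteq> {f. eigenvector V f}" "g = (\<lambda>x. \<Sum>f\<in>F. a f * f x)"
    using assms(1) unfolding eigenspan_def by blast
  have "(\<lambda>x. c * g x) = (\<lambda>x. \<Sum>f\<in>F. (c * a f) * f x)" unfolding F(3) by (simp add: sum_distrib_left mult.assoc)
  then show ?thesis using F unfolding eigenspan_def by (intro CollectI exI[of _ F] exI[of _ "\<lambda>f. c * a f"]) auto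
qed

lemma eigenspan_sum:
  assumes "\<And>i. i \<in> I \<Longrightarrow> g i \<in> eigenspan V"
  shows "(\<lambda>x. \<Sum>i\<in>I. g i x) \<in> eigenspan V"
  using assms
  by (induction I rule: infinite_finite_induct) (auto simp: eigenspan_zero intro: eigenspan_add)

text \<open>A limit of eigenvectors may vanish identically and is then no eigenvector; working with
  the span absorbs this case.\<close>

lemma solution_in_eigenspan:
  assumes "is_l2 f" "\<And>x. schr V f x = c * f x"
  shows "f \<in> eigenspan V"
proof (cases "f = (\<lambda>_. 0)")
  case False
  then have "eigenvector V f" using assms unfolding eigenvector_def by auto
  then show ?thesis unfolding eigenspan_def by (intro CollectI exI[of _ "{f}"] exI[of _ "\<lambda>_. 1"]) auto
qed (simp add: eigenspan_zero)

lemma sum_cmod_add_squares_le: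
  "(\<Sum>x\<in>A. (cmod (g x + h x))\<^sup>2) \<le> 2 * (\<Sum>x\<in>A. (cmod (g x))\<^sup>2) + 2 * (\<Sum>x\<in>A. (cmod (h x))\<^sup>2)"
proof -
  have "(cmod (g x + h x))\<^sup>2 \<le> 2 * (cmod (g x))\<^sup>2 + 2 * (cmod (h x))\<^sup>2" for x
  proof -
    have "(cmod (g x + h x))\<^sup>2 \<le> (cmod (g x) + cmod (h x))\<^sup>2"
      by (intro power_mono norm_triangle_ineq) simp
    also have "\<dots> \<le> 2 * (cmod (g x))\<^sup>2 + 2 * (cmod (h x))\<^sup>2"
      using zero_le_power2[of "cmod (g x) - cmod (h x)"] by (simp add: power2_eq_square algebra_simps)
    finally show ?thesis .
  qed
  then have "(\<Sum>x\<in>A. (cmod (g x + h x))\<^sup>2) \<le> (\<Sum>x\<in>A. 2 * (cmod (g x))\<^sup>2 + 2 * (cmod (h x))\<^sup>2)"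
    by (intro sum_mono)
  then show ?thesis by (simp add: sum.distrib sum_distrib_left)
qed

lemma eigen_approximable_add:
  assumes "eigen_approximable V g" "eigen_approximable V h"
  shows "eigen_approximable V (\<lambda>x. g x + h x)"
  unfolding eigen_approximable_def
proof (intro allI impI)
  fix \<epsilon> :: real assume "\<epsilon> > 0"
  then have e: "\<epsilon> / 4 > 0" by simp
  obtain g' where g': "g' \<in> eigenspan V" "\<And>A. finite A \<Longrightarrow> (\<Sum>x\<in>A. (cmod (g x - g' x))\<^sup>2) \<le> \<epsilon> / 4"
    using assms(1) e unfolding eigen_approximable_def by blast
  obtain h' where h': "h' \<in> eigenspan V" "\<And>A. finite A \<Longrightarrow> (\<Sum>x\<in>A. (cmod (h x - h' x))\<^sup>2) \<le> \<epsilon> / 4"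
    using assms(2) e unfolding eigen_approximable_def by blast
  show "\<exists>f\<in>eigenspan V. \<forall>A. finite A \<longrightarrow> (\<Sum>x\<in>A. (cmod (g x + h x - f x))\<^sup>2) \<le> \<epsilon>"
  proof (intro bexI allI impI)
    fix A :: "vertex set" assume A: "finite A"
    have "(\<Sum>x\<in>A. (cmod (g x + h x - (g' x + h' x)))\<^sup>2) = (\<Sum>x\<in>A. (cmod ((g x - g' x) + (h x - h' x)))\<^sup>2)"
      by (simp add: algebra_simps)
    also have "\<dots> \<le> 2 * (\<Sum>x\<in>A. (cmod (g x - g' x))\<^sup>2) + 2 * (\<Sum>x\<in>A. (cmod (h x - h' x))\<^sup>2)"
      by (rule sum_cmod_add_squares_le)
    also have "\<dots> \<le> \<epsilon>" using g'(2)[OF A] h'(2)[OF A] by simp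
    finally show "(\<Sum>x\<in>A. (cmod (g x + h x - (g' x + h' x)))\<^sup>2) \<le> \<epsilon>" .
  qed (rule eigenspan_add[OF g'(1) h'(1)])
qed

lemma eigen_approximable_scale:
  assumes "eigen_approximable V g"
  shows "eigen_approximable V (\<lambda>x. c * g x)"
  unfolding eigen_approximable_def
proof (intro allI impI)
  fix \<epsilon> :: real assume "\<epsilon> > 0"
  moreover have d: "(cmod c)\<^sup>2 + 1 > 0" by (simp add: add_nonneg_pos)
  ultimately have e: "\<epsilon> / ((cmod c)\<^sup>2 + 1) > 0" by simp
  obtain g' where g': "g' \<in> eigenspan V" "\<And>A. finite A \<Longrightarrow> (\<Sum>x\<in>A. (cmod (g x - g' x))\<^sup>2) \<le> \<epsilon> / ((cmod c)\<^sup>2 + 1)"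
    using assms(1) e unfolding eigen_approximable_def by blast
  show "\<exists>f\<in>eigenspan V. \<forall>A. finite A \<longrightarrow> (\<Sum>x\<in>A. (cmod (c * g x - f x))\<^sup>2) \<le> \<epsilon>"
  proof (intro bexI allI impI)
    fix A :: "vertex set" assume A: "finite A"
    have "(\<Sum>x\<in>A. (cmod (c * g x - c * g' x))\<^sup>2) = (cmod c)\<^sup>2 * (\<Sum>x\<in>A. (cmod (g x - g' x))\<^sup>2)"
      by (simp add: norm_mult power_mult_distrib sum_distrib_left flip: right_diff_distrib)
    also have "\<dots> \<le> ((cmod c)\<^sup>2 + 1) * (\<epsilon> / ((cmod c)\<^sup>2 + 1))"
      by (intro mult_mono g'(2)[OF A]) (auto intro: sum_nonneg)
    also have "\<dots> = \<epsilon>" using d by simp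
    finally show "(\<Sum>x\<in>A. (cmod (c * g x - c * g' x))\<^sup>2) \<le> \<epsilon>" .
  qed (rule eigenspan_scale[OF g'(1)])
qed

lemma is_l2_finite_tail:
  assumes "is_l2 g" "\<epsilon> > 0"
  obtains D where "finite D" "\<And>A. finite A \<Longrightarrow> A \<inter> D = {} \<Longrightarrow> (\<Sum>x\<in>A. (cmod (g x))\<^sup>2) \<le> \<epsilon>"
proof -
  let ?f = "\<lambda>x. (cmod (g x))\<^sup>2"
  have s: "?f summable_on UNIV" using assms(1) by (simp add: is_l2_def)
  obtain D where D: "finite D" "dist (sum ?f D) (infsum ?f UNIV) \<le> \<epsilon>"
    using infsum_finite_approximation[OF s assms(2)] by auto
  show ?thesis
  proof (rule that[OF D(1)])
    fix A assume A: "finite A" "A \<inter> D = {}"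
    have "sum ?f (A \<union> D) \<le> infsum ?f UNIV" by (rule finite_sum_le_infsum[OF s]) (use A D in auto)
    moreover have "sum ?f (A \<union> D) = sum ?f A + sum ?f D" by (rule sum.union_disjoint) (use A D in auto)
    ultimately show "sum ?f A \<le> \<epsilon>" using D(2) by (simp add: dist_real_def abs_le_iff)
  qed
qed

lemma pure_point_spectrum_if_deltas_approximable:
  assumes delta: "\<And>y. eigen_approximable V (\<lambda>x. if x = y then 1 else 0)"
  shows "pure_point_spectrum V"
  unfolding pure_point_spectrum_def
proof (intro allI impI)
  fix g :: "vertex \<Rightarrow> complex" and \<epsilon> :: real assume g: "is_l2 g" and \<epsilon>: "\<epsilon> > 0"
  \<comment> \<open>The truncation of g and the approximation of the truncated part each cost at
    most \<delta>, and both are doubled when squares are added: the total is at most half of the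
    squared tolerance, which is strictly below it.\<close>
  define \<delta> where "\<delta> = \<epsilon>\<^sup>2 / 8"
  have \<delta>: "\<delta> > 0" using \<epsilon> by (simp add: \<delta>_def)
  obtain D where D: "finite D" "\<And>A. finite A \<Longrightarrow> A \<inter> D = {} \<Longrightarrow> (\<Sum>x\<in>A. (cmod (g x))\<^sup>2) \<le> \<delta>"
    using is_l2_finite_tail[OF g \<delta>] by blast
  have "eigen_approximable V (\<lambda>x. \<Sum>y\<in>S. g y * (if x = y then 1 else 0))" if "finite S" for S
    using that
  proof (induction S)
    case empty
    show ?case unfolding eigen_approximable_def by (intro allI impI bexI[OF _ eigenspan_zero]) simp
  next
    case (insert y S)
    have "(\<lambda>x. \<Sum>y\<in>insert y S. g y * (if x = y then 1 else 0))
        = (\<lambda>x. g y * (if x = y then 1 else 0) + (\<Sum>y\<in>S. g y * (if x = y then 1 else 0)))"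
      by (simp only: sum.insert[OF insert.hyps])
    then show ?case by (simp only: eigen_approximable_add eigen_approximable_scale delta insert.IH)
  qed
  from this[OF D(1)] obtain h where h: "h \<in> eigenspan V"
    "\<And>A. finite A \<Longrightarrow> (\<Sum>x\<in>A. (cmod ((\<Sum>y\<in>D. g y * (if x = y then 1 else 0)) - h x))\<^sup>2) \<le> \<delta>"
    using \<delta> unfolding eigen_approximable_def by blast
  have bound: "(\<Sum>x\<in>A. (cmod (g x - h x))\<^sup>2) \<le> \<epsilon>\<^sup>2 / 2" if A: "finite A" for A
  proof -
    let ?t = "\<lambda>x. \<Sum>y\<in>D. g y * (if x = y then 1 else 0)"
    have t: "?t x = (if x \<in> D then g x else 0)" for x
    proof -
      have "?t x = (\<Sum>y\<in>D. if x = y then g y else 0)" by (intro sum.cong) auto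
      then show ?thesis using D(1) by simp
    qed
    have "(\<Sum>x\<in>A. (cmod (g x - ?t x))\<^sup>2) = (\<Sum>x\<in>A - D. (cmod (g x))\<^sup>2)"
      by (rule sum.mono_neutral_cong_right) (use A in \<open>auto simp: t\<close>)
    also have "\<dots> \<le> \<delta>" by (rule D(2)) (use A in auto)
    finally have 1: "(\<Sum>x\<in>A. (cmod (g x - ?t x))\<^sup>2) \<le> \<delta>" .
    have "(\<Sum>x\<in>A. (cmod (g x - h x))\<^sup>2) = (\<Sum>x\<in>A. (cmod ((g x - ?t x) + (?t x - h x)))\<^sup>2)" by simp
    also have "\<dots> \<le> 2 * (\<Sum>x\<in>A. (cmod (g x - ?t x))\<^sup>2) + 2 * (\<Sum>x\<in>A. (cmod (?t x - h x))\<^sup>2)"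
      by (rule sum_cmod_add_squares_le)
    also have "\<dots> \<le> \<epsilon>\<^sup>2 / 2" using 1 h(2)[OF A] by (simp add: \<delta>_def)
    finally show ?thesis .
  qed
  obtain F a where F: "finite F" "F \<subseteq> {f. eigenvector V f}" "h = (\<lambda>x. \<Sum>f\<in>F. a f * f x)"
    using h(1) unfolding eigenspan_def by blast
  have "(\<lambda>x. (cmod (g x - h x))\<^sup>2) summable_on UNIV"
    by (rule nonneg_bdd_above_summable_on) (auto intro!: bdd_aboveI[of _ "\<epsilon>\<^sup>2 / 2"] bound)
  then have "infsum (\<lambda>x. (cmod (g x - h x))\<^sup>2) UNIV \<le> \<epsilon>\<^sup>2 / 2"
    by (rule infsum_le_finite_sums) (rule bound)
  also have "\<dots> < \<epsilon>\<^sup>2" using \<epsilon> by simp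
  finally have "sqrt (infsum (\<lambda>x. (cmod (g x - h x))\<^sup>2) UNIV) < sqrt (\<epsilon>\<^sup>2)" by (rule real_sqrt_less_mono)
  then have "l2norm (\<lambda>x. g x - (\<Sum>f\<in>F. a f * f x)) < \<epsilon>"
    using \<epsilon> unfolding l2norm_def F(3) by simp
  then show "\<exists>F a. finite F \<and> F \<subseteq> {f. eigenvector V f} \<and> l2norm (\<lambda>x. g x - (\<Sum>f\<in>F. a f * f x)) < \<epsilon>"
    using F by blast
qed

lemma delta_approximable_if_eigensystems:
  assumes "\<And>\<epsilon>. \<epsilon> > 0 \<Longrightarrow> \<exists>N \<phi> E. approximate_eigensystem V R y \<epsilon> N UNIV \<phi> E"
  shows "eigen_approximable V (\<lambda>x. if x = y then 1 else 0)"
  unfolding eigen_approximable_def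
proof (intro allI impI)
  fix \<epsilon> :: real assume "\<epsilon> > 0"
  then obtain N \<phi> E where sys: "approximate_eigensystem V R y \<epsilon> N UNIV \<phi> E" using assms by blast
  have norm: "\<And>i A. finite A \<Longrightarrow> (\<Sum>x\<in>A. (\<phi> i x)\<^sup>2) \<le> 1"
    and eq: "\<And>i x. schr V (\<lambda>x. of_real (\<phi> i x)) x = of_real (E i * \<phi> i x)"
    and app: "\<And>A. finite A \<Longrightarrow> (\<Sum>x\<in>A. ((if x = y then 1 else 0) - (\<Sum>i<N. \<phi> i y * \<phi> i x))\<^sup>2) \<le> \<epsilon>"
    using sys unfolding approximate_eigensystem_def by blast+
  have span: "(\<lambda>x. complex_of_real (\<phi> i x)) \<in> eigenspan V" for i
  proof (rule solution_in_eigenspan)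
    have "(\<lambda>x. (\<phi> i x)\<^sup>2) summable_on UNIV"
      by (rule nonneg_bdd_above_summable_on) (auto intro!: bdd_aboveI[of _ 1] norm)
    then show "is_l2 (\<lambda>x. complex_of_real (\<phi> i x))" by (simp add: is_l2_def)
    show "schr V (\<lambda>x. complex_of_real (\<phi> i x)) x = of_real (E i) * of_real (\<phi> i x)" for x using eq[of i x] by simp
  qed
  show "\<exists>h\<in>eigenspan V. \<forall>A. finite A \<longrightarrow> (\<Sum>x\<in>A. (cmod ((if x = y then 1 else 0) - h x))\<^sup>2) \<le> \<epsilon>"
  proof (intro bexI allI impI)
    fix A :: "vertex set" assume A: "finite A"
    have "cmod ((if x = y then 1 else 0) - (\<Sum>i<N. of_real (\<phi> i y) * of_real (\<phi> i x)))
        = \<bar>(if x = y then 1 else 0) - (\<Sum>i<N. \<phi> i y * \<phi> i x)\<bar>" for x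
    proof -
      have "(if x = y then 1 else 0) - (\<Sum>i<N. of_real (\<phi> i y) * of_real (\<phi> i x))
          = complex_of_real ((if x = y then 1 else 0) - (\<Sum>i<N. \<phi> i y * \<phi> i x))" by simp
      then show ?thesis by (simp only: norm_of_real)
    qed
    then show "(\<Sum>x\<in>A. (cmod ((if x = y then 1 else 0) - (\<Sum>i<N. complex_of_real (\<phi> i y) * of_real (\<phi> i x))))\<^sup>2) \<le> \<epsilon>"
      using app[OF A] by simp
  qed (intro eigenspan_sum eigenspan_scale span)
qed

text \<open>The deterministic half of the argument: once the weighted spectral integrals stay
  bounded along some sequence of boxes, no randomness is left.\<close>

theorem pure_point_spectrum_if_localization_bound:
  fixes v :: "nat \<Rightarrow> bool \<Rightarrow> real"
  assumes B: "\<And>x. \<bar>on_tree v x\<bar> \<le> B"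
    and fin: "\<And>y. liminf (\<lambda>L. liminf (\<lambda>k. \<integral>\<^sup>+E. ennreal (Im (green_diag (shifted v (Complex E (1 / Suc k))) (L + length y) y)) *
          tail_weight v (length y) (L + length y) E * indicator {-(B + 4)..B + 4} E \<partial>lborel)) \<noteq> \<infinity>"
  shows "pure_point_spectrum (on_tree v)"
proof (rule pure_point_spectrum_if_deltas_approximable, rule delta_approximable_if_eigensystems)
  fix y :: vertex and \<epsilon> :: real assume \<epsilon>: "\<epsilon> > 0"
  define m where "m = length y"
  define X where "X L = liminf (\<lambda>k. \<integral>\<^sup>+E. ennreal (Im (green_diag (shifted v (Complex E (1 / Suc k))) (L + m) y)) *
          tail_weight v m (L + m) E * indicator {-(B + 4)..B + 4} E \<partial>lborel)" for L
  have "liminf X \<noteq> \<infinity>" using fin[of y] unfolding X_def m_def .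
  then obtain c where c: "c \<ge> 0" "\<And>n. \<exists>L\<ge>n. X L \<le> ennreal c" using infinitely_often_below_of_liminf by blast
  \<comment> \<open>A Chebyshev constant: M times the delocalized mass is at most c, so the mass is
    at most \<epsilon>. The added 1 keeps M positive when c = 0.\<close>
  define M where "M = (c + 1) / \<epsilon>"
  have M: "M > 0" using c \<epsilon> by (simp add: M_def)
  obtain n1 :: nat where n1: "4 * (4 ^ m * M) < 2 ^ n1" using real_arch_pow[of 2 "4 * (4 ^ m * M)"] by auto
  define n0 where "n0 = max m n1"
  have n0: "m \<le> n0" "4 * (4 ^ m * M) \<le> 2 ^ n0"
  proof -
    have "(2::real) ^ n1 \<le> 2 ^ n0" by (rule power_increasing) (auto simp: n0_def)
    then show "4 * (4 ^ m * M) \<le> 2 ^ n0" using n1 by linarith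
  qed (simp add: n0_def)
  have B0: "B \<ge> 0" using B[of "[]"] by linarith
  \<comment> \<open>The number of functions is fixed through n0, which was chosen from c, \<epsilon>
    and y alone; it is therefore the same for every n, as the limit requires.\<close>
  have "\<exists>\<phi> E. approximate_eigensystem (on_tree v) (B + 3) y \<epsilon> (2 * card (tree_box n0)) (tree_box n) \<phi> E" for n
  proof -
    obtain L' where L': "L' \<ge> n" "X L' \<le> ennreal c" using c(2) by blast
    define L where "L = L' + m"
    have y: "length y \<le> L" by (simp add: L_def m_def)
    obtain p e where basis: "box_eigenbasis L (on_tree v) p e" using box_eigenbasis_exists by blast
    let ?G = "{i. i < card (tree_box L) \<and> regular v m L (e i) \<and> tail_weight v m L (e i) \<le> ennreal M}"
    let ?D = "{i. i < card (tree_box L) \<and> \<not> (regular v m L (e i) \<and> tail_weight v m L (e i) \<le> ennreal M)}"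
    have D: "{..<card (tree_box L)} - ?G = ?D" by auto
    have "ennreal M * ennreal (\<Sum>i\<in>?D. (p i y)\<^sup>2) \<le> X L'"
      unfolding X_def L_def[symmetric] by (rule delocalized_mass_bound[OF basis B y])
    also have "\<dots> \<le> ennreal c" by (rule L'(2))
    finally have "ennreal (M * (\<Sum>i\<in>?D. (p i y)\<^sup>2)) \<le> ennreal c" using M by (simp add: ennreal_mult')
    then have "M * (\<Sum>i\<in>?D. (p i y)\<^sup>2) \<le> c" using c(1) by (simp add: ennreal_le_iff)
    also have "\<dots> \<le> M * \<epsilon>" using \<epsilon> by (simp add: M_def)
    finally have "(\<Sum>i\<in>{..<card (tree_box L)} - ?G. (p i y)\<^sup>2) \<le> \<epsilon>" unfolding D using M by simp
    moreover have "card ?G \<le> 2 * card (tree_box n0)"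
      by (rule card_localized_eigenvectors[OF basis _ n0]) (use M in simp)
    moreover have "?G \<subseteq> {..<card (tree_box L)}" by auto
    ultimately obtain \<phi> E where "approximate_eigensystem (on_tree v) (B + 3) y \<epsilon> (2 * card (tree_box n0)) (tree_box L) \<phi> E"
      using finite_volume_eigensystem[OF basis y B, of ?G] by blast
    moreover have "tree_box n \<subseteq> tree_box L" using L'(1) by (auto simp: tree_box_def L_def)
    ultimately have "approximate_eigensystem (on_tree v) (B + 3) y \<epsilon> (2 * card (tree_box n0)) (tree_box n) \<phi> E"
      unfolding approximate_eigensystem_def by blast
    then show ?thesis by blast
  qed
  then have "\<exists>\<phi> E. approximate_eigensystem (on_tree v) (B + 3) y \<epsilon> (2 * card (tree_box n0)) UNIV \<phi> E"
    by (rule limit_eigensystem) (use B0 in simp)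
  then show "\<exists>N \<phi> E. approximate_eigensystem (on_tree v) (B + 3) y \<epsilon> N UNIV \<phi> E" by blast
qed

section \<open>Pure point spectrum\<close>

lemma has_bounded_density_eventually_bounded_by:
  assumes "has_bounded_density \<mu>"
  obtains C where "\<And>C'. C' \<ge> C \<Longrightarrow> density_bounded_by C' \<mu>"
proof -
  obtain f C where f: "f \<in> borel_measurable lborel" "\<And>x. 0 \<le> f x \<and> f x \<le> C"
    "\<mu> = density lborel (\<lambda>x. ennreal (f x))"
    using assms unfolding has_bounded_density_def by blast
  have "density_bounded_by C' \<mu>" if "C' \<ge> C" for C'
    unfolding density_bounded_by_def using f that by (intro exI[of _ f]) (auto intro: order_trans)
  then show ?thesis by (rule that)
qed

context strongly_disordered_tree
begin

text \<open>There are countably many vertices y, so one null set serves all of them.\<close>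

lemma AE_pure_point_spectrum: "AE \<omega> in T. pure_point_spectrum (potential \<kappa> \<omega>)"
proof -
  have "AE \<omega> in T. \<forall>y. liminf (\<lambda>L. localization_bound \<omega> y (L + length y)) \<noteq> \<infinity>"
    unfolding AE_all_countable using AE_localization_bound by blast
  then show ?thesis using AE_potential_bounded
  proof eventually_elim
    case (elim \<omega>)
    have "pure_point_spectrum (on_tree (vpot \<omega>))"
    proof (rule pure_point_spectrum_if_localization_bound)
      show "\<bar>on_tree (vpot \<omega>) x\<bar> \<le> K + \<kappa>" for x using elim by blast
    qed (use elim in \<open>simp add: localization_bound_def\<close>)
    then show ?case by (simp only: potential_eq_on_tree)
  qed
qed

end

theorem theorem1p3:
  fixes \<nu>0 \<nu> :: "real measure" and \<sigma> :: "(real \<times> real) measure" and K :: real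
  assumes "prob_space \<nu>0" and "prob_space \<nu>"
    and "has_bounded_density \<nu>0" and "has_bounded_density \<nu>"
    and "emeasure \<nu>0 (- {-K..K}) = 0" and "emeasure \<nu> (- {-K..K}) = 0"
    and "prob_space \<sigma>" and "sets \<sigma> = sets borel"
    and "emeasure \<sigma> (- ({-1..1} \<times> {-1..1})) = 0"
    and "has_bounded_density (distr \<sigma> borel fst)"
    and "has_bounded_density (distr \<sigma> borel snd)"
  shows "\<exists>\<kappa>1. \<forall>\<kappa>\<ge>\<kappa>1. AE \<omega> in tree_model \<nu>0 \<nu> \<sigma>. pure_point_spectrum (potential \<kappa> \<omega>)"
proof -
  obtain C1 where C1: "\<And>C. C \<ge> C1 \<Longrightarrow> density_bounded_by C \<nu>0"
    using has_bounded_density_eventually_bounded_by[OF assms(3)] by blast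
  obtain C2 where C2: "\<And>C. C \<ge> C2 \<Longrightarrow> density_bounded_by C \<nu>"
    using has_bounded_density_eventually_bounded_by[OF assms(4)] by blast
  obtain C3 where C3: "\<And>C. C \<ge> C3 \<Longrightarrow> density_bounded_by C (distr \<sigma> borel fst)"
    using has_bounded_density_eventually_bounded_by[OF assms(10)] by blast
  obtain C4 where C4: "\<And>C. C \<ge> C4 \<Longrightarrow> density_bounded_by C (distr \<sigma> borel snd)"
    using has_bounded_density_eventually_bounded_by[OF assms(11)] by blast
  define C where "C = Max {1, C1, C2, C3, C4}"
  have C: "C \<ge> 1" "C \<ge> C1" "C \<ge> C2" "C \<ge> C3" "C \<ge> C4" by (auto simp: C_def)
  \<comment> \<open>The locale asks for a positive radius; enlarging the interval to
    \<open>max K 1\<close> provides one and keeps the complement null.\<close>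
  have support: "emeasure \<mu> (- {- max K 1..max K 1}) = 0"
    if "emeasure \<mu> (- {-K..K}) = 0" "has_bounded_density \<mu>" for \<mu> :: "real measure"
  proof -
    have "sets \<mu> = sets borel" using that(2) by (auto simp: has_bounded_density_def)
    then have "emeasure \<mu> (- {- max K 1..max K 1}) \<le> emeasure \<mu> (- {-K..K})"
      by (intro emeasure_mono) auto
    then show ?thesis using that(1) by simp
  qed
  have "AE \<omega> in tree_model \<nu>0 \<nu> \<sigma>. pure_point_spectrum (potential \<kappa> \<omega>)" if \<kappa>: "\<kappa> \<ge> 4096 * C" for \<kappa>
  proof -
    note bounds = C1[OF C(2)] C2[OF C(3)] C3[OF C(4)] C4[OF C(5)]
      support[OF assms(5,3)] support[OF assms(6,4)]
    interpret strongly_disordered_tree \<nu>0 \<nu> \<sigma> "max K 1" C \<kappa>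
      by (rule strongly_disordered_tree.intro; (fact assms | fact bounds | use C(1) \<kappa> in simp))
    show ?thesis by (rule AE_pure_point_spectrum)
  qed
  then show ?thesis by blast
qed

end
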